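(* Let $F_1\subseteq E_1$ and $F_2\subseteq E_2$ be admissible inclusions of directed graphs such that: (1) $E_1$ has no loops, $E_2$ has no short loops at vertices in $E_2^0\setminus F_2^0$, $E_1^0=E_2^0$, and $F_1^0=F_2^0$; (2) there is a functor $f\colon E_1\to E_2$ (between the path categories of $E_1$ and $E_2$) such that: for all $\alpha,\beta\in\mathrm{Path}(E_1)$, $f(\alpha)\preceq f(\beta)$ implies $\alpha\preceq\beta$; $f$ is the identity on objects; and the image of $f$ (on morphisms, i.e. on paths) is the set of all pointed paths in $E_2$. Then there exist induced $*$-homomorphisms $f_*\colon C^*(E_1)\to C^*(E_2)$ and $f|_*\colon C^*(F_1)\to C^*(F_2)$, determined by $f_*(P_v)=P_{f(v)}$, $f_*(S_e)=S_{f(e)}$ for $v\in E_1^0$, $e\in E_1^1$, and by the same formulas for $f|_*$ with $v\in F_1^0$, $e\in F_1^1$ (i.e. $f|_*$ is induced by the restriction-corestriction $F_1\to F_2$ of $f$), and the diagram formed by $$\pi_1\colon C^*(E_1)\to C^*(F_1),\quad f_*\colon C^*(E_1)\to C^*(E_2),\quad f|_*\colon C^*(F_1)\to C^*(F_2),\quad \pi_2\colon C^*(E_2)\to C^*(F_2)$$ is a pullback diagram of C*-algebras; that is, $f|_*\circ\pi_1=\pi_2\circ f_*$ and the map $c\mapsto(\pi_1(c),f_*(c))$ is an isomorphism from $C^*(E_1)$ onto $\{(a,b)\in C^*(F_1)\oplus C^*(E_2) : f|_*(a)=\pi_2(b)\}$. If $E_1^0$ is finite, then this is a pullback diagram of unital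 C*-algebras (all four algebras and all four maps are unital).
   Context: A directed graph is $E=(E^0,E^1,s_E,r_E)$ with countable vertex set $E^0$, countable edge set $E^1$, source map $s_E$ and range map $r_E\colon E^1\to E^0$. A vertex is regular if it emits at least one and at most finitely many edges. The graph C*-algebra $C^*(E)$ is the universal C*-algebra generated by mutually orthogonal projections $\{P_v : v\in E^0\}$ and partial isometries $\{S_e : e\in E^1\}$ subject to: (GA1) $S_e^*S_f=\delta_{e,f}P_{r(e)}$ for all $e,f\in E^1$; (GA2) $\sum_{e\in s^{-1}(v)}S_eS_e^*=P_v$ for all $v\in E^0$ with $0<|s^{-1}(v)|<\infty$; (GA3) $S_eS_e^*\le P_{s(e)}$ for all $e\in E^1$. A path is a finite sequence $(e_1,\dots,e_n)$ of edges with $r(e_i)=s(e_{i+1})$; vertices are paths of length zero. $\mathrm{Path}(E)$ is the set of all paths; source and range extend to paths; $S_\alpha=S_{e_1}\cdots S_{e_n}$ for $\alpha=(e_1,\dots,e_n)$ and $S_v=P_v$ for a vertex $v$. A loop is a path $\alpha$, not a vertex, with $s(\alpha)=r(\alpha)$; a loop is short if it is a single edge. A path is pointed if its final edge is not a loop; paths of length zero (vertices) count as pointed. Write $\beta\preceq\alpha$ if $\alpha=\beta\gamma$ for some path $\gamma$ with $s(\gamma)=r(\beta)$. The graph $E$ is viewed as a small category whose objects are vertices and whose morphisms are paths, with concatenation as composition and vertices as identities; a functor between graphs means a functor between these categories (it sends vertices to vertices, and edges to paths). A subset $H\subseteq E^0$ is hereditary if whenever $v\in H$ and there is a path from $v$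 to $w$, then $w\in H$; it is saturated if there is no regular vertex $v\notin H$ with $r(s^{-1}(v))\subseteq H$. An inclusion of a subgraph $D\subseteq E$ (vertices, edges, source and range maps of $D$ being restrictions of those of $E$) is admissible if: (A1) $E^0\setminus D^0$ is hereditary and saturated; (A2) $D^1=r_E^{-1}(D^0)$; (A3) no vertex in $E^0$ emits infinitely many edges into $E^0\setminus D^0$ while emitting finitely many (but not zero) edges into $D^0$. For an admissible inclusion $F_i\subseteq E_i$, $\pi_i\colon C^*(E_i)\to C^*(F_i)$ is the canonical surjection: $\pi_i(P_v)=P_v$ if $v\in F_i^0$ and $0$ otherwise, $\pi_i(S_e)=S_e$ if $e\in F_i^1$ and $0$ otherwise. (It is the quotient map by the ideal generated by $\{P_v: v\in E_i^0\setminus F_i^0\}$.) *)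

theory Defs
  imports
    "HOL-Analysis.Analysis"
    "HOL-Library.Poly_Mapping"
    "Graph_Theory.Digraph_Component"
    "Graph_Theory.Arc_Walk"
begin

section \<open>C*-algebras\<close>

text \<open>
  Complex C*-algebras with an explicit carrier and not necessarily unital. The norm and the
  operations matter only on the carrier. The zero algebra is allowed, and it is unital.
\<close>

record 'a cstar =
  celems :: "'a set"
  czero :: 'a
  cadd :: "'a \<Rightarrow> 'a \<Rightarrow> 'a"
  cscale :: "complex \<Rightarrow> 'a \<Rightarrow> 'a"
  cmult :: "'a \<Rightarrow> 'a \<Rightarrow> 'a"
  cadj :: "'a \<Rightarrow> 'a"
  cnrm :: "'a \<Rightarrow> real"

definition cdist :: "'a cstar \<Rightarrow> 'a \<Rightarrow> 'a \<Rightarrow> real" where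
  "cdist A x y = cnrm A (cadd A x (cscale A (- 1) y))"

locale cstar_algebra =
  fixes A :: "'a cstar"
  assumes zero_closed: "czero A \<in> celems A"
    and add_closed: "\<lbrakk>x \<in> celems A; y \<in> celems A\<rbrakk> \<Longrightarrow> cadd A x y \<in> celems A"
    and scale_closed: "x \<in> celems A \<Longrightarrow> cscale A c x \<in> celems A"
    and mult_closed: "\<lbrakk>x \<in> celems A; y \<in> celems A\<rbrakk> \<Longrightarrow> cmult A x y \<in> celems A"
    and adj_closed: "x \<in> celems A \<Longrightarrow> cadj A x \<in> celems A"
    and add_assoc: "\<lbrakk>x \<in> celems A; y \<in> celems A; z \<in> celems A\<rbrakk>
      \<Longrightarrow> cadd A (cadd A x y) z = cadd A x (cadd A y z)"
    and add_commute: "\<lbrakk>x \<in> celems A; y \<in> celems A\<rbrakk> \<Longrightarrow> cadd A x y = cadd A y x"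
    and add_zero: "x \<in> celems A \<Longrightarrow> cadd A x (czero A) = x"
    and add_neg: "x \<in> celems A \<Longrightarrow> cadd A x (cscale A (- 1) x) = czero A"
    and scale_add_right: "\<lbrakk>x \<in> celems A; y \<in> celems A\<rbrakk>
      \<Longrightarrow> cscale A c (cadd A x y) = cadd A (cscale A c x) (cscale A c y)"
    and scale_add_left: "x \<in> celems A
      \<Longrightarrow> cscale A (c + d) x = cadd A (cscale A c x) (cscale A d x)"
    and scale_scale: "x \<in> celems A \<Longrightarrow> cscale A c (cscale A d x) = cscale A (c * d) x"
    and scale_one: "x \<in> celems A \<Longrightarrow> cscale A 1 x = x"
    and mult_assoc: "\<lbrakk>x \<in> celems A; y \<in> celems A; z \<in> celems A\<rbrakk>
      \<Longrightarrow> cmult A (cmult A x y) z = cmult A x (cmult A y z)"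
    and mult_add_left: "\<lbrakk>x \<in> celems A; y \<in> celems A; z \<in> celems A\<rbrakk>
      \<Longrightarrow> cmult A (cadd A x y) z = cadd A (cmult A x z) (cmult A y z)"
    and mult_add_right: "\<lbrakk>x \<in> celems A; y \<in> celems A; z \<in> celems A\<rbrakk>
      \<Longrightarrow> cmult A x (cadd A y z) = cadd A (cmult A x y) (cmult A x z)"
    and mult_scale_left: "\<lbrakk>x \<in> celems A; y \<in> celems A\<rbrakk>
      \<Longrightarrow> cmult A (cscale A c x) y = cscale A c (cmult A x y)"
    and mult_scale_right: "\<lbrakk>x \<in> celems A; y \<in> celems A\<rbrakk>
      \<Longrightarrow> cmult A x (cscale A c y) = cscale A c (cmult A x y)"
    and adj_add: "\<lbrakk>x \<in> celems A; y \<in> celems A\<rbrakk>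
      \<Longrightarrow> cadj A (cadd A x y) = cadd A (cadj A x) (cadj A y)"
    and adj_scale: "x \<in> celems A \<Longrightarrow> cadj A (cscale A c x) = cscale A (cnj c) (cadj A x)"
    and adj_mult: "\<lbrakk>x \<in> celems A; y \<in> celems A\<rbrakk>
      \<Longrightarrow> cadj A (cmult A x y) = cmult A (cadj A y) (cadj A x)"
    and adj_adj: "x \<in> celems A \<Longrightarrow> cadj A (cadj A x) = x"
    and norm_nonneg: "x \<in> celems A \<Longrightarrow> 0 \<le> cnrm A x"
    and norm_eq_zero: "x \<in> celems A \<Longrightarrow> cnrm A x = 0 \<longleftrightarrow> x = czero A"
    and norm_scale: "x \<in> celems A \<Longrightarrow> cnrm A (cscale A c x) = cmod c * cnrm A x"
    and norm_triangle: "\<lbrakk>x \<in> celems A; y \<in> celems A\<rbrakk>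
      \<Longrightarrow> cnrm A (cadd A x y) \<le> cnrm A x + cnrm A y"
    and norm_mult: "\<lbrakk>x \<in> celems A; y \<in> celems A\<rbrakk>
      \<Longrightarrow> cnrm A (cmult A x y) \<le> cnrm A x * cnrm A y"
    and cstar_identity: "x \<in> celems A \<Longrightarrow> cnrm A (cmult A (cadj A x) x) = (cnrm A x)\<^sup>2"
    and complete: "\<lbrakk>\<And>n::nat. X n \<in> celems A;
        \<And>e. e > 0 \<Longrightarrow> \<exists>M. \<forall>m\<ge>M. \<forall>n\<ge>M. cdist A (X m) (X n) < e\<rbrakk>
      \<Longrightarrow> \<exists>x\<in>celems A. (\<lambda>n. cdist A (X n) x) \<longlonglongrightarrow> 0"

text \<open>
  Homomorphisms are extensional functions, so that equality of homomorphisms means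
  equality on the carrier. Continuity is automatic and is not required.
\<close>

definition star_hom :: "'a cstar \<Rightarrow> 'b cstar \<Rightarrow> ('a \<Rightarrow> 'b) \<Rightarrow> bool" where
  "star_hom A B \<phi> \<longleftrightarrow>
     \<phi> \<in> celems A \<rightarrow>\<^sub>E celems B \<and>
     (\<forall>x\<in>celems A. \<forall>y\<in>celems A. \<phi> (cadd A x y) = cadd B (\<phi> x) (\<phi> y)) \<and>
     (\<forall>c. \<forall>x\<in>celems A. \<phi> (cscale A c x) = cscale B c (\<phi> x)) \<and>
     (\<forall>x\<in>celems A. \<forall>y\<in>celems A. \<phi> (cmult A x y) = cmult B (\<phi> x) (\<phi> y)) \<and>
     (\<forall>x\<in>celems A. \<phi> (cadj A x) = cadj B (\<phi> x))"

definition star_iso :: "'a cstar \<Rightarrow> 'b cstar \<Rightarrow> ('a \<Rightarrow> 'b) \<Rightarrow> bool" where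
  "star_iso A B \<phi> \<longleftrightarrow> star_hom A B \<phi> \<and> bij_betw \<phi> (celems A) (celems B)"

definition is_cunit :: "'a cstar \<Rightarrow> 'a \<Rightarrow> bool" where
  "is_cunit A u \<longleftrightarrow> u \<in> celems A \<and> (\<forall>x\<in>celems A. cmult A u x = x \<and> cmult A x u = x)"

definition unital_cstar :: "'a cstar \<Rightarrow> bool" where
  "unital_cstar A \<longleftrightarrow> (\<exists>u. is_cunit A u)"

definition unital_map :: "'a cstar \<Rightarrow> 'b cstar \<Rightarrow> ('a \<Rightarrow> 'b) \<Rightarrow> bool" where
  "unital_map A B \<phi> \<longleftrightarrow> (\<forall>u. is_cunit A u \<longrightarrow> is_cunit B (\<phi> u))"

definition cstar_sum :: "'a cstar \<Rightarrow> 'b cstar \<Rightarrow> ('a \<times> 'b) cstar" where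
  "cstar_sum A B =
     \<lparr>celems = celems A \<times> celems B,
      czero = (czero A, czero B),
      cadd = (\<lambda>(a, b) (a', b'). (cadd A a a', cadd B b b')),
      cscale = (\<lambda>c (a, b). (cscale A c a, cscale B c b)),
      cmult = (\<lambda>(a, b) (a', b'). (cmult A a a', cmult B b b')),
      cadj = (\<lambda>(a, b). (cadj A a, cadj B b)),
      cnrm = (\<lambda>(a, b). max (cnrm A a) (cnrm B b))\<rparr>"

definition fiber_product ::
    "'a cstar \<Rightarrow> 'b cstar \<Rightarrow> ('a \<Rightarrow> 'c) \<Rightarrow> ('b \<Rightarrow> 'c) \<Rightarrow> ('a \<times> 'b) cstar" where
  "fiber_product A B \<phi> \<psi> =
     (cstar_sum A B)\<lparr>celems := {(a, b). a \<in> celems A \<and> b \<in> celems B \<and> \<phi> a = \<psi> b}\<rparr>"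

text \<open>
  The square with \<open>p: C \<rightarrow> A\<close>, \<open>q: C \<rightarrow> B\<close>, \<open>\<phi>: A \<rightarrow> D\<close> and \<open>\<psi>: B \<rightarrow> D\<close>.
\<close>

definition pullback_diagram ::
    "'c cstar \<Rightarrow> 'a cstar \<Rightarrow> 'b cstar \<Rightarrow> 'd cstar \<Rightarrow>
     ('c \<Rightarrow> 'a) \<Rightarrow> ('c \<Rightarrow> 'b) \<Rightarrow> ('a \<Rightarrow> 'd) \<Rightarrow> ('b \<Rightarrow> 'd) \<Rightarrow> bool" where
  "pullback_diagram C A B D p q \<phi> \<psi> \<longleftrightarrow>
     cstar_algebra C \<and> cstar_algebra A \<and> cstar_algebra B \<and> cstar_algebra D \<and>
     star_hom C A p \<and> star_hom C B q \<and> star_hom A D \<phi> \<and> star_hom B D \<psi> \<and>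
     (\<forall>c\<in>celems C. \<phi> (p c) = \<psi> (q c)) \<and>
     star_iso C (fiber_product A B \<phi> \<psi>) (\<lambda>c\<in>celems C. (p c, q c))"

definition unital_pullback_diagram ::
    "'c cstar \<Rightarrow> 'a cstar \<Rightarrow> 'b cstar \<Rightarrow> 'd cstar \<Rightarrow>
     ('c \<Rightarrow> 'a) \<Rightarrow> ('c \<Rightarrow> 'b) \<Rightarrow> ('a \<Rightarrow> 'd) \<Rightarrow> ('b \<Rightarrow> 'd) \<Rightarrow> bool" where
  "unital_pullback_diagram C A B D p q \<phi> \<psi> \<longleftrightarrow>
     pullback_diagram C A B D p q \<phi> \<psi> \<and>
     unital_cstar C \<and> unital_cstar A \<and> unital_cstar B \<and> unital_cstar D \<and>
     unital_map C A p \<and> unital_map C B q \<and> unital_map A D \<phi> \<and> unital_map B D \<psi>"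


section \<open>Noncommutative *-polynomials\<close>

text \<open>
  A word is a list of letters; the letter \<open>(g, False)\<close> stands for the generator \<open>g\<close> and
  \<open>(g, True)\<close> for its adjoint. The wrapper type makes words a monoid, so that
  \<open>'g word \<Rightarrow>\<^sub>0 complex\<close> carries the convolution product of the library and is the
  free unital complex *-algebra over \<open>'g\<close>.
\<close>

datatype 'g word = Word (letters: "('g \<times> bool) list")

instantiation word :: (type) monoid_add
begin

definition zero_word :: "'a word" where "0 = Word []"

definition plus_word :: "'a word \<Rightarrow> 'a word \<Rightarrow> 'a word" where
  "u + w = Word (letters u @ letters w)"

instance
  by standard (simp_all add: zero_word_def plus_word_def)

end

type_synonym 'g star_poly = "'g word \<Rightarrow>\<^sub>0 complex"

definition poly_gen :: "'g \<Rightarrow> 'g star_poly" where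
  "poly_gen g = Poly_Mapping.single (Word [(g, False)]) 1"

definition poly_scale :: "complex \<Rightarrow> 'g star_poly \<Rightarrow> 'g star_poly" where
  "poly_scale c p = Poly_Mapping.single 0 c * p"

definition word_adj :: "'g word \<Rightarrow> 'g word" where
  "word_adj w = Word (rev (map (\<lambda>(g, b). (g, \<not> b)) (letters w)))"

text \<open>The coefficient of \<open>w\<close> in \<open>poly_adj p\<close> is the conjugate of that of \<open>word_adj w\<close> in \<open>p\<close>.\<close>

definition poly_adj :: "'g star_poly \<Rightarrow> 'g star_poly" where
  "poly_adj p = Poly_Mapping.map cnj (Poly_Mapping.map_key word_adj p)"

text \<open>The *-polynomials without constant term, in the generators from \<open>G\<close>.\<close>

definition star_polys :: "'g set \<Rightarrow> 'g star_poly set" where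
  "star_polys G = {p. \<forall>w\<in>Poly_Mapping.keys p. letters w \<noteq> [] \<and> fst ` set (letters w) \<subseteq> G}"


section \<open>Universal C*-algebras given by generators and relations\<close>

text \<open>
  A set \<open>R\<close> of *-polynomials stands for the relations \<open>r = 0\<close>, \<open>r \<in> R\<close>. The universal
  C*-algebra is the Hausdorff completion of the free *-algebra in the largest C*-seminorm
  vanishing on \<open>R\<close>. It exists iff the supremum below is finite, which holds for graph
  algebras, as every generator is forced to be a partial isometry.
\<close>

definition cstar_seminorm :: "'g set \<Rightarrow> ('g star_poly \<Rightarrow> real) \<Rightarrow> bool" where
  "cstar_seminorm G N \<longleftrightarrow>
     (\<forall>p\<in>star_polys G. 0 \<le> N p) \<and>
     (\<forall>c. \<forall>p\<in>star_polys G. N (poly_scale c p) = cmod c * N p) \<and>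
     (\<forall>p\<in>star_polys G. \<forall>q\<in>star_polys G. N (p + q) \<le> N p + N q) \<and>
     (\<forall>p\<in>star_polys G. \<forall>q\<in>star_polys G. N (p * q) \<le> N p * N q) \<and>
     (\<forall>p\<in>star_polys G. N (poly_adj p * p) = (N p)\<^sup>2)"

definition universal_seminorm :: "'g set \<Rightarrow> 'g star_poly set \<Rightarrow> 'g star_poly \<Rightarrow> real" where
  "universal_seminorm G R p = (SUP N\<in>{N. cstar_seminorm G N \<and> (\<forall>r\<in>R. N r = 0)}. N p)"

definition cauchy_seqs :: "'g set \<Rightarrow> 'g star_poly set \<Rightarrow> (nat \<Rightarrow> 'g star_poly) set" where
  "cauchy_seqs G R = {X. range X \<subseteq> star_polys G \<and>
     (\<forall>e>0. \<exists>M. \<forall>m\<ge>M. \<forall>n\<ge>M. universal_seminorm G R (X m - X n) < e)}"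

definition cauchy_rel ::
    "'g set \<Rightarrow> 'g star_poly set \<Rightarrow> ((nat \<Rightarrow> 'g star_poly) \<times> (nat \<Rightarrow> 'g star_poly)) set" where
  "cauchy_rel G R = {(X, Y). X \<in> cauchy_seqs G R \<and> Y \<in> cauchy_seqs G R \<and>
     (\<lambda>n. universal_seminorm G R (X n - Y n)) \<longlonglongrightarrow> 0}"

definition cauchy_class ::
    "'g set \<Rightarrow> 'g star_poly set \<Rightarrow> (nat \<Rightarrow> 'g star_poly) \<Rightarrow> (nat \<Rightarrow> 'g star_poly) set" where
  "cauchy_class G R X = cauchy_rel G R `` {X}"

definition cauchy_rep :: "(nat \<Rightarrow> 'g star_poly) set \<Rightarrow> nat \<Rightarrow> 'g star_poly" where
  "cauchy_rep x = (SOME X. X \<in> x)"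

definition universal_cstar ::
    "'g set \<Rightarrow> 'g star_poly set \<Rightarrow> (nat \<Rightarrow> 'g star_poly) set cstar" where
  "universal_cstar G R =
     \<lparr>celems = cauchy_seqs G R // cauchy_rel G R,
      czero = cauchy_class G R (\<lambda>n. 0),
      cadd = (\<lambda>x y. cauchy_class G R (\<lambda>n. cauchy_rep x n + cauchy_rep y n)),
      cscale = (\<lambda>c x. cauchy_class G R (\<lambda>n. poly_scale c (cauchy_rep x n))),
      cmult = (\<lambda>x y. cauchy_class G R (\<lambda>n. cauchy_rep x n * cauchy_rep y n)),
      cadj = (\<lambda>x. cauchy_class G R (\<lambda>n. poly_adj (cauchy_rep x n))),
      cnrm = (\<lambda>x. lim (\<lambda>n. universal_seminorm G R (cauchy_rep x n)))\<rparr>"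

definition universal_gen ::
    "'g set \<Rightarrow> 'g star_poly set \<Rightarrow> 'g \<Rightarrow> (nat \<Rightarrow> 'g star_poly) set" where
  "universal_gen G R g = cauchy_class G R (\<lambda>n. poly_gen g)"


section \<open>Directed graphs and their path categories\<close>

definition directed_graph :: "('v, 'e) pre_digraph \<Rightarrow> bool" where
  "directed_graph E \<longleftrightarrow> wf_digraph E \<and> countable (verts E) \<and> countable (arcs E)"

definition regular_vertex :: "('v, 'e) pre_digraph \<Rightarrow> 'v \<Rightarrow> bool" where
  "regular_vertex E v \<longleftrightarrow> v \<in> verts E \<and> out_arcs E v \<noteq> {} \<and> finite (out_arcs E v)"

text \<open>
  A path is the pair of its source and its list of edges; \<open>(v, [])\<close> is the path of
  length zero at the vertex \<open>v\<close>.
\<close>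

type_synonym ('v, 'e) path = "'v \<times> 'e list"

definition paths :: "('v, 'e) pre_digraph \<Rightarrow> ('v, 'e) path set" where
  "paths E = {(u, p). \<exists>v. pre_digraph.awalk E u p v}"

definition path_source :: "('v, 'e) path \<Rightarrow> 'v" where
  "path_source \<alpha> = fst \<alpha>"

definition path_range :: "('v, 'e) pre_digraph \<Rightarrow> ('v, 'e) path \<Rightarrow> 'v" where
  "path_range E \<alpha> = pre_digraph.awlast E (fst \<alpha>) (snd \<alpha>)"

definition path_concat :: "('v, 'e) path \<Rightarrow> ('v, 'e) path \<Rightarrow> ('v, 'e) path" where
  "path_concat \<alpha> \<beta> = (fst \<alpha>, snd \<alpha> @ snd \<beta>)"

definition vertex_path :: "'v \<Rightarrow> ('v, 'e) path" where
  "vertex_path v = (v, [])"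

definition edge_path :: "('v, 'e) pre_digraph \<Rightarrow> 'e \<Rightarrow> ('v, 'e) path" where
  "edge_path E e = (tail E e, [e])"

definition path_le :: "('v, 'e) pre_digraph \<Rightarrow> ('v, 'e) path \<Rightarrow> ('v, 'e) path \<Rightarrow> bool" where
  "path_le E \<beta> \<alpha> \<longleftrightarrow>
     (\<exists>\<gamma>\<in>paths E. path_source \<gamma> = path_range E \<beta> \<and> \<alpha> = path_concat \<beta> \<gamma>)"

definition is_loop :: "('v, 'e) pre_digraph \<Rightarrow> ('v, 'e) path \<Rightarrow> bool" where
  "is_loop E \<alpha> \<longleftrightarrow> \<alpha> \<in> paths E \<and> snd \<alpha> \<noteq> [] \<and> path_source \<alpha> = path_range E \<alpha>"

definition pointed_path :: "('v, 'e) pre_digraph \<Rightarrow> ('v, 'e) path \<Rightarrow> bool" where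
  "pointed_path E \<alpha> \<longleftrightarrow>
     \<alpha> \<in> paths E \<and> (snd \<alpha> = [] \<or> \<not> is_loop E (edge_path E (last (snd \<alpha>))))"

text \<open>Functors between path categories, given by their object part \<open>f0\<close> and their
  morphism part \<open>f1\<close>.\<close>

definition path_functor ::
    "('v, 'e) pre_digraph \<Rightarrow> ('w, 'd) pre_digraph \<Rightarrow> ('v \<Rightarrow> 'w) \<Rightarrow>
     (('v, 'e) path \<Rightarrow> ('w, 'd) path) \<Rightarrow> bool" where
  "path_functor E E' f0 f1 \<longleftrightarrow>
     (\<forall>v\<in>verts E. f0 v \<in> verts E') \<and>
     (\<forall>\<alpha>\<in>paths E. f1 \<alpha> \<in> paths E' \<and>
        path_source (f1 \<alpha>) = f0 (path_source \<alpha>) \<and>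
        path_range E' (f1 \<alpha>) = f0 (path_range E \<alpha>)) \<and>
     (\<forall>v\<in>verts E. f1 (vertex_path v) = vertex_path (f0 v)) \<and>
     (\<forall>\<alpha>\<in>paths E. \<forall>\<beta>\<in>paths E. path_source \<beta> = path_range E \<alpha> \<longrightarrow>
        f1 (path_concat \<alpha> \<beta>) = path_concat (f1 \<alpha>) (f1 \<beta>))"

definition hereditary :: "('v, 'e) pre_digraph \<Rightarrow> 'v set \<Rightarrow> bool" where
  "hereditary E H \<longleftrightarrow> H \<subseteq> verts E \<and>
     (\<forall>\<alpha>\<in>paths E. path_source \<alpha> \<in> H \<longrightarrow> path_range E \<alpha> \<in> H)"

definition saturated :: "('v, 'e) pre_digraph \<Rightarrow> 'v set \<Rightarrow> bool" where
  "saturated E H \<longleftrightarrow> \<not> (\<exists>v. regular_vertex E v \<and> v \<notin> H \<and> head E ` out_arcs E v \<subseteq> H)"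

definition admissible :: "('v, 'e) pre_digraph \<Rightarrow> ('v, 'e) pre_digraph \<Rightarrow> bool" where
  "admissible D E \<longleftrightarrow> directed_graph D \<and> directed_graph E \<and> subgraph D E \<and>
     hereditary E (verts E - verts D) \<and> saturated E (verts E - verts D) \<and>
     arcs D = {e \<in> arcs E. head E e \<in> verts D} \<and>
     \<not> (\<exists>v\<in>verts E.
         infinite {e \<in> out_arcs E v. head E e \<in> verts E - verts D} \<and>
         finite {e \<in> out_arcs E v. head E e \<in> verts D} \<and>
         {e \<in> out_arcs E v. head E e \<in> verts D} \<noteq> {})"


section \<open>Graph C*-algebras\<close>

abbreviation vertex_var :: "'v \<Rightarrow> ('v + 'e) star_poly" where
  "vertex_var v \<equiv> poly_gen (Inl v)"

abbreviation edge_var :: "'e \<Rightarrow> ('v + 'e) star_poly" where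
  "edge_var e \<equiv> poly_gen (Inr e)"

text \<open>
  In this order: the vertex elements are mutually orthogonal projections; the edge elements
  are partial isometries; (GA1) for \<open>e = f\<close> and for \<open>e \<noteq> f\<close>; (GA2); (GA3). In (GA3), \<open>p \<le> q\<close>
  for projections \<open>p\<close>, \<open>q\<close> means \<open>q p = p\<close>.
\<close>

definition graph_relations :: "('v, 'e) pre_digraph \<Rightarrow> ('v + 'e) star_poly set" where
  "graph_relations E =
     {vertex_var v * vertex_var v - vertex_var v | v. v \<in> verts E} \<union>
     {poly_adj (vertex_var v) - vertex_var v | v. v \<in> verts E} \<union>
     {vertex_var v * vertex_var w | v w. v \<in> verts E \<and> w \<in> verts E \<and> v \<noteq> w} \<union>
     {edge_var e * poly_adj (edge_var e) * edge_var e - edge_var e | e. e \<in> arcs E} \<union>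
     {poly_adj (edge_var e) * edge_var e - vertex_var (head E e) | e. e \<in> arcs E} \<union>
     {poly_adj (edge_var e) * edge_var f | e f. e \<in> arcs E \<and> f \<in> arcs E \<and> e \<noteq> f} \<union>
     {(\<Sum>e\<in>out_arcs E v. edge_var e * poly_adj (edge_var e)) - vertex_var v
        | v. regular_vertex E v} \<union>
     {vertex_var (tail E e) * (edge_var e * poly_adj (edge_var e))
        - edge_var e * poly_adj (edge_var e) | e. e \<in> arcs E}"

type_synonym ('v, 'e) graph_elem = "(nat \<Rightarrow> ('v + 'e) star_poly) set"

definition graph_cstar :: "('v, 'e) pre_digraph \<Rightarrow> ('v, 'e) graph_elem cstar" where
  "graph_cstar E = universal_cstar (verts E <+> arcs E) (graph_relations E)"

definition vproj :: "('v, 'e) pre_digraph \<Rightarrow> 'v \<Rightarrow> ('v, 'e) graph_elem" where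
  "vproj E v = universal_gen (verts E <+> arcs E) (graph_relations E) (Inl v)"

definition eiso :: "('v, 'e) pre_digraph \<Rightarrow> 'e \<Rightarrow> ('v, 'e) graph_elem" where
  "eiso E e = universal_gen (verts E <+> arcs E) (graph_relations E) (Inr e)"

text \<open>The element \<open>S\<^sub>\<alpha>\<close> for a path \<open>\<alpha>\<close>, which is \<open>P\<^sub>v\<close> for the path of length zero at \<open>v\<close>.\<close>

fun path_iso :: "('v, 'e) pre_digraph \<Rightarrow> ('v, 'e) path \<Rightarrow> ('v, 'e) graph_elem" where
  "path_iso E (v, []) = vproj E v"
| "path_iso E (v, [e]) = eiso E e"
| "path_iso E (v, e # e' # p) = cmult (graph_cstar E) (eiso E e) (path_iso E (head E e, e' # p))"

definition hom_on_generators ::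
    "('v, 'e) pre_digraph \<Rightarrow> 'b cstar \<Rightarrow> ('v \<Rightarrow> 'b) \<Rightarrow> ('e \<Rightarrow> 'b) \<Rightarrow>
     (('v, 'e) graph_elem \<Rightarrow> 'b) \<Rightarrow> bool" where
  "hom_on_generators E B p s \<phi> \<longleftrightarrow>
     star_hom (graph_cstar E) B \<phi> \<and>
     (\<forall>v\<in>verts E. \<phi> (vproj E v) = p v) \<and>
     (\<forall>e\<in>arcs E. \<phi> (eiso E e) = s e)"

definition determined_hom ::
    "('v, 'e) pre_digraph \<Rightarrow> 'b cstar \<Rightarrow> ('v \<Rightarrow> 'b) \<Rightarrow> ('e \<Rightarrow> 'b) \<Rightarrow>
     (('v, 'e) graph_elem \<Rightarrow> 'b) \<Rightarrow> bool" where
  "determined_hom E B p s \<phi> \<longleftrightarrow>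
     hom_on_generators E B p s \<phi> \<and> (\<forall>\<psi>. hom_on_generators E B p s \<psi> \<longrightarrow> \<psi> = \<phi>)"

definition canonical_surjection ::
    "('v, 'e) pre_digraph \<Rightarrow> ('v, 'e) pre_digraph \<Rightarrow>
     (('v, 'e) graph_elem \<Rightarrow> ('v, 'e) graph_elem) \<Rightarrow> bool" where
  "canonical_surjection E F \<pi> \<longleftrightarrow>
     determined_hom E (graph_cstar F)
       (\<lambda>v. if v \<in> verts F then vproj F v else czero (graph_cstar F))
       (\<lambda>e. if e \<in> arcs F then eiso F e else czero (graph_cstar F)) \<pi> \<and>
     \<pi> ` celems (graph_cstar E) = celems (graph_cstar F)"

definition functor_induced_hom ::
    "('v, 'e) pre_digraph \<Rightarrow> ('w, 'd) pre_digraph \<Rightarrow> ('v \<Rightarrow> 'w) \<Rightarrow>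
     (('v, 'e) path \<Rightarrow> ('w, 'd) path) \<Rightarrow>
     (('v, 'e) graph_elem \<Rightarrow> ('w, 'd) graph_elem) \<Rightarrow> bool" where
  "functor_induced_hom E E' f0 f1 \<phi> \<longleftrightarrow>
     determined_hom E (graph_cstar E')
       (\<lambda>v. vproj E' (f0 v)) (\<lambda>e. path_iso E' (f1 (edge_path E e))) \<phi>"

end

theory Submission
  imports Defs "HOL-Library.Function_Algebras"
begin

text \<open>
  Write \<open>H\<close> for the complement of the vertex set shared by the two subgraphs. The kernel of the
  canonical surjection of \<open>C*(E\<^sub>i)\<close> is the closure of the ideal \<open>J\<^sub>i\<close> spanned by the elements
  \<open>S\<^sub>\<alpha> S\<^sub>\<beta>\<^sup>*\<close> for which \<open>\<alpha>\<close> and \<open>\<beta>\<close> end in the same vertex of \<open>H\<close>. Both canonical maps being onto,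
  the square is a pullback as soon as \<open>f\<^sub>*\<close> restricts to a bijection between these kernels; the
  diagram chase is in \<open>jointly_injective\<close> and \<open>jointly_surjective\<close>.

  The ideal \<open>J\<^sub>2\<close> is reached (\<open>ft_onto_ideal\<close>) because a path of \<open>E\<^sub>2\<close> ending in \<open>H\<close> is pointed, as
  there are no short loops at \<open>H\<close>; hence it is the image of a path of \<open>E\<^sub>1\<close>.

  The heart of the matter is that \<open>f\<^sub>*\<close> is isometric on \<open>J\<^sub>1\<close> (\<open>ft_isometric\<close>). The edges of \<open>E\<^sub>1\<close> that
  leave \<open>v\<close> correspond under \<open>f\<close> to the paths \<open>l\<^sub>1 \<dots> l\<^sub>n e\<close> of \<open>E\<^sub>2\<close> with short loops \<open>l\<^sub>i\<close> at \<open>v\<close> and an edge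
  \<open>e\<close> that is no loop. So a short loop \<open>l\<close> at \<open>v\<close> sends an edge \<open>g\<close> leaving \<open>v\<close> to an edge \<open>lg\<close> with
  \<open>f(lg) = l f(g)\<close>. Let \<open>l\<close> act on \<open>J\<^sub>1\<close> as the sum of all \<open>S\<^bsub>lg\<^esub> S\<^sub>g\<^sup>*\<close>. This sum is infinite in general,
  but on a given element of \<open>J\<^sub>1\<close> only finitely many terms matter: a path from \<open>v\<close> to \<open>H\<close> has a first
  edge, because \<open>v\<close> carries a loop and thus lies outside \<open>H\<close>. In this way the *-polynomials over \<open>E\<^sub>2\<close>
  act on \<open>J\<^sub>1\<close> compatibly with adjoints, the relations of \<open>C*(E\<^sub>2)\<close> hold, and \<open>f\<^sub>*(x)\<close> acts as left
  multiplication by \<open>x\<close>. The norm of the action is bounded by the universal norm, and for \<open>x\<close> in \<open>J\<^sub>1\<close>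
  the action of \<open>f\<^sub>*(x)\<close> has norm at least \<open>\<parallel>x x\<^sup>*\<parallel> / \<parallel>x\<^sup>*\<parallel> = \<parallel>x\<parallel>\<close>.

  For the kernels, the relations of \<open>F\<^sub>i\<close> hold in \<open>C*(E\<^sub>i)\<close> modulo \<open>J\<^sub>i\<close>. As the quotient norm of a
  *-ideal is a C*-seminorm (\<open>quotient_norm_cstar\<close>), the universal norm of \<open>C*(F\<^sub>i)\<close> dominates the
  distance to \<open>J\<^sub>i\<close>, which gives both the kernel (\<open>kernel_pi\<close>) and surjectivity (\<open>surjective_pi\<close>).

  The C*-algebra theory behind this rests on a single device. If \<open>h\<close> is self-adjoint with
  \<open>\<parallel>h\<parallel> < 1\<close>, iterating \<open>s = (h\<^sup>2 + s\<^sup>2) / 2\<close> yields \<open>s = 1 - (1 - h\<^sup>2)\<^bsup>1/2\<^esup>\<close>, and \<open>u = h + i (1 - s)\<close> is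
  unitary with real part \<open>h\<close>. Multiplication by a unitary is isometric by the C*-identity, so that
  \<open>h\<close> behaves like \<open>cos \<theta>\<close> and the formulas for \<open>cos 2\<theta>\<close> and \<open>cos 3\<theta>\<close> bound polynomials in \<open>h\<close>,
  without spectra or states. From \<open>\<parallel>1 - h\<^sup>2/2\<parallel> \<le> 1\<close> and \<open>\<parallel>h - h\<^sup>3/2\<parallel> \<le> 3/4\<close> one gets approximate
  units of *-ideals, hence quotient norms; and the same unitaries show that *-homomorphisms are
  contractive (\<open>M_le_N\<close>), hence determined by their values on the generators.

  Almost all computations take place among *-polynomials, modulo elements of universal seminorm
  \<open>0\<close>, where ring arithmetic is available; the C*-algebra itself is reached only at the end, as
  classes of Cauchy sequences.
\<close>

section \<open>C*-seminorms on *-rings\<close>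

text \<open>
  The carrier is a unital ring given by a type class, so that \<open>1 - x\<close> makes sense even for algebras
  without unit, and ring simplification applies. The scalars act through central elements \<open>\<kappa> c\<close>.
  This covers *-polynomials as well as sequences of them.
\<close>

locale star_ring =
  fixes \<kappa> :: "complex \<Rightarrow> 'a::ring_1" and adj :: "'a \<Rightarrow> 'a"
  assumes k_add: "\<kappa> (c + d) = \<kappa> c + \<kappa> d"
    and k_mult: "\<kappa> (c * d) = \<kappa> c * \<kappa> d"
    and k_one: "\<kappa> 1 = 1"
    and k_comm: "\<kappa> c * x = x * \<kappa> c"
    and adj_add: "adj (x + y) = adj x + adj y"
    and adj_mult: "adj (x * y) = adj y * adj x"
    and adj_adj: "adj (adj x) = x"
    and adj_k: "adj (\<kappa> c) = \<kappa> (cnj c)"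
begin

lemma k_zero: "\<kappa> 0 = 0"
  using k_add[of 0 0] by simp

lemma k_uminus: "\<kappa> (- c) = - \<kappa> c"
  using k_add[of c "- c"] by (simp add: k_zero eq_neg_iff_add_eq_0 add.commute)

lemma k_of_nat: "\<kappa> (of_nat n) = of_nat n"
  by (induction n) (simp_all add: k_zero k_add k_one)

lemma k_numeral: "\<kappa> (numeral n) = numeral n"
  using k_of_nat[of "numeral n"] by simp

lemma k_assoc: "\<kappa> c * (\<kappa> d * x) = \<kappa> (c * d) * x"
  by (simp add: k_mult mult.assoc)

lemma k_left_comm: "x * (\<kappa> c * y) = \<kappa> c * (x * y)"
  by (metis k_comm mult.assoc)

lemma adj_zero: "adj 0 = 0"
  using adj_add[of 0 0] by simp

lemma adj_one: "adj 1 = 1"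
  using adj_k[of 1] by (simp add: k_one)

lemma adj_uminus: "adj (- x) = - adj x"
  using adj_add[of x "- x"] by (simp add: adj_zero eq_neg_iff_add_eq_0 add.commute)

lemma adj_diff: "adj (x - y) = adj x - adj y"
  using adj_add[of x "- y"] by (simp add: adj_uminus)

lemmas adj_simps = adj_add adj_mult adj_adj adj_k adj_zero adj_one adj_uminus adj_diff

lemma adj_sum: "adj (\<Sum>i\<in>I. f i) = (\<Sum>i\<in>I. adj (f i))"
  by (induction I rule: infinite_finite_induct) (simp_all add: adj_simps)

end

locale cstar_seminormed = star_ring \<kappa> adj
  for \<kappa> :: "complex \<Rightarrow> 'a::ring_1" and adj :: "'a \<Rightarrow> 'a" +
  fixes A :: "'a set" and N :: "'a \<Rightarrow> real"
  assumes A_zero: "0 \<in> A"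
    and A_add: "\<lbrakk>x \<in> A; y \<in> A\<rbrakk> \<Longrightarrow> x + y \<in> A"
    and A_scale: "x \<in> A \<Longrightarrow> \<kappa> c * x \<in> A"
    and A_mult: "\<lbrakk>x \<in> A; y \<in> A\<rbrakk> \<Longrightarrow> x * y \<in> A"
    and A_adj: "x \<in> A \<Longrightarrow> adj x \<in> A"
    and N_nonneg: "x \<in> A \<Longrightarrow> 0 \<le> N x"
    and N_scale: "x \<in> A \<Longrightarrow> N (\<kappa> c * x) = cmod c * N x"
    and N_triangle: "\<lbrakk>x \<in> A; y \<in> A\<rbrakk> \<Longrightarrow> N (x + y) \<le> N x + N y"
    and N_mult: "\<lbrakk>x \<in> A; y \<in> A\<rbrakk> \<Longrightarrow> N (x * y) \<le> N x * N y"
    and N_cstar: "x \<in> A \<Longrightarrow> N (adj x * x) = (N x)\<^sup>2"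

lemma (in star_ring) norm_le_norm_adj:
  fixes N :: "'a \<Rightarrow> real"
  assumes "0 \<le> N y" "0 \<le> N (adj y)"
    and "N (adj y * y) \<le> N (adj y) * N y" "(N y)\<^sup>2 \<le> N (adj y * y)"
  shows "N y \<le> N (adj y)"
proof (cases "N y = 0")
  case False
  have "N y * N y \<le> N (adj y) * N y" using assms(3,4) by (simp add: power2_eq_square)
  then show ?thesis using False assms(1) by (simp add: mult_le_cancel_right)
qed (use assms(2) in simp)

text \<open>
  The inequalities suffice for the equalities in the locale: apply homogeneity to \<open>1/c\<close>, and use that
  \<open>\<parallel>y\<parallel>\<^sup>2 \<le> \<parallel>y\<^sup>* y\<parallel>\<close> forces the adjoint to be isometric.
\<close>

lemma (in star_ring) cstar_seminormedI:
  assumes zero: "0 \<in> A" and add: "\<And>x y. \<lbrakk>x \<in> A; y \<in> A\<rbrakk> \<Longrightarrow> x + y \<in> A"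
    and scale: "\<And>c x. x \<in> A \<Longrightarrow> \<kappa> c * x \<in> A"
    and mult: "\<And>x y. \<lbrakk>x \<in> A; y \<in> A\<rbrakk> \<Longrightarrow> x * y \<in> A" and adj: "\<And>x. x \<in> A \<Longrightarrow> adj x \<in> A"
    and nonneg: "\<And>x. x \<in> A \<Longrightarrow> 0 \<le> N x"
    and N_scale: "\<And>c x. x \<in> A \<Longrightarrow> N (\<kappa> c * x) \<le> cmod c * N x"
    and N_add: "\<And>x y. \<lbrakk>x \<in> A; y \<in> A\<rbrakk> \<Longrightarrow> N (x + y) \<le> N x + N y"
    and N_mult: "\<And>x y. \<lbrakk>x \<in> A; y \<in> A\<rbrakk> \<Longrightarrow> N (x * y) \<le> N x * N y"
    and N_sq: "\<And>x. x \<in> A \<Longrightarrow> (N x)\<^sup>2 \<le> N (adj x * x)"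
  shows "cstar_seminormed \<kappa> adj A N"
proof (unfold_locales; (fact assms)?)
  fix x c assume x: "x \<in> A"
  show "N (\<kappa> c * x) = cmod c * N x"
  proof (cases "c = 0")
    case True
    then show ?thesis using N_scale[OF x, of 0] nonneg[OF scale[OF x], of 0] by simp
  next
    case False
    have "N x = N (\<kappa> (1/c) * (\<kappa> c * x))" using False by (simp add: k_assoc k_one)
    also have "\<dots> \<le> cmod (1/c) * N (\<kappa> c * x)" by (intro N_scale scale x)
    finally show ?thesis using False N_scale[OF x, of c]
      by (simp add: norm_divide field_simps)
  qed
next
  have *: "N y \<le> N (adj y)" if "y \<in> A" for y
    by (rule norm_le_norm_adj[OF nonneg[OF that] nonneg[OF adj[OF that]] N_mult[OF adj[OF that] that] N_sq[OF that]])
  fix x assume x: "x \<in> A"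
  have "N (adj x * x) \<le> N x * N x"
    using *[of "adj x"] N_mult[of "adj x" x] nonneg[OF x] x
    by (simp add: adj adj_adj) (meson mult_right_mono order_trans)
  then show "N (adj x * x) = (N x)\<^sup>2"
    using N_sq[OF x] by (simp add: power2_eq_square)
qed

context cstar_seminormed
begin
lemma A_uminus: "x \<in> A \<Longrightarrow> - x \<in> A"
  using A_scale[of x "- 1"] by (simp add: k_uminus k_one)

lemma A_diff: "\<lbrakk>x \<in> A; y \<in> A\<rbrakk> \<Longrightarrow> x - y \<in> A"
  using A_add[of x "- y"] by (simp add: A_uminus)

lemmas A_closed = A_zero A_add A_scale A_mult A_adj A_uminus A_diff

lemma N_zero: "N 0 = 0"
  using N_scale[of 0 0] by (simp add: A_zero)

lemma N_uminus: "x \<in> A \<Longrightarrow> N (- x) = N x"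
  using N_scale[of x "- 1"] by (simp add: k_uminus k_one)

lemma N_minus_commute: "\<lbrakk>x \<in> A; y \<in> A\<rbrakk> \<Longrightarrow> N (x - y) = N (y - x)"
  using N_uminus[of "x - y"] by (simp add: A_diff)

lemma N_diff: "\<lbrakk>x \<in> A; y \<in> A\<rbrakk> \<Longrightarrow> N (x - y) \<le> N x + N y"
  using N_triangle[of x "- y"] by (simp add: A_uminus N_uminus)

lemma N_diff_triangle: "\<lbrakk>x \<in> A; y \<in> A; z \<in> A\<rbrakk> \<Longrightarrow> N (x - z) \<le> N (x - y) + N (y - z)"
  using N_triangle[of "x - y" "y - z"] by (simp add: A_diff)

lemma N_abs_diff: "\<lbrakk>x \<in> A; y \<in> A\<rbrakk> \<Longrightarrow> \<bar>N x - N y\<bar> \<le> N (x - y)"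
  using N_triangle[of "x - y" y] N_triangle[of "y - x" x] N_minus_commute[of x y]
  by (simp add: A_diff)

lemma N_adj: assumes "x \<in> A" shows "N (adj x) = N x"
proof -
  have *: "N y \<le> N (adj y)" if "y \<in> A" for y
    by (rule norm_le_norm_adj[OF N_nonneg[OF that] N_nonneg[OF A_adj[OF that]]
        N_mult[OF A_adj[OF that] that] eq_refl[OF N_cstar[OF that, symmetric]]])
  show ?thesis using *[OF assms] *[of "adj x"] assms by (simp add: A_adj adj_adj)
qed

lemma N_sum: "(\<And>i. i \<in> I \<Longrightarrow> f i \<in> A) \<Longrightarrow> sum f I \<in> A \<and> N (sum f I) \<le> (\<Sum>i\<in>I. N (f i))"
proof (induction I rule: infinite_finite_induct)
  case (insert i I)
  then show ?case using N_triangle[of "f i" "sum f I"] by (auto simp: A_closed)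
qed (auto simp: A_zero N_zero)

lemma A_sum: "(\<And>i. i \<in> I \<Longrightarrow> f i \<in> A) \<Longrightarrow> sum f I \<in> A"
  using N_sum by blast

text \<open>
  The idealizer of \<open>A\<close>. It contains \<open>A\<close> and \<open>1\<close>, so it replaces the unitization of \<open>A\<close>; operator norms
  on \<open>A\<close> are expressed by \<open>bounded_by\<close> and do not require extending the seminorm.
\<close>

definition multipliers :: "'a set" where
  "multipliers = {m. \<forall>x\<in>A. m * x \<in> A \<and> x * m \<in> A}"

definition bounded_by :: "real \<Rightarrow> 'a \<Rightarrow> bool" where
  "bounded_by C m \<longleftrightarrow> m \<in> multipliers \<and> 0 \<le> C \<and> (\<forall>x\<in>A. N (m * x) \<le> C * N x)"

lemma multipliersD: "m \<in> multipliers \<Longrightarrow> x \<in> A \<Longrightarrow> m * x \<in> A"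
    "m \<in> multipliers \<Longrightarrow> x \<in> A \<Longrightarrow> x * m \<in> A"
  by (auto simp: multipliers_def)

lemma multipliers_A: "x \<in> A \<Longrightarrow> x \<in> multipliers"
  by (auto simp: multipliers_def A_mult)

lemma multipliers_k: "\<kappa> c \<in> multipliers"
  by (auto simp: multipliers_def A_scale simp flip: k_comm)

lemma multipliers_one: "1 \<in> multipliers"
  by (auto simp: multipliers_def)

lemma multipliers_add: "m \<in> multipliers \<Longrightarrow> n \<in> multipliers \<Longrightarrow> m + n \<in> multipliers"
  by (auto simp: multipliers_def A_add distrib_left distrib_right)

lemma multipliers_diff: "m \<in> multipliers \<Longrightarrow> n \<in> multipliers \<Longrightarrow> m - n \<in> multipliers"
  by (auto simp: multipliers_def A_diff left_diff_distrib right_diff_distrib)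

lemma multipliers_mult: "m \<in> multipliers \<Longrightarrow> n \<in> multipliers \<Longrightarrow> m * n \<in> multipliers"
  by (auto simp: multipliers_def mult.assoc) (metis mult.assoc)

lemma multipliers_adj: assumes "m \<in> multipliers" shows "adj m \<in> multipliers"
proof -
  have "adj m * x = adj (adj x * m)" "x * adj m = adj (m * adj x)" for x
    by (simp_all add: adj_simps)
  then show ?thesis using assms by (auto simp: multipliers_def A_adj)
qed

lemmas multipliers_closed = multipliers_A multipliers_k multipliers_one multipliers_add
  multipliers_diff multipliers_mult multipliers_adj

lemma bounded_by_mono: "bounded_by C m \<Longrightarrow> C \<le> D \<Longrightarrow> bounded_by D m"
  unfolding bounded_by_def by (meson N_nonneg mult_right_mono order_trans)

lemma bounded_by_A: "x \<in> A \<Longrightarrow> bounded_by (N x) x"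
  by (auto simp: bounded_by_def multipliers_A N_mult N_nonneg)

lemma bounded_by_k: "bounded_by (cmod c) (\<kappa> c)"
  by (auto simp: bounded_by_def multipliers_k N_scale)

lemma bounded_by_one: "bounded_by 1 1"
  using bounded_by_k[of 1] by (simp add: k_one)

lemma bounded_by_add:
  assumes "bounded_by C m" "bounded_by D n" shows "bounded_by (C + D) (m + n)"
proof -
  have "N ((m + n) * x) \<le> (C + D) * N x" if "x \<in> A" for x
  proof -
    have "N (m * x + n * x) \<le> N (m * x) + N (n * x)"
      using assms that by (intro N_triangle) (auto simp: bounded_by_def multipliersD)
    also have "\<dots> \<le> C * N x + D * N x"
      using assms that by (intro add_mono) (auto simp: bounded_by_def)
    finally show ?thesis by (simp add: algebra_simps)
  qed
  then show ?thesis using assms by (auto simp: bounded_by_def multipliers_closed)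
qed

lemma bounded_by_mult:
  assumes "bounded_by C m" "bounded_by D n" shows "bounded_by (C * D) (m * n)"
proof -
  have "N (m * n * x) \<le> C * D * N x" if "x \<in> A" for x
  proof -
    have "N (m * (n * x)) \<le> C * N (n * x)"
      using assms that by (auto simp: bounded_by_def multipliersD)
    also have "\<dots> \<le> C * (D * N x)"
      using assms that by (intro mult_left_mono) (auto simp: bounded_by_def)
    finally show ?thesis by (simp add: mult.assoc)
  qed
  then show ?thesis using assms by (auto simp: bounded_by_def multipliers_closed)
qed

lemma bounded_by_scale: "bounded_by C m \<Longrightarrow> bounded_by (cmod c * C) (\<kappa> c * m)"
  by (intro bounded_by_mult bounded_by_k)

lemma bounded_by_uminus: "bounded_by C m \<Longrightarrow> bounded_by C (- m)"
  using bounded_by_scale[of C m "-1"] by (simp add: k_uminus k_one)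

lemma bounded_by_diff:
  "bounded_by C m \<Longrightarrow> bounded_by D n \<Longrightarrow> bounded_by (C + D) (m - n)"
  using bounded_by_add[OF _ bounded_by_uminus] by fastforce

lemma bounded_by_limit:
  assumes "\<And>e. 0 < e \<Longrightarrow> e < 1 \<Longrightarrow> bounded_by (C + K * e) m" "0 \<le> C"
  shows "bounded_by C m"
proof -
  have "N (m * x) \<le> C * N x" if x: "x \<in> A" for x
  proof (rule tendsto_lowerbound)
    show "((\<lambda>e. (C + K * e) * N x) \<longlongrightarrow> C * N x) (at_right 0)"
      by (auto intro!: tendsto_eq_intros)
    have "eventually (\<lambda>e. e \<in> {0<..<1}) (at_right (0::real))"
      by (rule eventually_at_right_real) simp
    then show "eventually (\<lambda>e. N (m * x) \<le> (C + K * e) * N x) (at_right 0)"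
      by eventually_elim (use assms x in \<open>auto simp: bounded_by_def\<close>)
  qed simp
  moreover have "m \<in> multipliers" using assms(1)[of "1/2"] by (auto simp: bounded_by_def)
  ultimately show ?thesis using assms by (auto simp: bounded_by_def)
qed

text \<open>
  A self-adjoint element attains its operator norm on itself, by the C*-identity.
\<close>

lemma N_le_of_bounded_by:
  assumes "bounded_by C x" "x \<in> A" "adj x = x" shows "N x \<le> C"
proof -
  have "N x * N x \<le> C * N x"
    using assms N_cstar[of x] by (auto simp: bounded_by_def power2_eq_square)
  then show ?thesis
    using N_nonneg[OF assms(2)] assms(1)
    by (cases "N x = 0") (auto simp: bounded_by_def mult_le_cancel_right)
qed

text \<open>
  Picard iteration for \<open>s = (h\<^sup>2 + s\<^sup>2) / 2\<close>, whose solution is \<open>1 - (1 - h\<^sup>2)\<^bsup>1/2\<^esup>\<close>. The map contracts with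
  factor \<open>\<parallel>h\<parallel>\<close> on the ball of radius \<open>\<parallel>h\<parallel>\<close>, because \<open>s\<^sup>2 - t\<^sup>2 = s (s - t) + (s - t) t\<close>.
\<close>

primrec root_iter :: "'a \<Rightarrow> nat \<Rightarrow> 'a" where
  "root_iter h 0 = 0"
| "root_iter h (Suc n) = \<kappa> (1/2) * (h * h + root_iter h n * root_iter h n)"

context
  fixes h assumes h: "h \<in> A" "adj h = h" "N h < 1"
begin

lemma root_iter_A: "root_iter h n \<in> A"
  by (induction n) (auto simp: A_closed h)

lemma root_iter_adj: "adj (root_iter h n) = root_iter h n"
proof (induction n)
  case (Suc n)
  show ?case unfolding root_iter.simps adj_mult Suc adj_add adj_k h by (simp add: k_comm)
qed (simp add: adj_zero)

lemma root_iter_comm: "h * root_iter h n = root_iter h n * h"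
proof (induction n)
  case (Suc n)
  have "h * (root_iter h n * root_iter h n) = root_iter h n * root_iter h n * h"
    by (metis Suc mult.assoc)
  then show ?case by (simp add: k_left_comm distrib_left distrib_right mult.assoc)
qed simp

lemma root_iter_N: "N (root_iter h n) \<le> N h"
proof (induction n)
  case 0 then show ?case by (simp add: N_zero N_nonneg h)
next
  case (Suc n)
  have "N (root_iter h (Suc n)) = 1/2 * N (h * h + root_iter h n * root_iter h n)"
    using N_scale[of "h * h + root_iter h n * root_iter h n" "1/2"]
    by (simp add: A_closed root_iter_A h)
  also have "\<dots> \<le> 1/2 * (N h * N h + N (root_iter h n) * N (root_iter h n))"
    by (intro mult_left_mono order_trans[OF N_triangle] add_mono N_mult A_mult h root_iter_A) auto
  also have "\<dots> \<le> 1/2 * (N h * 1 + N h * 1)"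
    using Suc h N_nonneg[OF root_iter_A[of n]] N_nonneg[of h]
    by (intro mult_left_mono add_mono mult_mono) auto
  finally show ?case by simp
qed

lemma root_iter_step: "N (root_iter h (Suc n) - root_iter h n) \<le> N h ^ n"
proof (induction n)
  case 0
  have "N (root_iter h (Suc 0)) \<le> 1"
    using root_iter_N[of 1] h by simp
  then show ?case by simp
next
  case (Suc n)
  let ?s = "root_iter h (Suc n)" and ?t = "root_iter h n"
  have "root_iter h (Suc (Suc n)) - ?s = \<kappa> (1/2) * (?s * ?s - ?t * ?t)"
    unfolding root_iter.simps(2)[of h "Suc n"] by (subst (3) root_iter.simps(2))
      (simp add: right_diff_distrib distrib_left del: root_iter.simps)
  also have "\<dots> = \<kappa> (1/2) * (?s * (?s - ?t) + (?s - ?t) * ?t)"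
    by (simp add: right_diff_distrib left_diff_distrib del: root_iter.simps)
  finally have "N (root_iter h (Suc (Suc n)) - ?s) = 1/2 * N (?s * (?s - ?t) + (?s - ?t) * ?t)"
    using N_scale[of "?s * (?s - ?t) + (?s - ?t) * ?t" "1/2"]
    by (simp add: A_closed root_iter_A del: root_iter.simps)
  also have "\<dots> \<le> 1/2 * (N ?s * N (?s - ?t) + N (?s - ?t) * N ?t)"
    by (intro mult_left_mono order_trans[OF N_triangle] add_mono N_mult A_closed root_iter_A) auto
  also have "\<dots> \<le> 1/2 * (N h * N h ^ n + N h ^ n * N h)"
    using Suc root_iter_N[of n] root_iter_N[of "Suc n"] h
    by (intro mult_left_mono add_mono mult_mono N_nonneg A_closed root_iter_A
      zero_le_power) (auto simp del: root_iter.simps)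
  finally show ?case by simp
qed

lemma root_iter_residual:
  "N (2 * root_iter h n - h * h - root_iter h n * root_iter h n) \<le> 2 * N h ^ n"
proof -
  let ?s = "root_iter h n" and ?t = "root_iter h (Suc n)"
  have "h * h + ?s * ?s = 2 * ?t"
    by (simp add: k_assoc flip: k_numeral) (simp add: k_one)
  then have "2 * ?s - h * h - ?s * ?s = \<kappa> 2 * (?s - ?t)"
    by (simp add: k_numeral algebra_simps del: root_iter.simps)
  then have "N (2 * ?s - h * h - ?s * ?s) = 2 * N (?s - ?t)"
    using N_scale[of "?s - ?t" 2] by (simp add: A_closed root_iter_A del: root_iter.simps)
  then show ?thesis
    using root_iter_step[of n] N_minus_commute[of ?s ?t]
    by (simp add: root_iter_A del: root_iter.simps)
qed

end

end

section \<open>Almost unitaries and approximate units\<close>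

context cstar_seminormed begin

text \<open>
  Take \<open>u = h + i (1 - s)\<close> with an iterate \<open>s\<close>. As \<open>s\<close> commutes with \<open>h\<close>, both \<open>u\<^sup>* u\<close> and \<open>u u\<^sup>*\<close> equal
  \<open>h\<^sup>2 + (1 - s)\<^sup>2\<close>, which differs from \<open>1\<close> by the residual of the iteration. Working with approximate
  solutions makes this available in algebras that are not complete.
\<close>

lemma almost_unitary:
  assumes h: "h \<in> A" "adj h = h" "N h < 1" and e: "0 < e"
  obtains u d where "u \<in> multipliers" "u + adj u = 2 * h"
    "adj u * u = 1 - d" "u * adj u = 1 - d" "d \<in> A" "N d \<le> e"
    "bounded_by (1 + e) u" "bounded_by (1 + e) (adj u)"
proof -
  have "(\<lambda>n. 2 * N h ^ n) \<longlonglongrightarrow> 2 * 0"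
    using h N_nonneg[of h] by (intro tendsto_mult_left LIMSEQ_power_zero) auto
  then have "eventually (\<lambda>n. 2 * N h ^ n < e) sequentially"
    by (rule order_tendstoD(2)) (use e in simp)
  then obtain n where n: "2 * N h ^ n < e"
    by (auto simp: eventually_sequentially)
  define s where "s = root_iter h n"
  define d where "d = 2 * s - h * h - s * s"
  define u where "u = h + \<kappa> \<i> * (1 - s)"
  have s: "s \<in> A" "adj s = s" "h * s = s * h"
    using root_iter_A[OF h] root_iter_adj[OF h] root_iter_comm[OF h] by (auto simp: s_def)
  have "2 * s \<in> A" using A_scale[OF s(1), of 2] by (simp add: k_numeral)
  then have d: "d \<in> A" by (simp add: d_def A_diff A_mult h s)
  have Nd: "N d \<le> e" using root_iter_residual[OF h, of n] n by (simp add: d_def s_def)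
  define w where "w = \<kappa> \<i> * (1 - s)"
  have hs: "h * (1 - s) = (1 - s) * h" by (simp add: s algebra_simps)
  have comm: "h * w = w * h"
    unfolding w_def k_left_comm[of h] hs mult.assoc ..
  have "w * w = \<kappa> \<i> * (\<kappa> \<i> * ((1 - s) * (1 - s)))"
    unfolding w_def k_left_comm[of "\<kappa> \<i> * (1 - s)"] by (simp only: mult.assoc)
  then have sq: "w * w = - ((1 - s) * (1 - s))"
    by (simp add: k_assoc k_uminus k_one)
  have u: "u = h + w" by (simp add: u_def w_def)
  have u': "adj u = h - w"
    by (simp add: u_def w_def adj_simps s h k_uminus) (simp add: k_comm)
  have dw: "1 - d = h * h - w * w"
    by (simp add: d_def sq algebra_simps mult_2)
  have uu: "adj u * u = 1 - d"
    unfolding u' dw by (simp add: u comm algebra_simps)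
  have uu': "u * adj u = 1 - d"
    unfolding u' dw by (simp add: u comm algebra_simps)
  have um: "u \<in> multipliers"
    unfolding u_def by (intro multipliers_closed h s)
  have bd: "N (v * x) \<le> (1 + e) * N x" if v: "adj v * v = 1 - d" "v \<in> multipliers" and x: "x \<in> A" for v x
  proof -
    have "adj (v * x) * (v * x) = adj x * (adj v * v) * x"
      by (simp add: adj_mult mult.assoc)
    then have "(N (v * x))\<^sup>2 = N (adj x * (adj v * v) * x)"
      using N_cstar[OF multipliersD(1)[OF v(2) x]] by simp
    also have "\<dots> = N (adj x * x - adj x * d * x)"
      by (simp add: v algebra_simps)
    also have "\<dots> \<le> N (adj x * x) + N (adj x * (d * x))"
      using x d N_diff[of "adj x * x" "adj x * d * x"] by (simp add: A_closed mult.assoc)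
    also have "\<dots> \<le> (N x)\<^sup>2 + N x * (e * N x)"
    proof (intro add_mono)
      have "N (adj x * (d * x)) \<le> N (adj x) * N (d * x)"
        by (intro N_mult A_closed x d)
      also have "\<dots> \<le> N x * (N d * N x)"
        by (simp add: N_adj x, intro mult_left_mono N_mult N_nonneg x d)
      also have "\<dots> \<le> N x * (e * N x)"
        by (intro mult_left_mono mult_right_mono Nd N_nonneg x)
      finally show "N (adj x * (d * x)) \<le> N x * (e * N x)" .
    qed (simp add: N_cstar x)
    also have "\<dots> = (1 + e) * (N x)\<^sup>2"
      by (simp add: power2_eq_square algebra_simps)
    also have "\<dots> \<le> (1 + e) * ((1 + e) * (N x)\<^sup>2)"
      using e by (intro mult_left_mono) (auto intro: mult_left_mono[of 1 "1 + e", simplified] simp: algebra_simps)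
    also have "\<dots> = ((1 + e) * N x)\<^sup>2" by (simp add: power2_eq_square algebra_simps)
    finally show ?thesis
      by (rule power2_le_imp_le) (use e N_nonneg[OF x] in simp)
  qed
  have "bounded_by (1 + e) u" "bounded_by (1 + e) (adj u)"
    using e bd[OF uu um] bd[of "adj u"] uu' um by (auto simp: bounded_by_def multipliers_adj adj_adj)
  moreover have "u + adj u = 2 * h" unfolding u' by (simp add: u mult_2)
  ultimately show thesis using that um uu uu' d Nd by blast
qed

text \<open>
  With \<open>2 h = u + u\<^sup>*\<close> and \<open>u\<close> unitary, \<open>4 - 4 h\<^sup>2 = 2 - u\<^sup>2 - u\<^sup>*\<^sup>2\<close> has norm at most \<open>4\<close> and
  \<open>8 h\<^sup>3 - 6 h = u\<^sup>3 + u\<^sup>*\<^sup>3\<close> has norm at most \<open>2\<close>: these are the formulas for \<open>cos 2\<theta>\<close> and \<open>cos 3\<theta>\<close>. Then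
  \<open>1 - h\<^sup>2/2 = 1/2 + (4 - 4 h\<^sup>2)/8\<close> and \<open>h - h\<^sup>3/2 = (10 h - (8 h\<^sup>3 - 6 h))/16\<close>.
\<close>

lemma
  assumes h: "h \<in> A" "adj h = h" "N h < 1"
  shows bounded_by_cos: "bounded_by 1 (1 - \<kappa> (1/2) * (h * h))"
    and N_cos_le: "N (h - \<kappa> (1/2) * (h * (h * h))) \<le> 3/4"
proof -
  let ?k = "8 * (h * (h * h)) - 6 * h"
  have k4: "4 * x = \<kappa> 4 * x" "2 * x = \<kappa> 2 * x" "6 * x = \<kappa> 6 * x" "8 * x = \<kappa> 8 * x"
      "16 * x = \<kappa> 16 * x" "10 * x = \<kappa> 10 * x" for x
    by (simp_all add: k_numeral)
  have kA: "?k \<in> A" unfolding k4 by (intro A_closed h)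
  have ksa: "adj ?k = ?k" by (simp add: k4 adj_simps h k_comm mult.assoc)
  have both: "bounded_by (4 + 8 * e) (4 - 4 * (h * h)) \<and> bounded_by (2 + 20 * e) ?k"
    if e: "0 < e" "e < 1" for e
  proof -
    obtain u d where u: "u + adj u = 2 * h" "adj u * u = 1 - d" "u * adj u = 1 - d"
        "d \<in> A" "N d \<le> e" "bounded_by (1 + e) u" "bounded_by (1 + e) (adj u)"
      using almost_unitary[OF h e(1)] by metis
    have d: "bounded_by e d" by (rule bounded_by_mono[OF bounded_by_A]) (use u in auto)
    have hh: "4 * (h * h) = u * u + adj u * adj u + (1 - d) + (1 - d)"
    proof -
      have "4 * (h * h) = (2 * h) * (2 * h)"
        by (simp add: mult.assoc k_left_comm[of h] k_assoc flip: k_numeral)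
      also have "\<dots> = (u + adj u) * (u + adj u)" unfolding u(1) ..
      also have "\<dots> = u * u + u * adj u + (adj u * u + adj u * adj u)"
        by (simp add: algebra_simps)
      also have "\<dots> = u * u + adj u * adj u + (1 - d) + (1 - d)"
        unfolding u by (simp add: algebra_simps)
      finally show ?thesis .
    qed
    have "(4::'a) = 1 + 1 + 1 + 1" "\<kappa> 2 * x = x + x" for x by (simp_all add: k_numeral mult_2)
    then have eq1: "4 - 4 * (h * h) = (\<kappa> 2 * 1 - u * u - adj u * adj u) + \<kappa> 2 * d"
      unfolding hh by (simp only: algebra_simps)
    have e2: "(1 + e) * (1 + e) \<le> 1 + 3 * e"
      using e by (simp add: algebra_simps) 
    have b1: "bounded_by ((cmod 2 * 1 + (1 + e) * (1 + e) + (1 + e) * (1 + e)) + cmod 2 * e) (4 - 4 * (h * h))"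
      unfolding eq1
      by (intro bounded_by_diff bounded_by_add bounded_by_mult bounded_by_scale bounded_by_one d u)
    have "bounded_by (4 + 8 * e) (4 - 4 * (h * h))"
      by (rule bounded_by_mono[OF b1]) (use e2 in simp)
    moreover
    have comm: "u * (adj u * adj u) = (1 - d) * adj u" "u * u * adj u = u * (1 - d)"
         "adj u * (u * u) = (1 - d) * u" "adj u * adj u * u = adj u * (1 - d)"
      using u by (simp_all add: mult.assoc flip: mult.assoc[of u "adj u"] mult.assoc[of "adj u" u])
    have dcomm: "u * d = d * u" "adj u * d = d * adj u"
    proof -
      have "u * (1 - d) = (1 - d) * u" by (metis u(2,3) mult.assoc)
      moreover have "adj u * (1 - d) = (1 - d) * adj u" by (metis u(2,3) mult.assoc)
      ultimately show "u * d = d * u" "adj u * d = d * adj u" by (simp_all add: algebra_simps)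
    qed
    have eq2: "?k = u * (u * u) + adj u * (adj u * adj u) - \<kappa> 6 * (d * h)"
    proof -
      define y where "y = u + adj u"
      have yd: "y * d = d * y" by (simp add: y_def dcomm algebra_simps)
      have "8 * (h * (h * h)) = 2 * h * (4 * (h * h))"
        by (simp add: mult.assoc k_left_comm[of h] k_assoc flip: k_numeral)
      also have "\<dots> = (u + adj u) * (u * u + adj u * adj u) + y * (1 - d) + y * (1 - d)"
        by (simp only: hh u(1)[symmetric] y_def distrib_left)
      also have "\<dots> = u * (u * u) + adj u * (adj u * adj u) + (u * (adj u * adj u) + adj u * (u * u))
            + y + y - d * y - d * y"
        by (simp add: algebra_simps yd)
      also have "u * (adj u * adj u) + adj u * (u * u) = y - d * y"
        unfolding comm y_def by (simp add: algebra_simps)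
      finally have "8 * (h * (h * h)) = u * (u * u) + adj u * (adj u * adj u) + 3 * y - 3 * (d * y)"
        using distrib_right[of 1 2 y] distrib_right[of 1 2 "d * y"] by (simp add: mult_2 algebra_simps)
      moreover have "3 * y = 6 * h" "3 * (d * y) = \<kappa> 6 * (d * h)"
        unfolding y_def u(1) by (simp_all add: k_assoc k_left_comm[of d] flip: k_numeral)
      ultimately show ?thesis by simp
    qed
    have b2: "bounded_by ((1 + e) * ((1 + e) * (1 + e)) + (1 + e) * ((1 + e) * (1 + e)) + cmod 6 * (e * N h)) ?k"
      unfolding eq2
      by (intro bounded_by_diff bounded_by_add bounded_by_mult bounded_by_scale bounded_by_A u d h)
    \<comment> \<open>as \<open>e < 1\<close>, its higher powers are at most \<open>e\<close>\<close>
    have e3: "(1 + e) * ((1 + e) * (1 + e)) \<le> 1 + 7 * e"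
    proof -
      have "e * e \<le> e" "e * (e * e) \<le> e" using e mult_le_one[of e "e"]
        by (auto simp: mult_le_cancel_left1 mult_le_one)
      moreover have "(1 + e) * ((1 + e) * (1 + e)) = 1 + 3 * e + 3 * (e * e) + e * (e * e)"
        by (simp add: algebra_simps)
      ultimately show ?thesis by simp
    qed
    have "e * N h \<le> e * 1" using e h by (intro mult_left_mono) auto
    then have "bounded_by (2 + 20 * e) ?k"
      by (intro bounded_by_mono[OF b2]) (use e3 in simp)
    ultimately show ?thesis by blast
  qed
  have c4: "bounded_by 4 (4 - 4 * (h * h))" by (rule bounded_by_limit) (use both in auto)
  have "1 - \<kappa> (1/2) * (h * h) = \<kappa> (1/2) * 1 + \<kappa> (1/8) * (4 - 4 * (h * h))"
  proof -
    have "\<kappa> (1/8) * (4 - 4 * (h * h)) = \<kappa> (1/2) * 1 - \<kappa> (1/2) * (h * h)"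
      by (simp add: right_diff_distrib k_assoc flip: k_numeral k_mult)
    moreover have "\<kappa> (1/2) + \<kappa> (1/2) = 1" using k_add[of "1/2" "1/2"] by (simp add: k_one)
    ultimately show ?thesis by (simp add: algebra_simps)
  qed
  then show "bounded_by 1 (1 - \<kappa> (1/2) * (h * h))"
    using bounded_by_add[OF bounded_by_scale[OF bounded_by_one, of "1/2"] bounded_by_scale[OF c4, of "1/8"]]
    by simp
  have "bounded_by 2 ?k" by (rule bounded_by_limit) (use both in auto)
  then have Nk: "N ?k \<le> 2" by (rule N_le_of_bounded_by[OF _ kA ksa])
  have "h - \<kappa> (1/2) * (h * (h * h)) = \<kappa> (1/16) * (\<kappa> 10 * h - ?k)"
  proof -
    have "\<kappa> (1/16) * (\<kappa> 10 * h - ?k) = \<kappa> (10/16) * h - (\<kappa> (8/16) * (h * (h * h)) - \<kappa> (6/16) * h)"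
      by (simp only: right_diff_distrib k4 k_assoc) simp
    also have "\<dots> = \<kappa> (10/16 + 6/16) * h - \<kappa> (8/16) * (h * (h * h))"
      unfolding k_add by (simp add: algebra_simps)
    finally show ?thesis by (simp add: k_one)
  qed
  then have "N (h - \<kappa> (1/2) * (h * (h * h))) = 1/16 * N (\<kappa> 10 * h - ?k)"
    using N_scale[of "\<kappa> 10 * h - ?k" "1/16"] by (simp add: A_closed h kA)
  also have "\<dots> \<le> 1/16 * (10 * N h + N ?k)"
    using N_diff[of "\<kappa> 10 * h" ?k] N_scale[of h 10] by (simp add: A_closed h kA)
  finally show "N (h - \<kappa> (1/2) * (h * (h * h))) \<le> 3/4" using Nk h by simp
qed

lemma
  assumes h: "h \<in> A" "adj h = h" "N h < r"
  shows bounded_by_cos_scaled: "bounded_by 1 (1 - \<kappa> (of_real (1 / (2 * r\<^sup>2))) * (h * h))"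
    and N_cos_scaled_le: "N (h * (1 - \<kappa> (of_real (1 / (2 * r\<^sup>2))) * (h * h))) \<le> 3/4 * r"
proof -
  have r: "0 < r" using h N_nonneg[of h] by linarith
  define g where "g = \<kappa> (of_real (1/r)) * h"
  have gA: "g \<in> A" by (simp add: g_def A_closed h)
  have gadj: "adj g = g" by (simp add: g_def adj_simps h k_comm)
  have "cmod (of_real (1/r)) = 1/r" using r by (simp only: norm_of_real) simp
  then have Ng: "N g = N h / r" unfolding g_def using N_scale[OF h(1), of "of_real (1/r)"] by simp
  have g: "g \<in> A" "adj g = g" "N g < 1" using gA gadj Ng h r by auto
  have gg: "\<kappa> (1/2) * (g * g) = \<kappa> (of_real (1 / (2 * r\<^sup>2))) * (h * h)"
    unfolding g_def mult.assoc k_left_comm[of h] k_assoc using r by (simp add: power2_eq_square)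
  show "bounded_by 1 (1 - \<kappa> (of_real (1 / (2 * r\<^sup>2))) * (h * h))"
    using bounded_by_cos[OF g] by (simp only: gg)
  have hg: "h = \<kappa> (of_real r) * g"
    unfolding g_def k_assoc using r by (simp add: k_one flip: of_real_mult)
  have mem: "g * (1 - \<kappa> (of_real (1 / (2 * r\<^sup>2))) * (h * h)) \<in> A"
    by (intro multipliersD(2) multipliers_closed g h)
  have "N (h * (1 - \<kappa> (of_real (1 / (2 * r\<^sup>2))) * (h * h)))
      = N (\<kappa> (of_real r) * (g * (1 - \<kappa> (of_real (1 / (2 * r\<^sup>2))) * (h * h))))"
    by (subst hg) (simp add: mult.assoc)
  also have "\<dots> = r * N (g * (1 - \<kappa> (of_real (1 / (2 * r\<^sup>2))) * (h * h)))"
    using N_scale[OF mem, of "of_real r"] r by simp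
  also have "g * (1 - \<kappa> (of_real (1 / (2 * r\<^sup>2))) * (h * h)) = g - \<kappa> (1/2) * (g * (g * g))"
    unfolding gg[symmetric] by (simp add: right_diff_distrib k_left_comm[of g])
  finally show "N (h * (1 - \<kappa> (of_real (1 / (2 * r\<^sup>2))) * (h * h))) \<le> 3/4 * r"
    using N_cos_le[OF g] r by (simp add: mult.commute)
qed

end

locale star_ideal = cstar_seminormed +
  fixes J
  assumes J_sub: "J \<subseteq> A"
    and J_zero: "0 \<in> J"
    and J_add: "\<lbrakk>x \<in> J; y \<in> J\<rbrakk> \<Longrightarrow> x + y \<in> J"
    and J_scale: "x \<in> J \<Longrightarrow> \<kappa> c * x \<in> J"
    and J_left: "\<lbrakk>a \<in> A; x \<in> J\<rbrakk> \<Longrightarrow> a * x \<in> J"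
    and J_adj: "x \<in> J \<Longrightarrow> adj x \<in> J"
begin

lemma J_A: "x \<in> J \<Longrightarrow> x \<in> A" using J_sub by blast

lemma J_uminus: "x \<in> J \<Longrightarrow> - x \<in> J"
  using J_scale[of x "- 1"] by (simp add: k_uminus k_one)

lemma J_diff: "\<lbrakk>x \<in> J; y \<in> J\<rbrakk> \<Longrightarrow> x - y \<in> J"
  using J_add[of x "- y"] by (simp add: J_uminus)

lemma J_right: "\<lbrakk>a \<in> A; x \<in> J\<rbrakk> \<Longrightarrow> x * a \<in> J"
  by (metis A_adj J_adj J_left adj_adj adj_mult)

lemmas J_closed = J_zero J_add J_scale J_uminus J_diff J_adj

text \<open>
  The multiplier \<open>1 - h\<^sup>2/(2 r\<^sup>2)\<close> is contractive, is \<open>1\<close> modulo the ideal, and shrinks \<open>h\<close> by the factor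
  \<open>3/4\<close>. Repeating the step with the shrunken element makes it arbitrarily small; \<open>1 - z\<close> is the
  product of the multipliers.
\<close>

lemma approximate_unit:
  assumes "j \<in> J" "adj j = j" "0 < e"
  obtains z where "z \<in> J" "bounded_by 1 (1 - z)" "bounded_by 1 (1 - adj z)" "N (j * (1 - z)) < e"
proof -
  have main: "\<exists>z\<in>J. bounded_by 1 (1 - z) \<and> bounded_by 1 (1 - adj z) \<and> N (j * (1 - z)) < e"
    if "j \<in> J" "adj j = j" "N j < e * (5/4) ^ n" for n j
    using that
  proof (induction n arbitrary: j)
    case 0
    then show ?case
      by (intro bexI[of _ 0]) (auto simp: J_zero adj_zero bounded_by_one)
  next
    case (Suc n)
    define r where "r = e * (5/4) ^ Suc n"
    have "N j < r" using Suc.prems by (simp add: r_def)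
    define y where "y = \<kappa> (of_real (1 / (2 * r\<^sup>2))) * (j * j)"
    have jj: "j * j \<in> J" using Suc.prems J_left J_A by blast
    have y: "y \<in> J" "adj y = y"
      using jj by (simp_all add: y_def J_scale adj_mult adj_k Suc.prems flip: k_comm del: of_real_divide of_real_mult)
    have b: "bounded_by 1 (1 - y)" and c: "N (j * (1 - y)) \<le> 3/4 * r"
      unfolding y_def using bounded_by_cos_scaled N_cos_scaled_le J_A Suc.prems \<open>N j < r\<close> by blast+
    have "j * (1 - y) = (1 - y) * j"
      by (simp add: y_def right_diff_distrib left_diff_distrib k_left_comm[of j] mult.assoc)
    then have sa: "adj (j * (1 - y)) = j * (1 - y)"
      by (simp add: adj_simps y Suc.prems)
    have jy: "j * (1 - y) \<in> J"
      using J_diff[OF Suc.prems(1) J_left[OF J_A[OF Suc.prems(1)] y(1)]] by (simp add: right_diff_distrib)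
    have "N (j * (1 - y)) < e * (5/4) ^ n"
      by (rule le_less_trans[OF c]) (use \<open>0 < e\<close> in \<open>simp add: r_def\<close>)
    from Suc.IH[OF jy sa this] obtain z where z: "z \<in> J" "bounded_by 1 (1 - z)"
      "bounded_by 1 (1 - adj z)" "N (j * (1 - y) * (1 - z)) < e" by blast
    define w where "w = y + z - y * z"
    have w: "1 - w = (1 - y) * (1 - z)" "1 - adj w = (1 - adj z) * (1 - y)"
      by (simp_all add: w_def adj_simps y algebra_simps)
    have "w \<in> J" unfolding w_def by (intro J_closed J_left J_A y z)
    moreover have "bounded_by 1 (1 - w)" "bounded_by 1 (1 - adj w)"
      unfolding w using bounded_by_mult[OF b z(2)] bounded_by_mult[OF z(3) b] by simp_all
    moreover have "N (j * (1 - w)) < e" using z(4) by (simp add: w mult.assoc)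
    ultimately show ?case by blast
  qed
  obtain n where "N j / e < (5/4) ^ n" using real_arch_pow[of "5/4"] by auto
  then have "N j < e * (5/4) ^ n" using \<open>0 < e\<close> by (simp add: field_simps)
  with main[OF assms(1,2)] that show thesis by blast
qed

end

section \<open>Quotient seminorms\<close>

lemma le_limit_at_right_0:
  fixes f :: "real \<Rightarrow> real"
  assumes "(f \<longlongrightarrow> L) (at_right 0)" "\<And>e. 0 < e \<Longrightarrow> t \<le> f e"
  shows "t \<le> L"
  by (rule tendsto_lowerbound[OF assms(1)])
    (use assms(2) in \<open>auto intro: eventually_at_right_less[THEN eventually_mono]\<close>)

context star_ideal begin

definition quotient_norm :: "'a \<Rightarrow> real" where
  "quotient_norm x = (INF j\<in>J. N (x - j))"

lemma quotient_norm_le: "x \<in> A \<Longrightarrow> j \<in> J \<Longrightarrow> quotient_norm x \<le> N (x - j)"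
  unfolding quotient_norm_def
  by (rule cINF_lower) (auto intro!: bdd_belowI[of _ 0] N_nonneg A_diff dest: J_A)

lemma quotient_norm_le_N: "x \<in> A \<Longrightarrow> quotient_norm x \<le> N x"
  using quotient_norm_le[of x 0] J_zero by simp

lemma quotient_norm_nonneg: "x \<in> A \<Longrightarrow> 0 \<le> quotient_norm x"
  unfolding quotient_norm_def
  by (rule cINF_greatest) (use J_zero in \<open>auto intro!: N_nonneg A_diff dest: J_A\<close>)

lemma quotient_norm_less:
  assumes "quotient_norm x < d" obtains j where "j \<in> J" "N (x - j) < d"
proof (rule ccontr)
  assume "\<not> thesis"
  then have "d \<le> quotient_norm x" unfolding quotient_norm_def using that J_zero
    by (intro cINF_greatest) (auto simp: not_less[symmetric])
  with assms show False by simp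
qed

lemma quotient_norm_J: "j \<in> J \<Longrightarrow> quotient_norm j = 0"
  using quotient_norm_le[of j j] quotient_norm_nonneg[of j] J_A by (simp add: N_zero)

text \<open>
  If \<open>j\<close> in \<open>J\<close> is self-adjoint and close to \<open>x\<^sup>* x\<close>, and \<open>1 - z\<close> is contractive and almost annihilates
  \<open>j\<close>, then \<open>x (1 - z)\<close> is congruent to \<open>x\<close> and
  \<open>\<parallel>x (1 - z)\<parallel>\<^sup>2 \<le> \<parallel>(1 - z\<^sup>*) (x\<^sup>* x - j) (1 - z)\<parallel> + \<parallel>(1 - z\<^sup>*) j (1 - z)\<parallel>\<close>.
\<close>

lemma quotient_norm_square_le:
  assumes x: "x \<in> A" shows "(quotient_norm x)\<^sup>2 \<le> quotient_norm (adj x * x)"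
proof -
  have main: "(quotient_norm x)\<^sup>2 \<le> quotient_norm (adj x * x) + 2 * e" if "0 < e" for e
  proof -
    let ?y = "adj x * x" let ?d = "quotient_norm (adj x * x) + e"
    have y: "?y \<in> A" "adj ?y = ?y" by (auto simp: A_closed x adj_mult adj_adj)
    obtain i where i: "i \<in> J" "N (?y - i) < ?d"
      using quotient_norm_less[of ?y ?d] \<open>0 < e\<close> by auto
    \<comment> \<open>\<open>x\<^sup>* x\<close> is self-adjoint, so symmetrizing keeps the distance\<close>
    define j where "j = \<kappa> (1/2) * (i + adj i)"
    have j: "j \<in> J" "adj j = j"
      unfolding j_def using i by (auto intro!: J_closed simp: adj_simps add.commute simp flip: k_comm)
    have half: "\<kappa> (1/2) * z + \<kappa> (1/2) * z = z" for z
    proof -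
      have "\<kappa> (1/2) * z + \<kappa> (1/2) * z = \<kappa> (1/2 + 1/2) * z" by (simp only: k_add distrib_right)
      then show ?thesis by (simp add: k_one)
    qed
    have "?y - j = \<kappa> (1/2) * ((?y - i) + adj (?y - i))"
      using half[of ?y] y(2) by (simp add: j_def adj_diff algebra_simps)
    then have "N (?y - j) = 1/2 * N ((?y - i) + adj (?y - i))"
      using N_scale[of "(?y - i) + adj (?y - i)" "1/2"] y i by (simp add: A_closed J_A)
    also have "\<dots> \<le> 1/2 * (N (?y - i) + N (?y - i))"
      using N_triangle[of "?y - i" "adj (?y - i)"] N_adj[of "?y - i"] y i by (simp add: A_closed J_A)
    finally have Nj: "N (?y - j) \<le> ?d" using i by simp
    obtain z where z: "z \<in> J" "bounded_by 1 (1 - z)" "bounded_by 1 (1 - adj z)" "N (j * (1 - z)) < e"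
      using approximate_unit[OF j \<open>0 < e\<close>] .
    have zm: "1 - z \<in> multipliers" "1 - adj z \<in> multipliers" using z by (auto simp: bounded_by_def)
    have xz: "x * (1 - z) \<in> A" by (intro multipliersD x zm)
    have left: "N ((1 - adj z) * a) \<le> N a" if "a \<in> A" for a
      using z that by (auto simp: bounded_by_def)
    have right: "N (a * (1 - z)) \<le> N a" if "a \<in> A" for a
      using left[of "adj a"] N_adj[of "a * (1 - z)"] N_adj[of a] that
      by (simp add: A_closed multipliersD zm adj_simps)
    have "quotient_norm x \<le> N (x * (1 - z))"
      using quotient_norm_le[OF x J_left[OF x z(1)]] by (simp add: right_diff_distrib)
    then have "(quotient_norm x)\<^sup>2 \<le> (N (x * (1 - z)))\<^sup>2"
      by (intro power_mono quotient_norm_nonneg x)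
    also have "\<dots> = N ((1 - adj z) * ((?y - j) * (1 - z)) + (1 - adj z) * (j * (1 - z)))"
      by (subst N_cstar[symmetric, OF xz]) (simp add: adj_simps algebra_simps)
    also have "\<dots> \<le> N ((1 - adj z) * ((?y - j) * (1 - z))) + N ((1 - adj z) * (j * (1 - z)))"
      by (intro N_triangle multipliersD zm A_diff y J_A j)
    also have "\<dots> \<le> N ((?y - j) * (1 - z)) + N (j * (1 - z))"
      by (intro add_mono left multipliersD zm A_diff y J_A j)
    also have "\<dots> \<le> ?d + e"
      using right[of "?y - j"] Nj z(4) y j by (simp add: A_closed J_A)
    finally show ?thesis by simp
  qed
  show ?thesis
    by (rule le_limit_at_right_0[OF _ main]) (auto intro!: tendsto_eq_intros)
qed

lemma quotient_norm_cstar: "cstar_seminormed \<kappa> adj A quotient_norm"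
proof (rule cstar_seminormedI)
  fix x c assume x: "x \<in> A"
  show "quotient_norm (\<kappa> c * x) \<le> cmod c * quotient_norm x"
  proof (rule le_limit_at_right_0)
    show "((\<lambda>e. cmod c * (quotient_norm x + e)) \<longlongrightarrow> cmod c * quotient_norm x) (at_right 0)"
      by (auto intro!: tendsto_eq_intros)
    fix e :: real assume "0 < e"
    then obtain j where j: "j \<in> J" "N (x - j) < quotient_norm x + e"
      using quotient_norm_less[of x "quotient_norm x + e"] by auto
    have "quotient_norm (\<kappa> c * x) \<le> N (\<kappa> c * x - \<kappa> c * j)"
      by (intro quotient_norm_le A_closed J_closed x j)
    also have "\<dots> = cmod c * N (x - j)"
      using N_scale[of "x - j" c] x j by (simp add: A_closed J_A right_diff_distrib)
    also have "\<dots> \<le> cmod c * (quotient_norm x + e)" using j by (intro mult_left_mono) auto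
    finally show "quotient_norm (\<kappa> c * x) \<le> cmod c * (quotient_norm x + e)" .
  qed
next
  fix x y assume x: "x \<in> A" and y: "y \<in> A"
  have choose: "\<exists>j\<in>J. \<exists>k\<in>J. N (x - j) \<le> quotient_norm x + e \<and> N (y - k) \<le> quotient_norm y + e"
    if "0 < e" for e
    using quotient_norm_less[of x "quotient_norm x + e"] quotient_norm_less[of y "quotient_norm y + e"] that
    by (metis less_add_same_cancel1 less_imp_le)
  show "quotient_norm (x + y) \<le> quotient_norm x + quotient_norm y"
  proof (rule le_limit_at_right_0)
    show "((\<lambda>e. (quotient_norm x + e) + (quotient_norm y + e)) \<longlongrightarrow> quotient_norm x + quotient_norm y) (at_right 0)"
      by (auto intro!: tendsto_eq_intros)
    fix e :: real assume "0 < e"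
    then obtain j k where j: "j \<in> J" "k \<in> J" "N (x - j) \<le> quotient_norm x + e" "N (y - k) \<le> quotient_norm y + e"
      using choose by blast
    have "quotient_norm (x + y) \<le> N ((x + y) - (j + k))"
      by (intro quotient_norm_le A_closed J_closed x y j)
    also have "\<dots> \<le> N (x - j) + N (y - k)"
      using N_triangle[of "x - j" "y - k"] x y j by (simp add: A_closed J_A algebra_simps)
    finally show "quotient_norm (x + y) \<le> (quotient_norm x + e) + (quotient_norm y + e)" using j by simp
  qed
  show "quotient_norm (x * y) \<le> quotient_norm x * quotient_norm y"
  proof (rule le_limit_at_right_0)
    show "((\<lambda>e. (quotient_norm x + e) * (quotient_norm y + e)) \<longlongrightarrow> quotient_norm x * quotient_norm y) (at_right 0)"
      by (auto intro!: tendsto_eq_intros)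
    fix e :: real assume "0 < e"
    then obtain j k where j: "j \<in> J" "k \<in> J" "N (x - j) \<le> quotient_norm x + e" "N (y - k) \<le> quotient_norm y + e"
      using choose by blast
    have "quotient_norm (x * y) \<le> N (x * y - (j * y + x * k - j * k))"
      by (intro quotient_norm_le A_mult x y J_closed J_left J_right j J_A)
    also have "x * y - (j * y + x * k - j * k) = (x - j) * (y - k)"
      by (simp add: algebra_simps)
    also have "N \<dots> \<le> N (x - j) * N (y - k)"
      by (intro N_mult A_diff x y J_A j)
    also have "\<dots> \<le> (quotient_norm x + e) * (quotient_norm y + e)"
      using j \<open>0 < e\<close> by (intro mult_mono N_nonneg A_diff x y add_nonneg_nonneg quotient_norm_nonneg)
        (auto dest: J_A)
    finally show "quotient_norm (x * y) \<le> (quotient_norm x + e) * (quotient_norm y + e)" .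
  qed
qed (auto intro: A_closed quotient_norm_nonneg quotient_norm_square_le)

end

section \<open>Automatic continuity\<close>

locale two_cstar_seminorms = cstar_seminormed \<kappa> adj A N + M: cstar_seminormed \<kappa> adj A M
  for \<kappa> :: "complex \<Rightarrow> 'a::ring_1" and adj A N M +
  assumes null: "x \<in> A \<Longrightarrow> N x = 0 \<Longrightarrow> M x = 0"
    and complete: "\<lbrakk>\<And>n::nat. X n \<in> A; \<And>e. 0 < e \<Longrightarrow> \<exists>m. \<forall>k\<ge>m. \<forall>l\<ge>m. N (X k - X l) < e\<rbrakk>
      \<Longrightarrow> \<exists>x\<in>A. (\<lambda>n. N (X n - x)) \<longlonglongrightarrow> 0"
begin

text \<open>
  Completeness provides an exact solution \<open>s\<close> of the iteration, up to \<open>N\<close>-null elements, and these are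
  \<open>M\<close>-null. So \<open>h \<plusminus> i (1 - s)\<close> act isometrically for \<open>M\<close>, whatever the relation between \<open>M\<close> and \<open>N\<close>, and
  their mean \<open>h\<close> acts contractively.
\<close>

lemma M_le_1: assumes h: "h \<in> A" "adj h = h" "N h < 1" shows "M h \<le> 1"
proof -
  let ?s = "root_iter h"
  have step: "N (?s n - ?s (n + m)) \<le> N h ^ n / (1 - N h)" for n m
  proof -
    have "N (?s n - ?s (n + m)) \<le> (\<Sum>i<m. N h ^ (n + i))"
    proof (induction m)
      case 0 then show ?case by (simp add: N_zero)
    next
      case (Suc m)
      have "N (?s n - ?s (n + Suc m)) \<le> N (?s n - ?s (n + m)) + N (?s (n + m) - ?s (Suc (n + m)))"
        unfolding add_Suc_right by (intro N_diff_triangle root_iter_A[OF h])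
      also have "N (?s (n + m) - ?s (Suc (n + m))) \<le> N h ^ (n + m)"
        using root_iter_step[OF h, of "n + m"] N_minus_commute[OF root_iter_A[OF h] root_iter_A[OF h]] by metis
      finally show ?case using Suc by simp
    qed
    also have "\<dots> = N h ^ n * (\<Sum>i<m. N h ^ i)" by (simp add: power_add sum_distrib_left)
    also have "\<dots> \<le> N h ^ n * (1 / (1 - N h))"
      using h N_nonneg[of h] by (intro mult_left_mono) (auto simp: sum_gp_strict divide_right_mono)
    finally show ?thesis by simp
  qed
  have lim: "(\<lambda>n. N h ^ n / (1 - N h)) \<longlonglongrightarrow> 0"
    using h N_nonneg[of h] by (intro tendsto_divide_zero LIMSEQ_power_zero) auto
  have "\<exists>s\<in>A. (\<lambda>n. N (?s n - s)) \<longlonglongrightarrow> 0"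
  proof (rule complete)
    fix e :: real assume "0 < e"
    then have "eventually (\<lambda>n. N h ^ n / (1 - N h) < e) sequentially"
      using order_tendstoD(2)[OF lim] by blast
    then obtain m where m: "N h ^ n / (1 - N h) < e" if "n \<ge> m" for n
      by (auto simp: eventually_sequentially)
    have "N (?s k - ?s l) < e" if "m \<le> k" "k \<le> l" for k l
      using step[of k "l - k"] m[of k] that by simp
    then have "\<forall>k\<ge>m. \<forall>l\<ge>m. N (?s k - ?s l) < e"
      by (metis N_minus_commute root_iter_A[OF h] nle_le)
    then show "\<exists>m. \<forall>k\<ge>m. \<forall>l\<ge>m. N (?s k - ?s l) < e" by blast
  qed (rule root_iter_A[OF h])
  then obtain s where s: "s \<in> A" and slim: "(\<lambda>n. N (?s n - s)) \<longlonglongrightarrow> 0" by blast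
  have diff_null: "N z = 0" if z: "z \<in> A" and b: "\<And>n. N z \<le> C * N (?s n - s) + D * N h ^ n" for z C D
  proof -
    have "(\<lambda>n. C * N (?s n - s) + D * N h ^ n) \<longlonglongrightarrow> C * 0 + D * 0"
      using h N_nonneg[of h] by (intro tendsto_intros slim LIMSEQ_power_zero) auto
    then have "N z \<le> 0" using b by (intro tendsto_lowerbound) auto
    then show ?thesis using N_nonneg[OF z] by simp
  qed
  have sa: "N (adj s - s) = 0"
  proof (rule diff_null[where C=2 and D=0])
    fix n
    have "adj s - s = (?s n - s) - adj (?s n - s)"
      using root_iter_adj[OF h, of n] by (simp add: adj_diff)
    then have "N (adj s - s) = N ((?s n - s) - adj (?s n - s))" by (rule arg_cong)
    then show "N (adj s - s) \<le> 2 * N (?s n - s) + 0 * N h ^ n"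
      using N_diff[of "?s n - s" "adj (?s n - s)"] N_adj[of "?s n - s"] s root_iter_A[OF h, of n]
      by (simp add: A_closed)
  qed (use s in \<open>simp add: A_closed\<close>)
  have comm: "N (h * s - s * h) = 0"
  proof (rule diff_null[where C="2 * N h" and D=0])
    fix n
    let ?t = "?s n - s"
    have t: "?t \<in> A" by (intro A_closed root_iter_A[OF h] s)
    have "h * s - s * h = ?t * h - h * ?t"
      using root_iter_comm[OF h, of n] by (simp add: algebra_simps)
    then have "N (h * s - s * h) = N (?t * h - h * ?t)" by (rule arg_cong)
    then have "N (h * s - s * h) \<le> N ?t * N h + N h * N ?t"
      using N_diff[OF A_mult[OF t h(1)] A_mult[OF h(1) t]] N_mult[OF t h(1)] N_mult[OF h(1) t]
      by linarith
    then show "N (h * s - s * h) \<le> 2 * N h * N (?s n - s) + 0 * N h ^ n" by simp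
  qed (use s h in \<open>simp add: A_closed\<close>)
  have A2: "2 * z \<in> A" "N (2 * z) = 2 * N z" if "z \<in> A" for z
    using A_scale[OF that, of 2] N_scale[OF that, of 2] by (simp_all add: k_numeral)
  have res: "N (2 * s - h * h - s * s) = 0"
  proof (rule diff_null[where C="3 + N s" and D=2])
    fix n
    let ?t = "?s n - s" let ?r = "2 * ?s n - h * h - ?s n * ?s n"
    have sn: "?s n \<in> A" by (rule root_iter_A[OF h])
    have t: "?t \<in> A" by (intro A_diff sn s)
    have t2: "2 * ?t \<in> A" by (rule A2[OF t])
    have r: "?r \<in> A" by (intro A_diff A2 A_mult root_iter_A[OF h] h)
    have N1: "N (?s n) \<le> 1" using root_iter_N[OF h, of n] h by simp
    have "2 * s - h * h - s * s = ?r - 2 * ?t + (?s n * ?t + ?t * s)"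
      by (simp add: algebra_simps)
    also have "N \<dots> \<le> N (?r - 2 * ?t) + N (?s n * ?t + ?t * s)"
      by (intro N_triangle[OF A_diff[OF r t2] A_add[OF A_mult[OF sn t] A_mult[OF t s]]])
    also have "\<dots> \<le> (N ?r + N (2 * ?t)) + (N (?s n) * N ?t + N ?t * N s)"
      using N_diff[OF r t2] N_triangle[OF A_mult[OF sn t] A_mult[OF t s]] N_mult[OF sn t] N_mult[OF t s]
      by linarith
    also have "\<dots> \<le> (2 * N h ^ n + 2 * N ?t) + (1 * N ?t + N ?t * N s)"
      by (intro add_mono mult_right_mono root_iter_residual[OF h] N1 N_nonneg t s A2(2)[THEN eq_refl] order_refl)
    finally show "N (2 * s - h * h - s * s) \<le> (3 + N s) * N (?s n - s) + 2 * N h ^ n"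
      by (simp add: algebra_simps)
  qed (intro A_diff A2 A_mult s h)
  define u where "u = h + \<kappa> \<i> * (1 - s)"
  define v where "v = h - \<kappa> \<i> * (1 - s)"
  have mult: "u \<in> multipliers" "v \<in> multipliers" "adj u \<in> multipliers" "adj v \<in> multipliers"
    unfolding u_def v_def by (intro multipliers_closed h s)+
  define c where "c = h * s - s * h" define d where "d = 2 * s - h * h - s * s"
  define t where "t = adj s - s"
  have cdt: "c \<in> A" "d \<in> A" "t \<in> A"
    unfolding c_def d_def t_def by (intro A_diff A2 A_mult A_adj s h)+
  then have Mcdt: "M c = 0" "M d = 0" "M t = 0"
    using null comm res sa unfolding c_def d_def t_def by blast+
  have iso: "M (w * b) = M b" if w: "w = u \<or> w = v" and b: "b \<in> A" for w b
  proof -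
    define g where "g = (if w = u then \<i> else - \<i>)"
    have g: "g * g = - 1" "cnj g = - g" by (auto simp: g_def)
    have wg: "w = h + \<kappa> g * (1 - s)" using w by (auto simp: g_def u_def v_def k_uminus)
    have wA: "w \<in> multipliers" using w mult by blast
    define z where "z = \<kappa> (- g) * c - d + t * s - t + \<kappa> g * (t * h)"
    have "adj w * w = (h - \<kappa> g * (1 - s - t)) * (h + \<kappa> g * (1 - s))"
      by (simp add: wg adj_simps h g t_def k_uminus k_comm[of g "1 - adj s", symmetric])
    also have "\<dots> = h * h + \<kappa> g * (h * (1 - s)) - \<kappa> g * ((1 - s - t) * h)
        - \<kappa> g * (\<kappa> g * ((1 - s - t) * (1 - s)))"
      by (simp only: left_diff_distrib[of h] distrib_left[of _ h] k_left_comm[of h]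
        k_left_comm[of "1 - s - t"] mult.assoc) simp
    also have "\<kappa> g * (\<kappa> g * ((1 - s - t) * (1 - s))) = - ((1 - s - t) * (1 - s))"
      by (simp add: k_assoc g k_uminus k_one)
    also have "h * h + \<kappa> g * (h * (1 - s)) - \<kappa> g * ((1 - s - t) * h) - - ((1 - s - t) * (1 - s)) = 1 + z"
      by (simp add: z_def c_def d_def k_uminus algebra_simps mult_2)
    finally have ww: "adj w * w = 1 + z" .
    have null_add: "M (p + q) = 0" if "p \<in> A" "q \<in> A" "M p = 0" "M q = 0" for p q
      using M.N_triangle[OF that(1,2)] M.N_nonneg[OF A_add[OF that(1,2)]] that by simp
    have null_mult: "M (p * q) = 0" if "p \<in> A" "q \<in> A" "M p = 0" for p q
      using M.N_mult[OF that(1,2)] M.N_nonneg[OF A_mult[OF that(1,2)]] that by simp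
    have null_scale: "M (\<kappa> a * p) = 0" if "p \<in> A" "M p = 0" for a p
      using M.N_scale[OF that(1)] that by simp
    have null_uminus: "M (- p) = 0" if "p \<in> A" "M p = 0" for p
      using M.N_uminus[OF that(1)] that by simp
    have "z \<in> A \<and> M z = 0"
      unfolding z_def diff_conv_add_uminus
      by (intro conjI null_add null_scale null_mult null_uminus cdt Mcdt A_closed s h)
    then have zA: "z \<in> A" and Mz: "M z = 0" by auto
    have "(M (w * b))\<^sup>2 = M (adj (w * b) * (w * b))"
      by (rule M.N_cstar[symmetric]) (intro multipliersD wA b)
    also have "adj (w * b) * (w * b) = adj b * b + adj b * (z * b)"
      using ww by (simp add: adj_mult mult.assoc flip: mult.assoc[of "adj w"]) (simp add: algebra_simps)
    also have "M \<dots> = M (adj b * b)"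
    proof -
      have "M (adj b * (z * b)) \<le> M (adj b) * (M z * M b)"
        by (rule order_trans[OF M.N_mult]) (intro A_closed zA b mult_left_mono M.N_mult M.N_nonneg)+
      then have "M (adj b * (z * b)) = 0"
        using M.N_nonneg[of "adj b * (z * b)"] zA b by (simp add: Mz A_closed)
      then show ?thesis
        using M.N_abs_diff[of "adj b * b + adj b * (z * b)" "adj b * b"] zA b by (simp add: A_closed)
    qed
    also have "\<dots> = (M b)\<^sup>2" by (rule M.N_cstar[OF b])
    finally show ?thesis using M.N_nonneg[OF b] M.N_nonneg[OF multipliersD(1)[OF wA b]]
      by (simp add: power2_eq_iff_nonneg)
  qed
  have "M (\<kappa> 2 * (h * h)) = M (u * h + v * h)"
    by (simp add: u_def v_def k_numeral algebra_simps mult_2)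
  also have "\<dots> \<le> M (u * h) + M (v * h)"
    by (intro M.N_triangle multipliersD mult h)
  also have "\<dots> = 2 * M h" using iso h by simp
  finally have "M (h * h) \<le> M h" using M.N_scale[of "h * h" 2] h by (simp add: A_closed)
  then have "M h * M h \<le> 1 * M h" using M.N_cstar[OF h(1)] h by (simp add: power2_eq_square)
  then show ?thesis using M.N_nonneg[OF h(1)] by (cases "M h = 0") (auto simp: mult_le_cancel_right)
qed

text \<open>
  On a complete C*-algebra every C*-seminorm is bounded by the norm. This is the contractivity of
  *-homomorphisms, freed of the target algebra.
\<close>

theorem M_le_N: assumes x: "x \<in> A" shows "M x \<le> N x"
proof -
  have sa: "M h \<le> N h" if h: "h \<in> A" "adj h = h" for h
  proof (rule le_limit_at_right_0)
    show "((\<lambda>e. N h + e) \<longlongrightarrow> N h) (at_right 0)" by (auto intro!: tendsto_eq_intros)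
    fix e :: real assume e: "0 < e"
    define r where "r = N h + e"
    have r: "0 < r" "N h < r" using e N_nonneg[OF h(1)] by (auto simp: r_def)
    let ?g = "\<kappa> (of_real (1/r)) * h"
    have c: "cmod (of_real (1/r)) = 1/r" using r by (simp only: norm_of_real) simp
    have "M ?g \<le> 1"
    proof (rule M_le_1)
      show "?g \<in> A" by (intro A_closed h)
      show "adj ?g = ?g" by (simp add: adj_simps h k_comm)
      show "N ?g < 1" using N_scale[OF h(1), of "of_real (1/r)"] r c by simp
    qed
    then show "M h \<le> N h + e" using M.N_scale[OF h(1), of "of_real (1/r)"] r c
      by (simp add: r_def[symmetric] divide_le_eq)
  qed
  have "(M x)\<^sup>2 \<le> (N x)\<^sup>2"
    using sa[of "adj x * x"] x N_cstar[OF x] M.N_cstar[OF x] by (simp add: A_closed adj_mult adj_adj)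
  then show ?thesis using N_nonneg[OF x] by (simp add: power2_le_iff_abs_le)
qed

end

section \<open>Free *-algebras and substitution\<close>

abbreviation scalar :: "complex \<Rightarrow> 'g star_poly" where
  "scalar c \<equiv> Poly_Mapping.single 0 c"

definition letter :: "'g \<times> bool \<Rightarrow> 'g star_poly" where
  "letter l = Poly_Mapping.single (Word [l]) 1"

definition words :: "'g set \<Rightarrow> 'g word set" where
  "words G = {w. letters w \<noteq> [] \<and> fst ` set (letters w) \<subseteq> G}"

lemma star_polys_iff: "p \<in> star_polys G \<longleftrightarrow> Poly_Mapping.keys p \<subseteq> words G"
  by (auto simp: star_polys_def words_def)

lemma letters_plus [simp]: "letters (u + w) = letters u @ letters w"
  by (simp add: plus_word_def)

lemma letters_zero [simp]: "letters 0 = []"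
  by (simp add: zero_word_def)

lemma word_adj_adj: "word_adj (word_adj w) = w"
  by (cases w) (simp add: word_adj_def rev_map o_def case_prod_unfold)

lemma inj_word_adj: "inj word_adj"
  by (metis injI word_adj_adj)

lemma word_adj_plus: "word_adj (u + w) = word_adj w + word_adj u"
  by (simp add: word_adj_def plus_word_def)

lemma word_adj_zero: "word_adj 0 = 0"
  by (simp add: word_adj_def zero_word_def)

lemma word_adj_words: "word_adj w \<in> words G \<longleftrightarrow> w \<in> words G"
  by (auto simp: word_adj_def words_def image_image case_prod_unfold)

lemma lookup_poly_adj: "Poly_Mapping.lookup (poly_adj p) w = cnj (Poly_Mapping.lookup p (word_adj w))"
  unfolding poly_adj_def
  by (simp add: Poly_Mapping.map.rep_eq Poly_Mapping.map_key.rep_eq inj_word_adj when_def)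

lemma poly_adj_single: "poly_adj (Poly_Mapping.single w c) = Poly_Mapping.single (word_adj w) (cnj c)"
  by (rule poly_mapping_eqI)
    (auto simp: lookup_poly_adj lookup_single when_def word_adj_adj)

lemma poly_adj_add: "poly_adj (p + q) = poly_adj p + poly_adj q"
  by (rule poly_mapping_eqI) (simp add: lookup_poly_adj lookup_add)

lemma star_poly_decompose:
  "p = (\<Sum>w\<in>Poly_Mapping.keys p. Poly_Mapping.single w (Poly_Mapping.lookup p w))"
proof (rule poly_mapping_eqI)
  fix v
  have "(\<Sum>w\<in>Poly_Mapping.keys p. Poly_Mapping.lookup p w when w = v) = Poly_Mapping.lookup p v"
    by (cases "v \<in> Poly_Mapping.keys p")
      (auto simp: when_def sum.If_cases in_keys_iff Int_def conj_commute cong: conj_cong)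
  then show "Poly_Mapping.lookup p v = Poly_Mapping.lookup
      (\<Sum>w\<in>Poly_Mapping.keys p. Poly_Mapping.single w (Poly_Mapping.lookup p w)) v"
    by (simp add: lookup_sum lookup_single)
qed

lemma star_poly_induct [case_names zero add single]:
  fixes p :: "'a \<Rightarrow>\<^sub>0 'b::comm_monoid_add"
  assumes "P 0" "\<And>p q. P p \<Longrightarrow> P q \<Longrightarrow> P (p + q)" "\<And>w c. P (Poly_Mapping.single w c)"
  shows "P p"
proof -
  have "P (\<Sum>w\<in>W. Poly_Mapping.single w (f w))" for W f
    by (induction W rule: infinite_finite_induct) (auto intro: assms)
  then show ?thesis by (subst star_poly_decompose)
qed

lemma poly_adj_zero: "poly_adj 0 = 0"
  by (rule poly_mapping_eqI) (simp add: lookup_poly_adj)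

lemma poly_adj_mult_single:
  "poly_adj (p * Poly_Mapping.single w c) = poly_adj (Poly_Mapping.single w c) * poly_adj p"
  by (induction p rule: star_poly_induct)
    (simp_all add: poly_adj_zero poly_adj_add algebra_simps mult_single poly_adj_single word_adj_plus)

interpretation poly: star_ring scalar poly_adj
proof
  fix c d :: complex and p q :: "'g star_poly"
  show "scalar (c + d) = (scalar c + scalar d :: 'g star_poly)" by (rule single_add)
  show "scalar (c * d) = (scalar c * scalar d :: 'g star_poly)" by (simp add: mult_single)
  show "scalar 1 = (1 :: 'g star_poly)" by simp
  show "scalar c * p = p * scalar c"
    by (induction p rule: star_poly_induct) (simp_all add: algebra_simps mult_single mult.commute)
  show "poly_adj (p + q) = poly_adj p + poly_adj q" by (rule poly_adj_add)
  show "poly_adj (p * q) = poly_adj q * poly_adj p"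
    by (induction q rule: star_poly_induct)
      (simp_all add: poly_adj_zero poly_adj_add algebra_simps poly_adj_mult_single)
  show "poly_adj (poly_adj p) = p"
    by (rule poly_mapping_eqI) (simp add: lookup_poly_adj word_adj_adj)
  show "poly_adj (scalar c) = (scalar (cnj c) :: 'g star_poly)"
    by (simp add: poly_adj_single word_adj_zero)
qed

lemma star_polys_zero: "0 \<in> star_polys G"
  by (simp add: star_polys_iff)

lemma star_polys_add: "p \<in> star_polys G \<Longrightarrow> q \<in> star_polys G \<Longrightarrow> p + q \<in> star_polys G"
  unfolding star_polys_iff using keys_add[of p q] by blast

lemma star_polys_mult: "p \<in> star_polys G \<Longrightarrow> q \<in> star_polys G \<Longrightarrow> p * q \<in> star_polys G"
  unfolding star_polys_iff using keys_mult[of p q] by (fastforce simp: words_def)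

lemma star_polys_scale: assumes "p \<in> star_polys G" shows "scalar c * p \<in> star_polys G"
proof -
  have "scalar c * p = Poly_Mapping.map ((*) c) p" by (rule mult_map_scale_conv_mult[symmetric])
  then have "Poly_Mapping.keys (scalar c * p) \<subseteq> Poly_Mapping.keys p"
    by (auto simp: in_keys_iff Poly_Mapping.map.rep_eq)
  then show ?thesis using assms by (auto simp: star_polys_iff)
qed

lemma star_polys_adj: assumes "p \<in> star_polys G" shows "poly_adj p \<in> star_polys G"
  unfolding star_polys_iff
proof
  fix w assume "w \<in> Poly_Mapping.keys (poly_adj p)"
  then have "word_adj w \<in> Poly_Mapping.keys p" by (simp add: in_keys_iff lookup_poly_adj)
  then show "w \<in> words G" using assms by (auto simp: star_polys_iff word_adj_words)
qed

lemma star_polys_gen: "poly_gen g \<in> star_polys G \<longleftrightarrow> g \<in> G"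
  by (simp add: star_polys_iff poly_gen_def words_def)

lemma star_polys_mono: "G \<subseteq> H \<Longrightarrow> star_polys G \<subseteq> star_polys H"
  by (auto simp: star_polys_def)

lemma star_polys_single: "w \<in> words G \<Longrightarrow> Poly_Mapping.single w c \<in> star_polys G"
  by (cases "c = 0") (auto simp: star_polys_iff)

lemma letter_eq: "letter (g, b) = (if b then poly_adj (poly_gen g) else poly_gen g)"
  by (simp add: letter_def poly_gen_def poly_adj_single word_adj_def)

lemma single_word: "Poly_Mapping.single (Word ls) c = scalar c * prod_list (map letter ls)"
proof (induction ls rule: rev_induct)
  case Nil then show ?case by (simp flip: zero_word_def)
next
  case (snoc l ls)
  have "Poly_Mapping.single (Word (ls @ [l])) c = Poly_Mapping.single (Word ls) c * letter l"
    by (simp add: letter_def mult_single plus_word_def)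
  then show ?case by (simp add: snoc mult.assoc)
qed

text \<open>
  The *-polynomials without constant term form the *-algebra generated by the variables. The rule
  spares later proofs any mention of words.
\<close>

lemma star_polys_induct [consumes 1, case_names zero add scale mult gen adj]:
  assumes "p \<in> star_polys G"
    and "P 0" "\<And>p q. p \<in> star_polys G \<Longrightarrow> q \<in> star_polys G \<Longrightarrow> P p \<Longrightarrow> P q \<Longrightarrow> P (p + q)"
    and scale: "\<And>c p. p \<in> star_polys G \<Longrightarrow> P p \<Longrightarrow> P (scalar c * p)"
    and mult: "\<And>p q. p \<in> star_polys G \<Longrightarrow> q \<in> star_polys G \<Longrightarrow> P p \<Longrightarrow> P q \<Longrightarrow> P (p * q)"
    and gen: "\<And>g. g \<in> G \<Longrightarrow> P (poly_gen g)"
    and adj: "\<And>p. p \<in> star_polys G \<Longrightarrow> P p \<Longrightarrow> P (poly_adj p)"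
  shows "P p"
proof -
  have letter: "letter l \<in> star_polys G \<and> P (letter l)" if "fst l \<in> G" for l
    using that gen adj by (cases l) (auto simp: letter_eq star_polys_gen star_polys_adj)
  have word: "prod_list (map letter (l # ls)) \<in> star_polys G \<and> P (prod_list (map letter (l # ls)))"
    if "fst ` set (l # ls) \<subseteq> G" for l ls
    using that
  proof (induction ls arbitrary: l)
    case Nil then show ?case using letter by simp
  next
    case (Cons k ls)
    then show ?case using letter[of l] mult[of "letter l" "prod_list (map letter (k # ls))"]
      by (auto simp: star_polys_mult)
  qed
  have single: "P (Poly_Mapping.single w c)" if w: "w \<in> words G" for w c
  proof -
    obtain l ls where ls: "letters w = l # ls"
      using w by (cases "letters w") (simp_all add: words_def)
    then have "w = Word (l # ls)" "fst ` set (l # ls) \<subseteq> G"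
      using that by (metis word.collapse) (use w in \<open>simp only: words_def mem_Collect_eq ls[symmetric]\<close>)
    then show ?thesis using word scale by (simp only: single_word)
  qed
  have "(\<Sum>w\<in>W. Poly_Mapping.single w (f w)) \<in> star_polys G \<and> P (\<Sum>w\<in>W. Poly_Mapping.single w (f w))"
    if "W \<subseteq> words G" for W f
    using that
    by (induction W rule: infinite_finite_induct)
      (auto intro: assms single star_polys_single star_polys_zero star_polys_add)
  then show ?thesis using assms(1) by (subst star_poly_decompose) (simp add: star_polys_iff)
qed

definition word_subst :: "('g \<Rightarrow> 'h star_poly) \<Rightarrow> ('g \<times> bool) list \<Rightarrow> 'h star_poly" where
  "word_subst \<sigma> ls = prod_list (map (\<lambda>(g, b). if b then poly_adj (\<sigma> g) else \<sigma> g) ls)"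

text \<open>
  The *-homomorphism from the free unital *-algebra that extends an assignment to the generators.
\<close>

definition subst :: "('g \<Rightarrow> 'h star_poly) \<Rightarrow> 'g star_poly \<Rightarrow> 'h star_poly" where
  "subst \<sigma> p = (\<Sum>w\<in>Poly_Mapping.keys p. scalar (Poly_Mapping.lookup p w) * word_subst \<sigma> (letters w))"

lemma subst_superset:
  assumes "finite W" "Poly_Mapping.keys p \<subseteq> W"
  shows "subst \<sigma> p = (\<Sum>w\<in>W. scalar (Poly_Mapping.lookup p w) * word_subst \<sigma> (letters w))"
  unfolding subst_def by (rule sum.mono_neutral_left) (use assms in \<open>auto simp: in_keys_iff\<close>)

lemma subst_zero: "subst \<sigma> 0 = 0"
  by (simp add: subst_def)

lemma subst_add: "subst \<sigma> (p + q) = subst \<sigma> p + subst \<sigma> q"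
proof -
  let ?W = "Poly_Mapping.keys p \<union> Poly_Mapping.keys q"
  have "subst \<sigma> p = (\<Sum>w\<in>?W. scalar (Poly_Mapping.lookup p w) * word_subst \<sigma> (letters w))"
    "subst \<sigma> q = (\<Sum>w\<in>?W. scalar (Poly_Mapping.lookup q w) * word_subst \<sigma> (letters w))"
    "subst \<sigma> (p + q) = (\<Sum>w\<in>?W. scalar (Poly_Mapping.lookup (p + q) w) * word_subst \<sigma> (letters w))"
    using keys_add[of p q] by (auto intro!: subst_superset)
  then show ?thesis by (simp add: lookup_add single_add distrib_right sum.distrib)
qed

lemma subst_single: "subst \<sigma> (Poly_Mapping.single w c) = scalar c * word_subst \<sigma> (letters w)"
  by (cases "c = 0") (simp_all add: subst_def)

lemma word_subst_append: "word_subst \<sigma> (u @ v) = word_subst \<sigma> u * word_subst \<sigma> v"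
  by (simp add: word_subst_def)

lemma scalar_mult_mult: "scalar c * a * (scalar d * b) = scalar (c * d) * (a * b)"
  by (metis mult.assoc poly.k_comm poly.k_mult)

lemma subst_mult: "subst \<sigma> (p * q) = subst \<sigma> p * subst \<sigma> q"
proof (induction p rule: star_poly_induct)
  case (single w c)
  then show ?case
  proof (induction q rule: star_poly_induct)
    case (single v d)
    show ?case
      by (simp add: mult_single subst_single word_subst_append scalar_mult_mult)
  qed (simp_all add: subst_zero subst_add distrib_left)
qed (simp_all add: subst_zero subst_add distrib_right)

lemma subst_scalar: "subst \<sigma> (scalar c) = scalar c"
  by (simp add: subst_single word_subst_def)

lemma subst_one: "subst \<sigma> 1 = 1"
  using subst_scalar[of \<sigma> 1] by simp

lemma subst_scale: "subst \<sigma> (scalar c * p) = scalar c * subst \<sigma> p"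
  by (simp add: subst_mult subst_scalar)

lemma subst_gen: "subst \<sigma> (poly_gen g) = \<sigma> g"
  by (simp add: poly_gen_def subst_single word_subst_def)

lemma subst_uminus: "subst \<sigma> (- p) = - subst \<sigma> p"
  using subst_add[of \<sigma> p "- p"] by (simp add: subst_zero eq_neg_iff_add_eq_0 add.commute)

lemma subst_diff: "subst \<sigma> (p - q) = subst \<sigma> p - subst \<sigma> q"
  using subst_add[of \<sigma> p "- q"] by (simp add: subst_uminus)

lemma subst_sum: "subst \<sigma> (\<Sum>i\<in>I. f i) = (\<Sum>i\<in>I. subst \<sigma> (f i))"
  by (induction I rule: infinite_finite_induct) (simp_all add: subst_zero subst_add)

lemma word_subst_adj:
  "word_subst \<sigma> (rev (map (\<lambda>(g, b). (g, \<not> b)) ls)) = poly_adj (word_subst \<sigma> ls)"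
  by (induction ls) (auto simp: word_subst_def poly.adj_one poly.adj_mult poly.adj_adj)

lemma subst_adj: "subst \<sigma> (poly_adj p) = poly_adj (subst \<sigma> p)"
proof (induction p rule: star_poly_induct)
  case (single w c)
  then show ?case
    by (simp add: poly_adj_single subst_single word_adj_def word_subst_adj poly.adj_mult
        poly.k_comm[symmetric] flip: zero_word_def)
qed (simp_all add: subst_zero subst_add poly.adj_simps)

lemmas subst_simps = subst_zero subst_add subst_mult subst_scalar subst_one subst_gen subst_uminus
  subst_diff subst_sum subst_adj

lemma subst_closed:
  assumes "p \<in> star_polys G" "\<And>g. g \<in> G \<Longrightarrow> \<sigma> g \<in> star_polys H"
  shows "subst \<sigma> p \<in> star_polys H"
  using assms(1)
  by (induction p rule: star_polys_induct)
    (auto simp: subst_simps assms star_polys_zero star_polys_add star_polys_mult star_polys_scale star_polys_adj)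

lemma cstar_seminorm_iff:
  "cstar_seminorm G N \<longleftrightarrow> cstar_seminormed scalar poly_adj (star_polys G) N"
proof
  assume "cstar_seminorm G N"
  then show "cstar_seminormed scalar poly_adj (star_polys G) N"
    by unfold_locales
      (auto simp: cstar_seminorm_def poly_scale_def star_polys_zero star_polys_add star_polys_mult
        star_polys_scale star_polys_adj)
next
  assume "cstar_seminormed scalar poly_adj (star_polys G) N"
  then interpret cstar_seminormed scalar poly_adj "star_polys G" N .
  show "cstar_seminorm G N"
    by (simp add: cstar_seminorm_def poly_scale_def N_nonneg N_scale N_triangle N_mult N_cstar)
qed

section \<open>The universal C*-algebra as a completion\<close>

interpretation seq: star_ring "\<lambda>c (n::nat). scalar c :: 'g star_poly" "\<lambda>X n. poly_adj (X n)"
  by unfold_locales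
    (auto simp: fun_eq_iff plus_fun_def times_fun_def one_fun_def poly.k_add poly.k_mult poly.adj_simps
      intro: poly.k_comm)

text \<open>
  The boundedness of the generators is what makes the supremum in the universal seminorm finite.
\<close>

locale universal =
  fixes G :: "'g set" and R :: "'g star_poly set"
  assumes R_sub: "R \<subseteq> star_polys G"
    and gen_bounded: "g \<in> G \<Longrightarrow>
      \<exists>C. \<forall>N. cstar_seminorm G N \<longrightarrow> (\<forall>r\<in>R. N r = 0) \<longrightarrow> N (poly_gen g) \<le> C"
begin

abbreviation P where "P \<equiv> star_polys G"
abbreviation U where "U \<equiv> universal_seminorm G R"

definition seminorms where "seminorms = {N. cstar_seminorm G N \<and> (\<forall>r\<in>R. N r = 0)}"

lemma U_def: "U p = (SUP N\<in>seminorms. N p)"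
  by (simp add: universal_seminorm_def seminorms_def)

lemma seminorms_cstar: "N \<in> seminorms \<Longrightarrow> cstar_seminormed scalar poly_adj P N"
  by (simp add: seminorms_def cstar_seminorm_iff)

lemma zero_seminorm: "(\<lambda>p. 0) \<in> seminorms"
  by (simp add: seminorms_def cstar_seminorm_def)

lemma seminorms_bdd: "p \<in> P \<Longrightarrow> bdd_above ((\<lambda>N. N p) ` seminorms)"
proof -
  assume "p \<in> P"
  then have "\<exists>C. \<forall>N\<in>seminorms. N p \<le> C"
  proof (induction p rule: star_polys_induct)
    case zero
    then show ?case using cstar_seminormed.N_zero[OF seminorms_cstar] by (metis order_refl)
  next
    case (add p q)
    then obtain C D where "\<forall>N\<in>seminorms. N p \<le> C" "\<forall>N\<in>seminorms. N q \<le> D" by blast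
    then show ?case using cstar_seminormed.N_triangle[OF seminorms_cstar add(1,2)]
      by (intro exI[of _ "C + D"]) force
  next
    case (scale c p)
    then obtain C where "\<forall>N\<in>seminorms. N p \<le> C" by blast
    then have "N (scalar c * p) \<le> cmod c * C" if "N \<in> seminorms" for N
      unfolding cstar_seminormed.N_scale[OF seminorms_cstar[OF that] scale(1)]
      using that by (intro mult_left_mono) auto
    then show ?case by blast
  next
    case (mult p q)
    then obtain C D where C: "\<forall>N\<in>seminorms. N p \<le> C" "\<forall>N\<in>seminorms. N q \<le> D" by blast
    have "N (p * q) \<le> C * D" if N: "N \<in> seminorms" for N
    proof -
      interpret cstar_seminormed scalar poly_adj P N by (rule seminorms_cstar[OF N])
      have "N (p * q) \<le> N p * N q" by (intro N_mult mult)
      also have "\<dots> \<le> C * D"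
        using C N N_nonneg[OF mult(1)] N_nonneg[OF mult(2)] by (intro mult_mono) (auto intro: order_trans)
      finally show ?thesis .
    qed
    then show ?case by blast
  next
    case (gen g)
    then show ?case using gen_bounded[OF gen] by (simp add: seminorms_def) blast
  next
    case (adj p)
    then show ?case using cstar_seminormed.N_adj[OF seminorms_cstar adj(1)] by (metis (no_types))
  qed
  then show ?thesis by (auto intro: bdd_aboveI)
qed

lemma U_upper: "N \<in> seminorms \<Longrightarrow> p \<in> P \<Longrightarrow> N p \<le> U p"
  unfolding U_def by (rule cSUP_upper[OF _ seminorms_bdd])

lemma U_least: "(\<And>N. N \<in> seminorms \<Longrightarrow> N p \<le> C) \<Longrightarrow> U p \<le> C"
  unfolding U_def using zero_seminorm by (intro cSUP_least) auto

lemma U_cstar: "cstar_seminormed scalar poly_adj P U"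
proof (rule poly.cstar_seminormedI)
  fix p assume p: "p \<in> P"
  show "0 \<le> U p" using U_upper[OF zero_seminorm p] by simp
  show "U (scalar c * p) \<le> cmod c * U p" for c
  proof (rule U_least)
    fix N assume N: "N \<in> seminorms"
    show "N (scalar c * p) \<le> cmod c * U p"
      unfolding cstar_seminormed.N_scale[OF seminorms_cstar[OF N] p]
      by (intro mult_left_mono U_upper N p) simp
  qed
  show "(U p)\<^sup>2 \<le> U (poly_adj p * p)"
  proof -
    have pp: "poly_adj p * p \<in> P" using p by (simp add: star_polys_adj star_polys_mult)
    have nn: "0 \<le> U (poly_adj p * p)" using U_upper[OF zero_seminorm pp] by simp
    have "N p \<le> sqrt (U (poly_adj p * p))" if N: "N \<in> seminorms" for N
    proof (rule real_le_rsqrt)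
      show "(N p)\<^sup>2 \<le> U (poly_adj p * p)"
        using U_upper[OF N pp] cstar_seminormed.N_cstar[OF seminorms_cstar[OF N] p] by simp
    qed
    then have "U p \<le> sqrt (U (poly_adj p * p))" by (rule U_least)
    then have "(U p)\<^sup>2 \<le> (sqrt (U (poly_adj p * p)))\<^sup>2"
      using U_upper[OF zero_seminorm p] by (intro power_mono) auto
    then show ?thesis using nn by simp
  qed
next
  fix p q assume p: "p \<in> P" and q: "q \<in> P"
  show "U (p + q) \<le> U p + U q"
    using U_upper[OF _ p] U_upper[OF _ q] cstar_seminormed.N_triangle[OF seminorms_cstar p q]
    by (intro U_least) (meson add_mono order_trans)
  show "U (p * q) \<le> U p * U q"
  proof (rule U_least)
    fix N assume N: "N \<in> seminorms"
    interpret cstar_seminormed scalar poly_adj P N by (rule seminorms_cstar[OF N])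
    have "N (p * q) \<le> N p * N q" by (intro N_mult p q)
    also have "\<dots> \<le> U p * U q"
      using U_upper[OF N p] U_upper[OF N q] N_nonneg[OF p] N_nonneg[OF q]
      by (intro mult_mono) auto
    finally show "N (p * q) \<le> U p * U q" .
  qed
qed (auto simp: star_polys_zero star_polys_add star_polys_mult star_polys_scale star_polys_adj)

sublocale cstar_seminormed scalar poly_adj P U
  by (rule U_cstar)

lemma U_relation: "r \<in> R \<Longrightarrow> U r = 0"
  using R_sub N_nonneg[of r] by (intro antisym U_least) (auto simp: seminorms_def)

abbreviation CS where "CS \<equiv> cauchy_seqs G R"
abbreviation cl where "cl \<equiv> cauchy_class G R"
abbreviation alg where "alg \<equiv> universal_cstar G R"

text \<open>
  The seminorm of the completion, before passing to classes of Cauchy sequences.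
\<close>

definition L :: "(nat \<Rightarrow> 'g star_poly) \<Rightarrow> real" where "L X = lim (\<lambda>n. U (X n))"

lemma CS_P: "X \<in> CS \<Longrightarrow> X n \<in> P"
  by (auto simp: cauchy_seqs_def)

lemma CS_cauchy: "X \<in> CS \<Longrightarrow> 0 < e \<Longrightarrow> \<exists>M. \<forall>m\<ge>M. \<forall>n\<ge>M. U (X m - X n) < e"
  by (auto simp: cauchy_seqs_def)

lemma CS_I: "(\<And>n. X n \<in> P) \<Longrightarrow> (\<And>e. 0 < e \<Longrightarrow> \<exists>M. \<forall>m\<ge>M. \<forall>n\<ge>M. U (X m - X n) < e) \<Longrightarrow> X \<in> CS"
  by (auto simp: cauchy_seqs_def)

lemma CS_const: "p \<in> P \<Longrightarrow> (\<lambda>n. p) \<in> CS"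
  by (auto intro!: CS_I simp: N_zero)

lemma L_lim: assumes "X \<in> CS" shows "(\<lambda>n. U (X n)) \<longlonglongrightarrow> L X"
proof -
  have "Cauchy (\<lambda>n. U (X n))"
  proof (rule metric_CauchyI)
    fix e :: real assume "0 < e"
    then obtain M where M: "\<forall>m\<ge>M. \<forall>n\<ge>M. U (X m - X n) < e" using CS_cauchy assms by blast
    have "dist (U (X m)) (U (X n)) < e" if "m \<ge> M" "n \<ge> M" for m n
      unfolding dist_real_def
      by (rule le_less_trans[OF N_abs_diff[OF CS_P[OF assms] CS_P[OF assms]]]) (use M that in blast)
    then show "\<exists>M. \<forall>m\<ge>M. \<forall>n\<ge>M. dist (U (X m)) (U (X n)) < e" by blast
  qed
  then show ?thesis
    unfolding L_def by (simp add: Cauchy_convergent flip: convergent_LIMSEQ_iff)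
qed

lemma null_seq_CS:
  assumes Z: "\<And>n. Z n \<in> P" and lim: "(\<lambda>n. U (Z n)) \<longlonglongrightarrow> 0"
  shows "Z \<in> CS" "L Z = 0"
proof -
  show CS: "Z \<in> CS"
  proof (rule CS_I)
    fix e :: real assume e: "0 < e"
    then have "0 < e/2" by simp
    from order_tendstoD(2)[OF lim this] obtain M where M: "U (Z n) < e/2" if "n \<ge> M" for n
      by (auto simp: eventually_sequentially)
    have "U (Z m - Z n) < e" if "m \<ge> M" "n \<ge> M" for m n
      using N_diff[OF Z[of m] Z[of n]] M[OF that(1)] M[OF that(2)] by linarith
    then show "\<exists>M. \<forall>m\<ge>M. \<forall>n\<ge>M. U (Z m - Z n) < e" by blast
  qed (rule Z)
  show "L Z = 0" using LIMSEQ_unique[OF L_lim[OF CS] lim] .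
qed

lemma L_const: "p \<in> P \<Longrightarrow> L (\<lambda>n. p) = U p"
  using LIMSEQ_unique[OF L_lim[OF CS_const]] by blast

lemma CS_bounded: assumes "X \<in> CS" obtains B where "0 < B" "\<And>n. U (X n) \<le> B"
proof -
  have "Bseq (\<lambda>n. U (X n))" using L_lim[OF assms] convergent_def convergent_imp_Bseq by blast
  then obtain K where "0 < K" "\<And>n. norm (U (X n)) \<le> K" by (auto simp: Bseq_def)
  then have "U (X n) \<le> K" for n by (simp add: abs_le_iff)
  then show thesis using that \<open>0 < K\<close> by blast
qed

lemma CS_add: assumes X: "X \<in> CS" and Y: "Y \<in> CS" shows "X + Y \<in> CS"
proof (rule CS_I)
  fix e :: real assume "0 < e"
  then obtain M K where M: "\<forall>m\<ge>M. \<forall>n\<ge>M. U (X m - X n) < e/2" "\<forall>m\<ge>K. \<forall>n\<ge>K. U (Y m - Y n) < e/2"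
    using CS_cauchy[OF X, of "e/2"] CS_cauchy[OF Y, of "e/2"] by auto
  have "U ((X + Y) m - (X + Y) n) < e" if "m \<ge> max M K" "n \<ge> max M K" for m n
  proof -
    have "U ((X m - X n) + (Y m - Y n)) \<le> U (X m - X n) + U (Y m - Y n)"
      by (intro N_triangle A_diff CS_P X Y)
    also have "\<dots> < e/2 + e/2" using M that by (intro add_strict_mono) auto
    finally show ?thesis by (simp add: plus_fun_def algebra_simps)
  qed
  then show "\<exists>M. \<forall>m\<ge>M. \<forall>n\<ge>M. U ((X + Y) m - (X + Y) n) < e" by blast
qed (simp add: plus_fun_def A_add CS_P X Y)

lemma CS_mult: assumes X: "X \<in> CS" and Y: "Y \<in> CS" shows "X * Y \<in> CS"
proof (rule CS_I)
  obtain B C where B: "0 < B" "\<And>n. U (X n) \<le> B" and C: "0 < C" "\<And>n. U (Y n) \<le> C"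
    using CS_bounded[OF X] CS_bounded[OF Y] by metis
  fix e :: real assume "0 < e"
  then obtain M K where M: "\<forall>m\<ge>M. \<forall>n\<ge>M. U (X m - X n) < e/(2*C)" "\<forall>m\<ge>K. \<forall>n\<ge>K. U (Y m - Y n) < e/(2*B)"
    using CS_cauchy[OF X, of "e/(2*C)"] CS_cauchy[OF Y, of "e/(2*B)"] B C by auto
  have "U ((X * Y) m - (X * Y) n) < e" if "m \<ge> max M K" "n \<ge> max M K" for m n
  proof -
    have "U ((X m - X n) * Y m + X n * (Y m - Y n)) \<le> U ((X m - X n) * Y m) + U (X n * (Y m - Y n))"
      by (intro N_triangle A_mult A_diff CS_P X Y)
    also have "\<dots> \<le> U (X m - X n) * U (Y m) + U (X n) * U (Y m - Y n)"
      by (intro add_mono N_mult A_diff CS_P X Y)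
    also have "\<dots> \<le> U (X m - X n) * C + B * U (Y m - Y n)"
      by (intro add_mono mult_left_mono mult_right_mono B C N_nonneg A_diff CS_P X Y)
    also have "\<dots> < e/(2*C) * C + B * (e/(2*B))"
      using M that B C by (intro add_strict_mono mult_strict_left_mono mult_strict_right_mono) auto
    also have "\<dots> = e" using B C by simp
    finally show ?thesis by (simp add: times_fun_def algebra_simps)
  qed
  then show "\<exists>M. \<forall>m\<ge>M. \<forall>n\<ge>M. U ((X * Y) m - (X * Y) n) < e" by blast
qed (simp add: times_fun_def A_mult CS_P X Y)

lemma CS_adj: assumes X: "X \<in> CS" shows "(\<lambda>n. poly_adj (X n)) \<in> CS"
proof (rule CS_I)
  have "U (poly_adj (X m) - poly_adj (X n)) = U (X m - X n)" for m n
    using N_adj[of "X m - X n"] CS_P[OF X] by (simp add: A_diff poly.adj_diff)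
  then show "\<exists>M. \<forall>m\<ge>M. \<forall>n\<ge>M. U (poly_adj (X m) - poly_adj (X n)) < e" if "0 < e" for e
    using CS_cauchy[OF X that] by simp
qed (simp add: A_adj CS_P X)

lemma L_cstar: "cstar_seminormed (\<lambda>c n. scalar c) (\<lambda>X n. poly_adj (X n)) CS L"
proof (rule seq.cstar_seminormedI)
  show "0 \<in> CS" using CS_const[OF A_zero] by (simp add: zero_fun_def)
  fix X assume X: "X \<in> CS"
  show sc: "(\<lambda>n. scalar c) * X \<in> CS" for c
  proof (rule CS_I)
    fix e :: real assume "0 < e"
    then obtain M where M: "\<forall>m\<ge>M. \<forall>n\<ge>M. U (X m - X n) < e / (cmod c + 1)"
      using CS_cauchy[OF X, of "e / (cmod c + 1)"] by (auto simp: add_nonneg_pos)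
    have "U (scalar c * X m - scalar c * X n) < e" if "m \<ge> M" "n \<ge> M" for m n
    proof -
      have "U (scalar c * X m - scalar c * X n) = cmod c * U (X m - X n)"
        using N_scale[OF A_diff[OF CS_P[OF X] CS_P[OF X]]] by (simp add: right_diff_distrib)
      also have "\<dots> \<le> (cmod c + 1) * U (X m - X n)"
        by (intro mult_right_mono N_nonneg A_diff CS_P X) auto
      also have "\<dots> < (cmod c + 1) * (e / (cmod c + 1))"
        using M that by (intro mult_strict_left_mono) (auto simp: add_nonneg_pos)
      also have "\<dots> = e" by (simp add: add_nonneg_eq_0_iff)
      finally show ?thesis .
    qed
    then show "\<exists>M. \<forall>m\<ge>M. \<forall>n\<ge>M. U (((\<lambda>n. scalar c) * X) m - ((\<lambda>n. scalar c) * X) n) < e"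
      by (auto simp: times_fun_def)
  qed (simp add: times_fun_def A_scale CS_P X)
  show "(\<lambda>n. poly_adj (X n)) \<in> CS" by (rule CS_adj[OF X])
  show "0 \<le> L X" by (rule LIMSEQ_le_const[OF L_lim[OF X]]) (auto intro: N_nonneg CS_P X)
  have "(\<lambda>n. U (((\<lambda>n. scalar c) * X) n)) \<longlonglongrightarrow> cmod c * L X" for c
    using tendsto_mult_left[OF L_lim[OF X]] by (simp add: times_fun_def N_scale CS_P X)
  from LIMSEQ_unique[OF L_lim[OF sc] this]
  show "L ((\<lambda>n. scalar c) * X) \<le> cmod c * L X" for c by simp
  have "(\<lambda>n. U (((\<lambda>n. poly_adj (X n)) * X) n)) \<longlonglongrightarrow> (L X)\<^sup>2"
    using tendsto_power[OF L_lim[OF X], of 2] by (simp add: times_fun_def N_cstar CS_P X)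
  from LIMSEQ_unique[OF L_lim[OF CS_mult[OF CS_adj[OF X] X]] this]
  show "(L X)\<^sup>2 \<le> L ((\<lambda>n. poly_adj (X n)) * X)" by simp
next
  fix X Y assume X: "X \<in> CS" and Y: "Y \<in> CS"
  show "X + Y \<in> CS" "X * Y \<in> CS" by (intro CS_add CS_mult X Y)+
  show "L (X + Y) \<le> L X + L Y"
    by (rule LIMSEQ_le[OF L_lim[OF CS_add[OF X Y]] tendsto_add[OF L_lim[OF X] L_lim[OF Y]]])
      (auto simp: plus_fun_def intro!: exI[of _ 0] N_triangle CS_P X Y)
  show "L (X * Y) \<le> L X * L Y"
    by (rule LIMSEQ_le[OF L_lim[OF CS_mult[OF X Y]] tendsto_mult[OF L_lim[OF X] L_lim[OF Y]]])
      (auto simp: times_fun_def intro!: exI[of _ 0] N_mult CS_P X Y)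
qed

sublocale S: cstar_seminormed "\<lambda>c n. scalar c" "\<lambda>X n. poly_adj (X n)" CS L
  by (rule L_cstar)

lemma L_diff_const_tendsto:
  assumes X: "X \<in> CS" shows "(\<lambda>n. L (X - (\<lambda>k. X n))) \<longlonglongrightarrow> 0"
proof (rule LIMSEQ_I)
  fix e :: real assume e: "0 < e"
  then obtain M where M: "\<forall>m\<ge>M. \<forall>n\<ge>M. U (X m - X n) < e/2" using CS_cauchy[OF X, of "e/2"] by auto
  have "L (X - (\<lambda>k. X n)) \<le> e/2" if "n \<ge> M" for n
    by (rule LIMSEQ_le_const2[OF L_lim[OF S.A_diff[OF X CS_const[OF CS_P[OF X]]]]])
      (use M that in \<open>auto simp: fun_diff_def intro!: exI[of _ M] less_imp_le\<close>)
  moreover have "0 \<le> L (X - (\<lambda>k. X n))" for n by (intro S.N_nonneg S.A_diff X CS_const CS_P)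
  ultimately show "\<exists>M. \<forall>n\<ge>M. norm (L (X - (\<lambda>k. X n)) - 0) < e"
    using e by (intro exI[of _ M]) (fastforce intro: le_less_trans)
qed

text \<open>
  Approximate the \<open>k\<close>-th Cauchy sequence by one of its own entries, regarded as a constant sequence,
  within \<open>1/(k+1)\<close>; these entries form the limit.
\<close>

lemma CS_complete:
  assumes X: "\<And>k::nat. X k \<in> CS"
    and cauchy: "\<And>e. 0 < e \<Longrightarrow> \<exists>m. \<forall>k\<ge>m. \<forall>l\<ge>m. L (X k - X l) < e"
  shows "\<exists>Y\<in>CS. (\<lambda>k. L (X k - Y)) \<longlonglongrightarrow> 0"
proof -
  have "\<exists>p\<in>P. L (X k - (\<lambda>n. p)) < inverse (Suc k)" for k
  proof -
    \<comment> \<open>constant sequences of entries converge to the sequence\<close>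
    have "eventually (\<lambda>n. L (X k - (\<lambda>i. X k n)) < inverse (Suc k)) sequentially"
      by (rule order_tendstoD(2)[OF L_diff_const_tendsto[OF X]]) simp
    then show ?thesis using CS_P[OF X] by (auto simp: eventually_sequentially)
  qed
  then obtain Y where Y: "\<And>k. Y k \<in> P" "\<And>k. L (X k - (\<lambda>n. Y k)) < inverse (Suc k)" by metis
  have tri: "L (V - Z) \<le> L (V - W) + L (W - Z)" if "V \<in> CS" "W \<in> CS" "Z \<in> CS" for V W Z
    using S.N_diff_triangle that by blast
  have inv: "\<exists>m. \<forall>k\<ge>m. inverse (real (Suc k)) < e" if "0 < e" for e
    using order_tendstoD(2)[OF LIMSEQ_inverse_real_of_nat that] by (auto simp: eventually_sequentially)
  have YCS: "Y \<in> CS"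
  proof (rule CS_I)
    fix e :: real assume "0 < e"
    then have "0 < e/3" by simp
    obtain m1 m2 where m: "\<forall>k\<ge>m1. \<forall>l\<ge>m1. L (X k - X l) < e/3" "\<forall>k\<ge>m2. inverse (real (Suc k)) < e/3"
      using cauchy[OF \<open>0 < e/3\<close>] inv[OF \<open>0 < e/3\<close>] by blast
    have "U (Y k - Y l) < e" if "k \<ge> max m1 m2" "l \<ge> max m1 m2" for k l
    proof -
      have "U (Y k - Y l) = L ((\<lambda>n. Y k) - (\<lambda>n. Y l))"
        using L_const[OF A_diff[OF Y(1) Y(1)]] by (simp add: fun_diff_def)
      also have "\<dots> \<le> L ((\<lambda>n. Y k) - X k) + (L (X k - X l) + L (X l - (\<lambda>n. Y l)))"
        using tri[of "\<lambda>n. Y k" "X k" "\<lambda>n. Y l"] tri[of "X k" "X l" "\<lambda>n. Y l"] X CS_const[OF Y(1)]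
        by force
      also have "L ((\<lambda>n. Y k) - X k) = L (X k - (\<lambda>n. Y k))"
        by (intro S.N_minus_commute X CS_const Y)
      also have "\<dots> + (L (X k - X l) + L (X l - (\<lambda>n. Y l))) < e/3 + (e/3 + e/3)"
        by (intro add_strict_mono less_trans[OF Y(2)]) (use m that in auto)
      finally show ?thesis by simp
    qed
    then show "\<exists>M. \<forall>m\<ge>M. \<forall>n\<ge>M. U (Y m - Y n) < e" by blast
  qed (rule Y)
  have "(\<lambda>k. inverse (real (Suc k)) + L (Y - (\<lambda>n. Y k))) \<longlonglongrightarrow> 0 + 0"
    by (intro tendsto_add LIMSEQ_inverse_real_of_nat L_diff_const_tendsto YCS)
  then have lim: "(\<lambda>k. inverse (real (Suc k)) + L (Y - (\<lambda>n. Y k))) \<longlonglongrightarrow> 0" by simp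
  have "(\<lambda>k. L (X k - Y)) \<longlonglongrightarrow> 0"
  proof (rule tendsto_sandwich[OF _ _ tendsto_const lim])
    show "eventually (\<lambda>k. 0 \<le> L (X k - Y)) sequentially"
      by (intro always_eventually allI S.N_nonneg S.A_diff X YCS)
    have "L (X k - Y) \<le> inverse (real (Suc k)) + L (Y - (\<lambda>n. Y k))" for k
      using tri[OF X[of k] CS_const[OF Y(1)[of k]] YCS] Y(2)[of k]
        S.N_minus_commute[OF YCS CS_const[OF Y(1)[of k]]] by linarith
    then show "eventually (\<lambda>k. L (X k - Y) \<le> inverse (real (Suc k)) + L (Y - (\<lambda>n. Y k))) sequentially"
      by simp
  qed
  with YCS show ?thesis by blast
qed

lemma cauchy_rel_iff: "(X, Y) \<in> cauchy_rel G R \<longleftrightarrow> X \<in> CS \<and> Y \<in> CS \<and> L (X - Y) = 0"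
proof -
  have "((\<lambda>n. U (X n - Y n)) \<longlonglongrightarrow> 0) \<longleftrightarrow> L (X - Y) = 0" if "X \<in> CS" "Y \<in> CS"
    using L_lim[OF S.A_diff[OF that]] LIMSEQ_unique by (auto simp: fun_diff_def)
  then show ?thesis by (auto simp: cauchy_rel_def)
qed

lemma cauchy_rel_equiv: "equiv CS (cauchy_rel G R)"
proof (rule equivI)
  show "cauchy_rel G R \<subseteq> CS \<times> CS" by (auto simp: cauchy_rel_iff)
  show "refl_on CS (cauchy_rel G R)"
    by (auto simp: refl_on_def cauchy_rel_iff S.N_zero)
  show "sym (cauchy_rel G R)"
    by (auto simp: sym_def cauchy_rel_iff S.N_minus_commute)
  show "trans (cauchy_rel G R)"
  proof (rule transI)
    fix X Y Z assume "(X, Y) \<in> cauchy_rel G R" "(Y, Z) \<in> cauchy_rel G R"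
    then show "(X, Z) \<in> cauchy_rel G R"
      using S.N_diff_triangle[of X Y Z] S.N_nonneg[of "X - Z"] S.A_diff[of X Z] by (auto simp: cauchy_rel_iff)
  qed
qed

lemma cl_eq_iff: "X \<in> CS \<Longrightarrow> Y \<in> CS \<Longrightarrow> cl X = cl Y \<longleftrightarrow> L (X - Y) = 0"
  unfolding cauchy_class_def using eq_equiv_class_iff[OF cauchy_rel_equiv]
  by (simp add: cauchy_rel_iff)

lemma cl_eqI: "X \<in> CS \<Longrightarrow> Y \<in> CS \<Longrightarrow> L (X - Y) = 0 \<Longrightarrow> cl X = cl Y"
  by (simp add: cl_eq_iff)

lemma celems_eq: "celems alg = cl ` CS"
  by (auto simp: universal_cstar_def quotient_def cauchy_class_def)

lemma cl_closed: "X \<in> CS \<Longrightarrow> cl X \<in> celems alg"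
  by (simp add: celems_eq)

lemma celems_E: assumes "x \<in> celems alg" obtains X where "X \<in> CS" "x = cl X"
  using assms by (auto simp: celems_eq)

lemma rep_cl: assumes "X \<in> CS" shows "cauchy_rep (cl X) \<in> CS" "L (cauchy_rep (cl X) - X) = 0"
proof -
  have "X \<in> cl X" using assms by (simp add: cauchy_class_def cauchy_rel_iff S.N_zero)
  then have "cauchy_rep (cl X) \<in> cl X" unfolding cauchy_rep_def by (rule someI[of "\<lambda>Z. Z \<in> cl X"])
  then show "cauchy_rep (cl X) \<in> CS" "L (cauchy_rep (cl X) - X) = 0"
    using assms S.N_minus_commute by (auto simp: cauchy_class_def cauchy_rel_iff)
qed

lemma L_null_add: "X \<in> CS \<Longrightarrow> Y \<in> CS \<Longrightarrow> L X = 0 \<Longrightarrow> L Y = 0 \<Longrightarrow> L (X + Y) = 0"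
  using S.N_triangle[of X Y] S.N_nonneg[of "X + Y"] CS_add by fastforce

lemma L_null_mult: "X \<in> CS \<Longrightarrow> Y \<in> CS \<Longrightarrow> L X = 0 \<or> L Y = 0 \<Longrightarrow> L (X * Y) = 0"
  using S.N_mult[of X Y] S.N_nonneg[of "X * Y"] CS_mult by fastforce

lemma cl_zero: "czero alg = cl 0"
  by (simp add: universal_cstar_def zero_fun_def)

lemma cl_add: assumes "X \<in> CS" "Y \<in> CS" shows "cadd alg (cl X) (cl Y) = cl (X + Y)"
proof -
  let ?X = "cauchy_rep (cl X)" and ?Y = "cauchy_rep (cl Y)"
  have "L ((?X - X) + (?Y - Y)) = 0"
    using rep_cl[OF assms(1)] rep_cl[OF assms(2)] assms by (intro L_null_add S.A_diff)
  then have "cl (?X + ?Y) = cl (X + Y)"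
    using rep_cl[OF assms(1)] rep_cl[OF assms(2)] assms by (intro cl_eqI CS_add) (auto simp: algebra_simps)
  then show ?thesis by (simp add: universal_cstar_def plus_fun_def)
qed

lemma cl_mult: assumes "X \<in> CS" "Y \<in> CS" shows "cmult alg (cl X) (cl Y) = cl (X * Y)"
proof -
  let ?X = "cauchy_rep (cl X)" and ?Y = "cauchy_rep (cl Y)"
  have "L ((?X - X) * ?Y + X * (?Y - Y)) = 0"
    using rep_cl[OF assms(1)] rep_cl[OF assms(2)] assms
    by (intro L_null_add L_null_mult S.A_diff CS_mult) auto
  then have "cl (?X * ?Y) = cl (X * Y)"
    using rep_cl[OF assms(1)] rep_cl[OF assms(2)] assms by (intro cl_eqI CS_mult) (auto simp: algebra_simps)
  then show ?thesis by (simp add: universal_cstar_def times_fun_def)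
qed

lemma cl_scale: assumes "X \<in> CS" shows "cscale alg c (cl X) = cl ((\<lambda>n. scalar c) * X)"
proof -
  let ?X = "cauchy_rep (cl X)"
  have "L ((\<lambda>n. scalar c) * (?X - X)) = 0"
    using rep_cl[OF assms] S.N_scale[of "?X - X" c] assms by (simp add: S.A_diff)
  then have "cl ((\<lambda>n. scalar c) * ?X) = cl ((\<lambda>n. scalar c) * X)"
    using rep_cl[OF assms] assms by (intro cl_eqI S.A_scale) (auto simp: right_diff_distrib)
  then show ?thesis by (simp add: universal_cstar_def times_fun_def poly_scale_def)
qed

lemma cl_adj: assumes "X \<in> CS" shows "cadj alg (cl X) = cl (\<lambda>n. poly_adj (X n))"
proof -
  let ?X = "cauchy_rep (cl X)"
  have "L (\<lambda>n. poly_adj ((?X - X) n)) = 0"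
    using rep_cl[OF assms] S.N_adj[of "?X - X"] assms by (simp add: S.A_diff)
  then have "cl (\<lambda>n. poly_adj (?X n)) = cl (\<lambda>n. poly_adj (X n))"
    using rep_cl[OF assms] assms by (intro cl_eqI CS_adj) (auto simp: fun_diff_def poly.adj_diff)
  then show ?thesis by (simp add: universal_cstar_def)
qed

lemma cl_norm: assumes "X \<in> CS" shows "cnrm alg (cl X) = L X"
  using S.N_abs_diff[OF rep_cl(1)[OF assms] assms] rep_cl(2)[OF assms]
  by (simp add: universal_cstar_def flip: L_def)

lemma cl_dist: assumes X: "X \<in> CS" and Y: "Y \<in> CS" shows "cdist alg (cl X) (cl Y) = L (X - Y)"
proof -
  have "(\<lambda>n. scalar (-1)) * Y = - Y"
    by (simp add: fun_eq_iff times_fun_def poly.k_uminus poly.k_one)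
  then show ?thesis using X Y by (simp add: cdist_def cl_scale cl_add cl_norm S.A_diff S.A_uminus)
qed

lemmas cl_ops = cl_zero cl_add cl_mult cl_scale cl_adj cl_norm
lemmas CS_closed = S.A_zero CS_add CS_mult S.A_scale CS_adj

lemma cl_add_cong: "\<lbrakk>X \<in> CS; Y \<in> CS; X' \<in> CS; Y' \<in> CS; cl X = cl X'; cl Y = cl Y'\<rbrakk> \<Longrightarrow> cl (X + Y) = cl (X' + Y')"
  using cl_add[of X Y] cl_add[of X' Y'] by simp

lemma L_eq_0: "X \<in> CS \<Longrightarrow> L X = 0 \<longleftrightarrow> cl X = cl 0"
  by (simp add: cl_eq_iff S.A_zero)

theorem cstar_algebra_universal: "cstar_algebra alg"
proof
  show "czero alg \<in> celems alg" by (simp add: cl_ops CS_closed cl_closed)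
next
  fix x y assume "x \<in> celems alg" "y \<in> celems alg"
  then obtain X Y where [simp]: "X \<in> CS" "Y \<in> CS" and xy: "x = cl X" "y = cl Y" by (auto simp: celems_eq)
  show "cadd alg x y \<in> celems alg" "cmult alg x y \<in> celems alg" "cadd alg x y = cadd alg y x"
    "cnrm alg (cadd alg x y) \<le> cnrm alg x + cnrm alg y" "cnrm alg (cmult alg x y) \<le> cnrm alg x * cnrm alg y"
    by (auto simp: xy cl_ops cl_closed CS_closed S.N_triangle S.N_mult add.commute)
  show "cscale alg c (cadd alg x y) = cadd alg (cscale alg c x) (cscale alg c y)"
    "cmult alg (cscale alg c x) y = cscale alg c (cmult alg x y)"
    "cmult alg x (cscale alg c y) = cscale alg c (cmult alg x y)" for c
    by (simp_all add: xy cl_ops CS_closed distrib_left mult.assoc seq.k_left_comm[of X])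
  show "cadj alg (cadd alg x y) = cadd alg (cadj alg x) (cadj alg y)"
    "cadj alg (cmult alg x y) = cmult alg (cadj alg y) (cadj alg x)"
    by (simp_all add: xy cl_ops CS_closed) (simp_all add: plus_fun_def times_fun_def poly.adj_simps)
next
  fix x y z assume "x \<in> celems alg" "y \<in> celems alg" "z \<in> celems alg"
  then obtain X Y Z where [simp]: "X \<in> CS" "Y \<in> CS" "Z \<in> CS" and xyz: "x = cl X" "y = cl Y" "z = cl Z"
    by (auto simp: celems_eq)
  show "cadd alg (cadd alg x y) z = cadd alg x (cadd alg y z)"
    "cmult alg (cmult alg x y) z = cmult alg x (cmult alg y z)"
    "cmult alg (cadd alg x y) z = cadd alg (cmult alg x z) (cmult alg y z)"
    "cmult alg x (cadd alg y z) = cadd alg (cmult alg x y) (cmult alg x z)"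
    by (auto simp: xyz cl_ops CS_closed algebra_simps)
next
  fix x assume "x \<in> celems alg"
  then obtain X where [simp]: "X \<in> CS" and x: "x = cl X" by (auto simp: celems_eq)
  show "cscale alg c x \<in> celems alg" "cadj alg x \<in> celems alg" "cadd alg x (czero alg) = x" "0 \<le> cnrm alg x" for c
    by (auto simp: x cl_ops cl_closed CS_closed S.N_nonneg)
  show "cadd alg x (cscale alg (- 1) x) = czero alg"
    by (simp add: x cl_ops CS_closed S.A_uminus seq.k_uminus flip: one_fun_def)
  show "cscale alg (c + d) x = cadd alg (cscale alg c x) (cscale alg d x)"
    "cscale alg c (cscale alg d x) = cscale alg (c * d) x" "cscale alg 1 x = x" for c d
    by (simp_all add: x cl_ops CS_closed seq.k_add seq.k_assoc flip: distrib_right one_fun_def)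
  show "cadj alg (cscale alg c x) = cscale alg (cnj c) (cadj alg x)" for c
    by (simp add: x cl_ops CS_closed) (simp add: times_fun_def poly.adj_mult poly.adj_k flip: poly.k_comm)
  show "cadj alg (cadj alg x) = x" by (auto simp: x cl_ops CS_closed poly.adj_simps)
  show "cnrm alg x = 0 \<longleftrightarrow> x = czero alg"
    by (auto simp: x cl_ops CS_closed L_eq_0)
  show "cnrm alg (cscale alg c x) = cmod c * cnrm alg x" for c
    using S.N_scale[of X c] by (simp add: x cl_ops CS_closed)
  show "cnrm alg (cmult alg (cadj alg x) x) = (cnrm alg x)\<^sup>2"
    using S.N_cstar[of X] by (auto simp: x cl_ops CS_closed)
next
  fix x :: "nat \<Rightarrow> (nat \<Rightarrow> 'g star_poly) set"
  assume x: "\<And>n. x n \<in> celems alg"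
    and cauchy: "\<And>e. 0 < e \<Longrightarrow> \<exists>M. \<forall>m\<ge>M. \<forall>n\<ge>M. cdist alg (x m) (x n) < e"
  have "\<forall>n. \<exists>X\<in>CS. x n = cl X" using x by (simp add: celems_eq image_iff)
  then obtain X where X: "\<And>n. X n \<in> CS" "\<And>n. x n = cl (X n)" by metis
  have "\<exists>Y\<in>CS. (\<lambda>k. L (X k - Y)) \<longlonglongrightarrow> 0"
    by (rule CS_complete[OF X(1)]) (use cauchy X in \<open>simp add: cl_dist\<close>)
  then obtain Y where "Y \<in> CS" "(\<lambda>k. L (X k - Y)) \<longlonglongrightarrow> 0" by blast
  then show "\<exists>y\<in>celems alg. (\<lambda>n. cdist alg (x n) y) \<longlonglongrightarrow> 0"
    using X by (intro bexI[of _ "cl Y"]) (simp_all add: cl_dist cl_closed)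
qed

end

section \<open>Homomorphisms between universal C*-algebras\<close>

context cstar_algebra begin

lemma zero_add: "x \<in> celems A \<Longrightarrow> cadd A (czero A) x = x"
  using add_commute[OF zero_closed] add_zero by simp

lemma diff_add_cancel:
  assumes "x \<in> celems A" "y \<in> celems A"
  shows "cadd A (cadd A x (cscale A (- 1) y)) y = x"
proof -
  have "cadd A (cscale A (- 1) y) y = czero A"
    using add_neg[OF assms(2)] add_commute scale_closed assms by metis
  then show ?thesis using assms add_assoc scale_closed add_zero by simp
qed

lemma dist_zero_imp_eq:
  assumes "x \<in> celems A" "y \<in> celems A" "cdist A x y = 0" shows "x = y"
proof -
  have "cadd A x (cscale A (- 1) y) = czero A"
    using assms norm_eq_zero[of "cadd A x (cscale A (- 1) y)"] add_closed scale_closed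
    by (simp add: cdist_def)
  then show ?thesis using diff_add_cancel[OF assms(1,2)] zero_add[OF assms(2)] by simp
qed

lemma dist_nonneg: "x \<in> celems A \<Longrightarrow> y \<in> celems A \<Longrightarrow> 0 \<le> cdist A x y"
  unfolding cdist_def by (intro norm_nonneg add_closed scale_closed)

lemma dist_triangle:
  assumes "x \<in> celems A" "y \<in> celems A" "z \<in> celems A"
  shows "cdist A x z \<le> cdist A x y + cdist A y z"
proof -
  let ?m = "\<lambda>u v. cadd A u (cscale A (- 1) v)"
  have "cadd A (?m x y) (?m y z) = cadd A (cadd A (?m x y) y) (cscale A (- 1) z)"
    by (rule add_assoc[symmetric]) (intro add_closed scale_closed assms)+
  also have "\<dots> = ?m x z" using diff_add_cancel assms by simp
  finally have "?m x z = cadd A (?m x y) (?m y z)" ..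
  then show ?thesis unfolding cdist_def using norm_triangle[of "?m x y" "?m y z"] assms
    by (simp add: add_closed scale_closed)
qed

lemma scale_zero_eq: "x \<in> celems A \<Longrightarrow> cscale A 0 x = czero A"
  using norm_scale[of x 0] norm_eq_zero[of "cscale A 0 x"] scale_closed by simp

lemma cunit_unique: "is_cunit A u \<Longrightarrow> is_cunit A v \<Longrightarrow> u = v"
  unfolding is_cunit_def by metis

end

lemma star_hom_closed: "star_hom A B \<phi> \<Longrightarrow> x \<in> celems A \<Longrightarrow> \<phi> x \<in> celems B"
  by (auto simp: star_hom_def)

lemma star_hom_zero:
  assumes "cstar_algebra A" "cstar_algebra B" "star_hom A B \<phi>" shows "\<phi> (czero A) = czero B"
proof -
  interpret A: cstar_algebra A by fact
  interpret B: cstar_algebra B by fact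
  have "\<phi> (cscale A 0 (czero A)) = cscale B 0 (\<phi> (czero A))"
    using assms(3) A.zero_closed by (simp add: star_hom_def)
  then show ?thesis
    using A.scale_zero_eq[OF A.zero_closed] B.scale_zero_eq star_hom_closed[OF assms(3) A.zero_closed] by simp
qed

context universal begin

lemma gen_closed: "g \<in> G \<Longrightarrow> poly_gen g \<in> P"
  by (simp add: star_polys_gen)

lemma universal_gen_eq: "universal_gen G R g = cl (\<lambda>n. poly_gen g)"
  by (simp add: universal_gen_def)

lemma cl_uminus: "Y \<in> CS \<Longrightarrow> cscale alg (- 1) (cl Y) = cl (- Y)"
  by (simp add: cl_scale seq.k_uminus flip: one_fun_def)

text \<open>
  Pulling back the norm of \<open>B\<close> gives a C*-seminorm on Cauchy sequences, which form a complete algebra;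
  so \<open>M_le_N\<close> applies.
\<close>

lemma star_hom_norm_le:
  assumes B: "cstar_algebra B" and hom: "star_hom alg B \<psi>" and X: "X \<in> CS"
  shows "cnrm B (\<psi> (cl X)) \<le> L X"
proof -
  interpret B: cstar_algebra B by fact
  have psi: "\<psi> (cl X) \<in> celems B" if "X \<in> CS" for X
    using hom that by (intro star_hom_closed[OF hom] cl_closed)
  let ?M = "\<lambda>X. cnrm B (\<psi> (cl X))"
  have ops: "\<psi> (cl (X + Y)) = cadd B (\<psi> (cl X)) (\<psi> (cl Y))"
    "\<psi> (cl (X * Y)) = cmult B (\<psi> (cl X)) (\<psi> (cl Y))"
    "\<psi> (cl ((\<lambda>n. scalar c) * X)) = cscale B c (\<psi> (cl X))"
    "\<psi> (cl (\<lambda>n. poly_adj (X n))) = cadj B (\<psi> (cl X))"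
    if "X \<in> CS" "Y \<in> CS" for X Y c
    using hom that by (simp_all add: star_hom_def cl_closed flip: cl_add cl_mult cl_scale cl_adj)
  have "cstar_seminormed (\<lambda>c n. scalar c) (\<lambda>X n. poly_adj (X n)) CS ?M"
    by (rule seq.cstar_seminormedI)
      (simp_all add: CS_closed ops psi B.norm_nonneg B.norm_scale B.norm_triangle B.norm_mult B.cstar_identity)
  then interpret M: cstar_seminormed "\<lambda>c n. scalar c" "\<lambda>X n. poly_adj (X n)" CS ?M .
  have null: "?M X = 0" if "X \<in> CS" "L X = 0" for X
    using that star_hom_zero[OF cstar_algebra_universal B hom] B.norm_eq_zero[OF B.zero_closed]
    by (simp add: L_eq_0 cl_zero)
  interpret two_cstar_seminorms "\<lambda>c n. scalar c" "\<lambda>X n. poly_adj (X n)" CS L ?M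
    by unfold_locales (use null CS_complete in auto)
  show ?thesis by (rule M_le_N[OF X])
qed

text \<open>
  The homomorphisms agree on constant sequences, and a Cauchy sequence is the limit of the constant
  sequences formed from its entries.
\<close>

theorem star_hom_unique:
  assumes B: "cstar_algebra B" and hom: "star_hom alg B \<psi>" "star_hom alg B \<psi>'"
    and gen: "\<And>g. g \<in> G \<Longrightarrow> \<psi> (universal_gen G R g) = \<psi>' (universal_gen G R g)"
  shows "\<psi> = \<psi>'"
proof -
  interpret B: cstar_algebra B by fact
  have poly: "\<psi> (cl (\<lambda>n. p)) = \<psi>' (cl (\<lambda>n. p))" if "p \<in> P" for p
    using that
  proof (induction p rule: star_polys_induct)
    case zero
    have "cl (\<lambda>n. 0) = czero alg" by (simp add: cl_zero zero_fun_def)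
    then show ?case
      using star_hom_zero[OF cstar_algebra_universal B hom(1)] star_hom_zero[OF cstar_algebra_universal B hom(2)]
      by simp
  next
    case (add p q)
    have "cl (\<lambda>n. p + q) = cadd alg (cl (\<lambda>n. p)) (cl (\<lambda>n. q))"
      using add by (simp add: cl_add CS_const plus_fun_def)
    then show ?case using hom add by (simp add: star_hom_def cl_closed CS_const)
  next
    case (scale c p)
    have "cl (\<lambda>n. scalar c * p) = cscale alg c (cl (\<lambda>n. p))"
      using scale by (simp add: cl_scale CS_const times_fun_def)
    then show ?case using hom scale by (simp add: star_hom_def cl_closed CS_const)
  next
    case (mult p q)
    have "cl (\<lambda>n. p * q) = cmult alg (cl (\<lambda>n. p)) (cl (\<lambda>n. q))"
      using mult by (simp add: cl_mult CS_const times_fun_def)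
    then show ?case using hom mult by (simp add: star_hom_def cl_closed CS_const)
  next
    case (gen g)
    then show ?case using assms(4)[of g] by (simp add: universal_gen_eq)
  next
    case (adj p)
    have "cl (\<lambda>n. poly_adj p) = cadj alg (cl (\<lambda>n. p))"
      using adj by (simp add: cl_adj CS_const)
    then show ?case using hom adj by (simp add: star_hom_def cl_closed CS_const)
  qed
  have dist: "cdist B (\<phi> (cl X)) (\<phi> (cl Y)) \<le> L (X - Y)"
    if "star_hom alg B \<phi>" "X \<in> CS" "Y \<in> CS" for \<phi> X Y
  proof -
    have "cdist B (\<phi> (cl X)) (\<phi> (cl Y)) = cnrm B (\<phi> (cadd alg (cl X) (cscale alg (- 1) (cl Y))))"
      using that cstar_algebra.scale_closed[OF cstar_algebra_universal]
      by (simp add: cdist_def star_hom_def cl_closed)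
    also have "cadd alg (cl X) (cscale alg (- 1) (cl Y)) = cl (X - Y)"
      using that by (simp add: cl_uminus cl_add S.A_uminus)
    finally show ?thesis using star_hom_norm_le[OF B that(1)] S.A_diff that by simp
  qed
  have in_B: "\<psi> (cl Z) \<in> celems B" "\<psi>' (cl Z) \<in> celems B" if "Z \<in> CS" for Z
    using star_hom_closed[OF hom(1) cl_closed[OF that]] star_hom_closed[OF hom(2) cl_closed[OF that]] by auto
  have "\<psi> (cl X) = \<psi>' (cl X)" if X: "X \<in> CS" for X
  proof (rule B.dist_zero_imp_eq)
    have b: "cdist B (\<psi> (cl X)) (\<psi>' (cl X)) \<le> 2 * L (X - (\<lambda>k. X n))" for n
    proof -
      let ?Y = "\<lambda>k. X n"
      have Y: "?Y \<in> CS" "X n \<in> P" by (simp_all add: CS_const CS_P X)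
      have "cdist B (\<psi> (cl X)) (\<psi>' (cl X)) \<le> cdist B (\<psi> (cl X)) (\<psi> (cl ?Y)) + cdist B (\<psi> (cl ?Y)) (\<psi>' (cl X))"
        by (rule B.dist_triangle[OF in_B(1)[OF X] in_B(1)[OF Y(1)] in_B(2)[OF X]])
      also have "cdist B (\<psi> (cl ?Y)) (\<psi>' (cl X)) = cdist B (\<psi>' (cl ?Y)) (\<psi>' (cl X))"
        using poly[OF Y(2)] by simp
      also have "cdist B (\<psi> (cl X)) (\<psi> (cl ?Y)) + \<dots> \<le> L (X - ?Y) + L (?Y - X)"
        by (intro add_mono dist hom X Y)
      also have "\<dots> = 2 * L (X - ?Y)" using S.N_minus_commute[OF X Y(1)] by simp
      finally show ?thesis .
    qed
    have "(\<lambda>n. 2 * L (X - (\<lambda>k. X n))) \<longlonglongrightarrow> 2 * 0"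
      by (intro tendsto_mult_left L_diff_const_tendsto X)
    then have "cdist B (\<psi> (cl X)) (\<psi>' (cl X)) \<le> 2 * 0"
      by (rule tendsto_lowerbound) (use b in auto)
    then show "cdist B (\<psi> (cl X)) (\<psi>' (cl X)) = 0"
      using B.dist_nonneg[OF star_hom_closed[OF hom(1)] star_hom_closed[OF hom(2)], of "cl X" "cl X"] X
      by (simp add: cl_closed)
  qed (intro in_B X)+
  then have "\<psi> x = \<psi>' x" if "x \<in> celems alg" for x
    using that by (auto simp: celems_eq)
  moreover have "\<psi> \<in> celems alg \<rightarrow>\<^sub>E celems B" "\<psi>' \<in> celems alg \<rightarrow>\<^sub>E celems B"
    using hom by (simp_all add: star_hom_def)
  ultimately show ?thesis by (intro PiE_ext)
qed

end

text \<open>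
  The universal property: an assignment to the generators that respects the relations pulls the
  universal seminorm of the target back to one of the seminorms that define the one of the source.
\<close>

locale universal_hom = A: universal G R + B: universal H S
  for G :: "'g set" and R and H :: "'h set" and S +
  fixes \<sigma> :: "'g \<Rightarrow> 'h star_poly"
  assumes gen_image: "g \<in> G \<Longrightarrow> \<sigma> g \<in> star_polys H"
    and relation_image: "r \<in> R \<Longrightarrow> universal_seminorm H S (subst \<sigma> r) = 0"
begin

lemma subst_P: "p \<in> A.P \<Longrightarrow> subst \<sigma> p \<in> B.P"
  by (rule subst_closed) (use gen_image in auto)

lemma U_subst_le: "p \<in> A.P \<Longrightarrow> B.U (subst \<sigma> p) \<le> A.U p"
proof (rule A.U_upper[where N="\<lambda>p. B.U (subst \<sigma> p)"])
  have "cstar_seminormed scalar poly_adj A.P (\<lambda>p. B.U (subst \<sigma> p))"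
    by (rule poly.cstar_seminormedI)
      (simp_all add: A.A_closed subst_simps subst_P B.N_nonneg B.N_scale B.N_triangle B.N_mult B.N_cstar)
  then show "(\<lambda>p. B.U (subst \<sigma> p)) \<in> A.seminorms"
    by (simp add: A.seminorms_def cstar_seminorm_iff relation_image)
qed

lemma CS_subst: assumes X: "X \<in> A.CS" shows "(\<lambda>n. subst \<sigma> (X n)) \<in> B.CS"
proof (rule B.CS_I)
  fix e :: real assume "0 < e"
  then obtain M where M: "\<forall>m\<ge>M. \<forall>n\<ge>M. A.U (X m - X n) < e" using A.CS_cauchy[OF X] by blast
  have "B.U (subst \<sigma> (X m) - subst \<sigma> (X n)) \<le> A.U (X m - X n)" for m n
    using U_subst_le[OF A.A_diff[OF A.CS_P[OF X] A.CS_P[OF X]]] by (simp add: subst_diff)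
  then show "\<exists>M. \<forall>m\<ge>M. \<forall>n\<ge>M. B.U (subst \<sigma> (X m) - subst \<sigma> (X n)) < e"
    using M by (meson le_less_trans)
qed (simp add: subst_P A.CS_P X)

lemma L_subst_le: assumes X: "X \<in> A.CS" shows "B.L (\<lambda>n. subst \<sigma> (X n)) \<le> A.L X"
  by (rule LIMSEQ_le[OF B.L_lim[OF CS_subst[OF X]] A.L_lim[OF X]])
    (auto intro: U_subst_le A.CS_P X)

definition hom :: "(nat \<Rightarrow> 'g star_poly) set \<Rightarrow> (nat \<Rightarrow> 'h star_poly) set" where
  "hom = (\<lambda>x\<in>celems A.alg. B.cl (\<lambda>n. subst \<sigma> (cauchy_rep x n)))"

lemma hom_cl: assumes X: "X \<in> A.CS" shows "hom (A.cl X) = B.cl (\<lambda>n. subst \<sigma> (X n))"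
proof -
  let ?X = "cauchy_rep (A.cl X)"
  have rep: "?X \<in> A.CS" "A.L (?X - X) = 0" using A.rep_cl[OF X] by auto
  have "B.L (\<lambda>n. subst \<sigma> ((?X - X) n)) \<le> 0"
    using L_subst_le[OF A.S.A_diff[OF rep(1) X]] rep(2) by simp
  then have "B.L (\<lambda>n. subst \<sigma> ((?X - X) n)) = 0"
    using B.S.N_nonneg[OF CS_subst[OF A.S.A_diff[OF rep(1) X]]] by linarith
  then have "B.cl (\<lambda>n. subst \<sigma> (?X n)) = B.cl (\<lambda>n. subst \<sigma> (X n))"
    by (intro B.cl_eqI CS_subst rep X) (simp add: subst_diff fun_diff_def)
  then show ?thesis using A.cl_closed[OF X] by (simp add: hom_def)
qed

lemma star_hom_hom: "star_hom A.alg B.alg hom"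
  unfolding star_hom_def
proof (intro conjI ballI allI)
  show "hom \<in> celems A.alg \<rightarrow>\<^sub>E celems B.alg"
  proof (rule PiE_I)
    fix x assume "x \<in> celems A.alg"
    then show "hom x \<in> celems B.alg"
      by (elim A.celems_E) (simp add: hom_cl B.cl_closed CS_subst)
  qed (simp add: hom_def)
  fix x assume "x \<in> celems A.alg"
  then obtain X where X: "X \<in> A.CS" "x = A.cl X" by (rule A.celems_E)
  show "hom (cscale A.alg c x) = cscale B.alg c (hom x)" for c
    using X by (simp add: A.cl_scale B.cl_scale hom_cl A.S.A_scale CS_subst)
      (simp add: times_fun_def subst_simps)
  show "hom (cadj A.alg x) = cadj B.alg (hom x)"
    using X by (simp add: A.cl_adj B.cl_adj hom_cl A.CS_adj CS_subst subst_adj)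
  fix y assume "y \<in> celems A.alg"
  then obtain Y where Y: "Y \<in> A.CS" "y = A.cl Y" by (rule A.celems_E)
  show "hom (cadd A.alg x y) = cadd B.alg (hom x) (hom y)"
    using X Y by (simp add: A.cl_add B.cl_add hom_cl A.CS_add CS_subst)
      (simp add: plus_fun_def subst_simps)
  show "hom (cmult A.alg x y) = cmult B.alg (hom x) (hom y)"
    using X Y by (simp add: A.cl_mult B.cl_mult hom_cl A.CS_mult CS_subst)
      (simp add: times_fun_def subst_simps)
qed

end

section \<open>Paths in graph C*-algebras\<close>

text \<open>
  This bounds the vertex generators, and the edge generators through \<open>\<parallel>S\<parallel>\<^sup>2 = \<parallel>S\<^sup>* S\<parallel>\<close>.
\<close>

lemma (in cstar_seminormed) projection_norm_le_1:
  assumes p: "p \<in> A" and idem: "N (p * p - p) = 0" and sa: "N (adj p - p) = 0"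
  shows "N p \<le> 1"
proof -
  have "adj p * p - p = (adj p - p) * p + (p * p - p)" by (simp add: algebra_simps)
  then have "N (adj p * p - p) \<le> N ((adj p - p) * p) + N (p * p - p)"
    by (simp only:) (intro N_triangle A_closed p)
  also have "\<dots> \<le> N (adj p - p) * N p + N (p * p - p)"
    by (intro add_right_mono N_mult A_closed p)
  finally have "\<bar>N (adj p * p) - N p\<bar> \<le> 0"
    using N_abs_diff[of "adj p * p" p] idem sa p by (simp add: A_closed)
  then have "N p * N p = N p" using N_cstar[OF p] by (simp add: power2_eq_square)
  then show ?thesis by auto
qed

lemma graph_relations_cases [consumes 1, case_names idem sa orth pisom GA1 GA1' GA2 GA3]:
  fixes E :: "('v, 'e) pre_digraph"
  assumes "r \<in> graph_relations E"
  obtains v where "v \<in> verts E" "r = vertex_var v * vertex_var v - vertex_var v"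
  | v where "v \<in> verts E" "r = poly_adj (vertex_var v) - vertex_var v"
  | v w where "v \<in> verts E" "w \<in> verts E" "v \<noteq> w" "r = vertex_var v * vertex_var w"
  | e where "e \<in> arcs E" "r = edge_var e * poly_adj (edge_var e) * edge_var e - edge_var e"
  | e where "e \<in> arcs E" "r = poly_adj (edge_var e) * edge_var e - vertex_var (head E e)"
  | e f where "e \<in> arcs E" "f \<in> arcs E" "e \<noteq> f" "r = poly_adj (edge_var e) * edge_var f"
  | v where "regular_vertex E v"
      "r = (\<Sum>e\<in>out_arcs E v. edge_var e * poly_adj (edge_var e)) - vertex_var v"
  | e where "e \<in> arcs E" "r = vertex_var (tail E e) * (edge_var e * poly_adj (edge_var e))
        - edge_var e * poly_adj (edge_var e)"
  using assms unfolding graph_relations_def by (elim UnE CollectE exE conjE) (rule that; assumption)+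

lemma graph_relationsI:
  fixes E :: "('v, 'e) pre_digraph"
  shows "v \<in> verts E \<Longrightarrow> vertex_var v * vertex_var v - vertex_var v \<in> graph_relations E"
    and "v \<in> verts E \<Longrightarrow> poly_adj (vertex_var v) - vertex_var v \<in> graph_relations E"
    and "v \<in> verts E \<Longrightarrow> w \<in> verts E \<Longrightarrow> v \<noteq> w \<Longrightarrow> vertex_var v * vertex_var w \<in> graph_relations E"
    and "e \<in> arcs E \<Longrightarrow> edge_var e * poly_adj (edge_var e) * edge_var e - edge_var e \<in> graph_relations E"
    and "e \<in> arcs E \<Longrightarrow> poly_adj (edge_var e) * edge_var e - vertex_var (head E e) \<in> graph_relations E"
    and "e \<in> arcs E \<Longrightarrow> f \<in> arcs E \<Longrightarrow> e \<noteq> f \<Longrightarrow> poly_adj (edge_var e) * edge_var f \<in> graph_relations E"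
    and "regular_vertex E v \<Longrightarrow>
      (\<Sum>e\<in>out_arcs E v. edge_var e * poly_adj (edge_var e)) - vertex_var v \<in> graph_relations E"
    and "e \<in> arcs E \<Longrightarrow> vertex_var (tail E e) * (edge_var e * poly_adj (edge_var e))
        - edge_var e * poly_adj (edge_var e) \<in> graph_relations E"
  unfolding graph_relations_def
  subgoal by (rule UnI1, rule UnI1, rule UnI1, rule UnI1, rule UnI1, rule UnI1, rule UnI1, blast)
  subgoal by (rule UnI1, rule UnI1, rule UnI1, rule UnI1, rule UnI1, rule UnI1, rule UnI2, blast)
  subgoal by (rule UnI1, rule UnI1, rule UnI1, rule UnI1, rule UnI1, rule UnI2, blast)
  subgoal by (rule UnI1, rule UnI1, rule UnI1, rule UnI1, rule UnI2, blast)
  subgoal by (rule UnI1, rule UnI1, rule UnI1, rule UnI2, blast)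
  subgoal by (rule UnI1, rule UnI1, rule UnI2, blast)
  subgoal by (rule UnI1, rule UnI2, blast)
  subgoal by (rule UnI2, blast)
  done

locale graph_alg = wf_digraph E for E :: "('v, 'e) pre_digraph"
begin

abbreviation gens where "gens \<equiv> verts E <+> arcs E"

lemma var_in_polys:
  "v \<in> verts E \<Longrightarrow> vertex_var v \<in> star_polys gens"
  "e \<in> arcs E \<Longrightarrow> edge_var e \<in> star_polys gens"
  by (auto simp: star_polys_gen)

lemma relations_in_polys: "graph_relations E \<subseteq> star_polys gens"
proof
  interpret Z: cstar_seminormed scalar poly_adj "star_polys gens" "\<lambda>p. 0 :: real"
    by (rule poly.cstar_seminormedI)
      (auto simp: star_polys_zero star_polys_add star_polys_mult star_polys_scale star_polys_adj)
  fix r assume "r \<in> graph_relations E"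
  then show "r \<in> star_polys gens"
    by (cases rule: graph_relations_cases)
      (auto intro!: Z.A_closed Z.A_sum var_in_polys simp: regular_vertex_def)
qed

lemma universal_graph: "universal gens (graph_relations E)"
proof
  have V: "N (vertex_var v) \<le> 1"
    if "cstar_seminorm gens N" "\<forall>r\<in>graph_relations E. N r = 0" "v \<in> verts E" for N v
  proof -
    interpret cstar_seminormed scalar poly_adj "star_polys gens" N
      using that by (simp add: cstar_seminorm_iff)
    show ?thesis
      by (rule projection_norm_le_1[OF var_in_polys(1)[OF that(3)]
          bspec[OF that(2) graph_relationsI(1)[OF that(3)]] bspec[OF that(2) graph_relationsI(2)[OF that(3)]]])
  qed
  have S: "N (edge_var e) \<le> 1"
    if N: "cstar_seminorm gens N" "\<forall>r\<in>graph_relations E. N r = 0" and e: "e \<in> arcs E" for N e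
  proof -
    interpret cstar_seminormed scalar poly_adj "star_polys gens" N
      using N by (simp add: cstar_seminorm_iff)
    have "N (poly_adj (edge_var e) * edge_var e - vertex_var (head E e)) = 0"
      by (rule bspec[OF N(2) graph_relationsI(5)[OF e]])
    then have "N (poly_adj (edge_var e) * edge_var e) = N (vertex_var (head E e))"
      using N_abs_diff[of "poly_adj (edge_var e) * edge_var e" "vertex_var (head E e)"] e
      by (simp add: A_closed var_in_polys)
    also have "\<dots> \<le> 1" using V[OF N] e by simp
    finally have "(N (edge_var e))\<^sup>2 \<le> 1" using N_cstar[of "edge_var e"] e var_in_polys by simp
    then show ?thesis using N_nonneg[of "edge_var e"] e var_in_polys
      by (simp add: power_le_one_iff)
  qed
  fix g assume "g \<in> gens"
  then show "\<exists>C. \<forall>N. cstar_seminorm gens N \<longrightarrow> (\<forall>r\<in>graph_relations E. N r = 0) \<longrightarrow> N (poly_gen g) \<le> C"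
    by (intro exI[of _ 1]) (use V S in auto)
qed (rule relations_in_polys)

sublocale universal gens "graph_relations E"
  by (rule universal_graph)

abbreviation V :: "'v \<Rightarrow> ('v + 'e) star_poly" where "V \<equiv> vertex_var"
abbreviation S :: "'e \<Rightarrow> ('v + 'e) star_poly" where "S \<equiv> edge_var"

text \<open>
  Equality in \<open>C*(E)\<close> for elements of the dense subalgebra of *-polynomials. Membership is included so
  that equivalences can be chained without separate side conditions.
\<close>

definition eqv (infix "\<simeq>" 50) where
  "p \<simeq> q \<longleftrightarrow> p \<in> P \<and> q \<in> P \<and> U (p - q) = 0"

lemma eqvD: "p \<simeq> q \<Longrightarrow> p \<in> P" "p \<simeq> q \<Longrightarrow> q \<in> P" "p \<simeq> q \<Longrightarrow> U (p - q) = 0"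
  by (auto simp: eqv_def)

lemma eqv_refl: "p \<in> P \<Longrightarrow> p \<simeq> p"
  by (simp add: eqv_def N_zero)

lemma eqv_sym: "p \<simeq> q \<Longrightarrow> q \<simeq> p"
  using N_minus_commute by (auto simp: eqv_def)

lemma eqv_trans [trans]: "p \<simeq> q \<Longrightarrow> q \<simeq> r \<Longrightarrow> p \<simeq> r"
  using N_diff_triangle[of p q r] N_nonneg[of "p - r"] A_diff[of p r] by (auto simp: eqv_def)

lemma eqv_U: "p \<simeq> q \<Longrightarrow> U p = U q"
  using N_abs_diff[of p q] by (auto simp: eqv_def)

lemma U_null_add: "p \<in> P \<Longrightarrow> q \<in> P \<Longrightarrow> U p = 0 \<Longrightarrow> U q = 0 \<Longrightarrow> U (p + q) = 0"
  using N_triangle[of p q] N_nonneg[of "p + q"] by (simp add: A_add)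

lemma U_null_mult: "p \<in> P \<Longrightarrow> q \<in> P \<Longrightarrow> U p = 0 \<or> U q = 0 \<Longrightarrow> U (p * q) = 0"
  using N_mult[of p q] N_nonneg[of "p * q"] A_mult by force

lemma eqv_add: assumes "p \<simeq> p'" "q \<simeq> q'" shows "p + q \<simeq> p' + q'"
proof -
  have "U ((p - p') + (q - q')) = 0" using assms by (intro U_null_add A_diff) (auto simp: eqv_def)
  then show ?thesis using assms by (auto simp: eqv_def A_add algebra_simps)
qed

lemma eqv_mult: assumes "p \<simeq> p'" "q \<simeq> q'" shows "p * q \<simeq> p' * q'"
proof -
  have "U ((p - p') * q + p' * (q - q')) = 0"
    using assms by (intro U_null_add U_null_mult A_mult A_diff) (auto simp: eqv_def)
  then show ?thesis using assms by (auto simp: eqv_def A_mult algebra_simps)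
qed

lemma eqv_scale: assumes "p \<simeq> q" shows "scalar c * p \<simeq> scalar c * q"
  using assms N_scale[of "p - q" c] by (auto simp: eqv_def A_scale A_diff right_diff_distrib)

lemma eqv_uminus: "p \<simeq> q \<Longrightarrow> - p \<simeq> - q"
  using eqv_scale[of p q "-1"] by (simp add: poly.k_uminus poly.k_one)

lemma eqv_diff: "p \<simeq> p' \<Longrightarrow> q \<simeq> q' \<Longrightarrow> p - q \<simeq> p' - q'"
  using eqv_add[OF _ eqv_uminus] by fastforce

lemma eqv_adj: assumes "p \<simeq> q" shows "poly_adj p \<simeq> poly_adj q"
  using assms N_adj[of "p - q"] by (auto simp: eqv_def A_adj A_diff poly.adj_diff)

lemma eqv_sum: "(\<And>i. i \<in> I \<Longrightarrow> f i \<simeq> g i) \<Longrightarrow> sum f I \<simeq> sum g I"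
  by (induction I rule: infinite_finite_induct) (auto intro: eqv_refl A_zero eqv_add)

lemma eqv_left: "a \<in> P \<Longrightarrow> p \<simeq> q \<Longrightarrow> a * p \<simeq> a * q"
  by (intro eqv_mult eqv_refl)

lemma eqv_right: "a \<in> P \<Longrightarrow> p \<simeq> q \<Longrightarrow> p * a \<simeq> q * a"
  by (intro eqv_mult eqv_refl)

lemma eqv_left0: "a \<in> P \<Longrightarrow> p \<simeq> 0 \<Longrightarrow> a * p \<simeq> 0"
  using eqv_left[of a p 0] by simp

lemma eqv_right0: "a \<in> P \<Longrightarrow> p \<simeq> 0 \<Longrightarrow> p * a \<simeq> 0"
  using eqv_right[of a p 0] by simp

lemma eqv_adj0: "p \<simeq> 0 \<Longrightarrow> poly_adj p \<simeq> 0"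
  using eqv_adj[of p 0] by (simp add: poly.adj_zero)

lemma eqv_of_relation: "p - q \<in> graph_relations E \<Longrightarrow> p \<in> P \<Longrightarrow> q \<in> P \<Longrightarrow> p \<simeq> q"
  by (simp add: eqv_def U_relation)

lemma V_P [simp]: "v \<in> verts E \<Longrightarrow> V v \<in> P"
  and S_P [simp]: "e \<in> arcs E \<Longrightarrow> S e \<in> P"
  and Sadj_P [simp]: "e \<in> arcs E \<Longrightarrow> poly_adj (S e) \<in> P"
  by (simp_all add: var_in_polys A_adj)

lemma V_idem: "v \<in> verts E \<Longrightarrow> V v * V v \<simeq> V v"
  by (intro eqv_of_relation graph_relationsI A_mult V_P)

lemma V_sa: "v \<in> verts E \<Longrightarrow> poly_adj (V v) \<simeq> V v"
  by (intro eqv_of_relation graph_relationsI A_adj V_P)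

lemma V_orth: assumes "v \<in> verts E" "w \<in> verts E" "v \<noteq> w" shows "V v * V w \<simeq> 0"
  using U_relation[OF graph_relationsI(3)[OF assms]] assms by (simp add: eqv_def A_mult A_zero)

lemma S_adj_S: "e \<in> arcs E \<Longrightarrow> poly_adj (S e) * S e \<simeq> V (head E e)"
  by (intro eqv_of_relation graph_relationsI A_mult Sadj_P S_P V_P) auto

lemma S_adj_S0: assumes "e \<in> arcs E" "f \<in> arcs E" "e \<noteq> f" shows "poly_adj (S e) * S f \<simeq> 0"
  using U_relation[OF graph_relationsI(6)[OF assms]] assms by (simp add: eqv_def A_mult A_zero)

lemma S_S_adj_S: "e \<in> arcs E \<Longrightarrow> S e * poly_adj (S e) * S e \<simeq> S e"
  by (intro eqv_of_relation graph_relationsI A_mult Sadj_P S_P)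

lemma CK: "regular_vertex E v \<Longrightarrow> (\<Sum>e\<in>out_arcs E v. S e * poly_adj (S e)) \<simeq> V v"
  by (intro eqv_of_relation graph_relationsI) (auto simp: regular_vertex_def intro!: A_sum A_mult)

lemma V_S: assumes "e \<in> arcs E" shows "V (tail E e) * S e \<simeq> S e"
proof -
  let ?V = "V (tail E e)" and ?S = "S e"
  have V: "?V \<in> P" using assms by simp
  have "?V * ?S \<simeq> ?V * (?S * poly_adj ?S * ?S)"
    by (intro eqv_left V eqv_sym[OF S_S_adj_S[OF assms]])
  also have "\<dots> = (?V * (?S * poly_adj ?S)) * ?S" by (simp add: mult.assoc)
  also have "\<dots> \<simeq> ?S * poly_adj ?S * ?S"
    by (intro eqv_right eqv_of_relation graph_relationsI A_mult) (use assms in auto)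
  also have "\<dots> \<simeq> ?S" by (rule S_S_adj_S[OF assms])
  finally show ?thesis .
qed

lemma S_V: assumes "e \<in> arcs E" shows "S e * V (head E e) \<simeq> S e"
proof -
  have "S e * V (head E e) \<simeq> S e * (poly_adj (S e) * S e)"
    by (intro eqv_left eqv_sym[OF S_adj_S]) (use assms in auto)
  also have "\<dots> \<simeq> S e" using S_S_adj_S[OF assms] by (simp add: mult.assoc)
  finally show ?thesis .
qed

lemma V_S0: assumes "e \<in> arcs E" "w \<in> verts E" "w \<noteq> tail E e" shows "V w * S e \<simeq> 0"
proof -
  have "V w * S e \<simeq> V w * (V (tail E e) * S e)"
    by (intro eqv_left eqv_sym[OF V_S]) (use assms in auto)
  also have "\<dots> = V w * V (tail E e) * S e" by (simp add: mult.assoc)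
  also have "\<dots> \<simeq> 0" by (intro eqv_right0 V_orth) (use assms in auto)
  finally show ?thesis .
qed

text \<open>
  A polynomial representing \<open>S\<^sub>\<alpha>\<close>. The trailing vertex factor does not change its class, since
  \<open>S\<^sub>e P\<^bsub>r(e)\<^esub> = S\<^sub>e\<close>; it makes the recursion uniform.
\<close>

primrec mon :: "'v \<Rightarrow> 'e list \<Rightarrow> ('v + 'e) star_poly" where
  "mon v [] = V v"
| "mon v (e # p) = S e * mon (head E e) p"

lemma mon_P [simp]: "awalk u p w \<Longrightarrow> mon u p \<in> P"
  by (induction p arbitrary: u) (auto simp: awalk_simps intro!: A_mult)

lemma mon_adj_P [simp]: "awalk u p w \<Longrightarrow> poly_adj (mon u p) \<in> P"
  by (intro A_adj mon_P)

lemma awalk_verts_in: "awalk u p w \<Longrightarrow> u \<in> verts E" "awalk u p w \<Longrightarrow> w \<in> verts E"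
  by (simp_all add: awalk_hd_in_verts awalk_last_in_verts)

lemma V_mon: assumes "awalk u p w" shows "V u * mon u p \<simeq> mon u p"
proof (cases p)
  case Nil then show ?thesis using assms awalk_verts_in V_idem by auto
next
  case (Cons e q)
  then have e: "e \<in> arcs E" "u = tail E e" "awalk (head E e) q w" using assms by (auto simp: awalk_Cons_iff)
  have "V u * S e * mon (head E e) q \<simeq> S e * mon (head E e) q"
    by (rule eqv_right) (use e V_S in auto)
  then show ?thesis by (simp add: Cons mult.assoc)
qed

lemma V_mon0: assumes "awalk u p w" "v \<in> verts E" "v \<noteq> u" shows "V v * mon u p \<simeq> 0"
proof -
  have "V v * mon u p \<simeq> V v * (V u * mon u p)"
    by (intro eqv_left eqv_sym[OF V_mon]) (use assms in auto)
  also have "\<dots> = V v * V u * mon u p" by (simp add: mult.assoc)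
  also have "\<dots> \<simeq> 0" by (intro eqv_right0 V_orth) (use assms awalk_verts_in in auto)
  finally show ?thesis .
qed

lemma mon_V: "awalk u p w \<Longrightarrow> mon u p * V w \<simeq> mon u p"
proof (induction p arbitrary: u)
  case Nil then show ?case using awalk_verts_in V_idem by (auto simp: awalk_Nil_iff)
next
  case (Cons e p)
  then have "e \<in> arcs E" "awalk (head E e) p w" by (auto simp: awalk_Cons_iff)
  then show ?case using eqv_left[OF S_P Cons.IH] by (simp add: mult.assoc)
qed

lemma mon_append: "awalk u p w \<Longrightarrow> awalk w q x \<Longrightarrow> mon u p * mon w q \<simeq> mon u (p @ q)"
proof (induction p arbitrary: u)
  case Nil then show ?case using V_mon by (auto simp: awalk_Nil_iff)
next
  case (Cons e p)
  then have "e \<in> arcs E" "awalk (head E e) p w" by (auto simp: awalk_Cons_iff)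
  then show ?case using eqv_left[OF S_P Cons.IH[OF _ Cons.prems(2)]] by (simp add: mult.assoc)
qed

lemma mon_single: "e \<in> arcs E \<Longrightarrow> mon v [e] \<simeq> S e"
  by (simp add: S_V)

lemma S_mon: assumes "e \<in> arcs E" "awalk u p w" "head E e \<noteq> u" shows "S e * mon u p \<simeq> 0"
proof -
  have "S e * mon u p \<simeq> S e * V (head E e) * mon u p"
    by (intro eqv_right eqv_sym[OF S_V]) (use assms in auto)
  also have "\<dots> = S e * (V (head E e) * mon u p)" by (simp add: mult.assoc)
  also have "\<dots> \<simeq> 0" by (intro eqv_left0 V_mon0) (use assms in auto)
  finally show ?thesis .
qed

lemma S_adj_mon:
  assumes "e \<in> arcs E" "awalk (head E e) p w"
  shows "poly_adj (S e) * (S e * mon (head E e) p) \<simeq> mon (head E e) p"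
proof -
  have "poly_adj (S e) * (S e * mon (head E e) p) = poly_adj (S e) * S e * mon (head E e) p"
    by (simp add: mult.assoc)
  also have "\<dots> \<simeq> V (head E e) * mon (head E e) p" by (intro eqv_right S_adj_S) (use assms in auto)
  also have "\<dots> \<simeq> mon (head E e) p" by (rule V_mon[OF assms(2)])
  finally show ?thesis .
qed

lemma S_adj_mon0:
  assumes "e \<in> arcs E" "f \<in> arcs E" "e \<noteq> f" "x \<in> P"
  shows "poly_adj (S e) * (S f * x) \<simeq> 0"
  using eqv_right0[OF assms(4) S_adj_S0[OF assms(1-3)]] by (simp add: mult.assoc)

lemma mon_adj_mon: "awalk u p w \<Longrightarrow> poly_adj (mon u p) * mon u p \<simeq> V w"
proof (induction p arbitrary: u)
  case Nil
  then show ?case using awalk_verts_in eqv_trans[OF eqv_right[OF V_P V_sa] V_idem] by (auto simp: awalk_Nil_iff)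
next
  case (Cons e p)
  then have e: "e \<in> arcs E" "awalk (head E e) p w" by (auto simp: awalk_Cons_iff)
  have "poly_adj (mon u (e # p)) * mon u (e # p)
      = poly_adj (mon (head E e) p) * (poly_adj (S e) * (S e * mon (head E e) p))"
    by (simp add: poly.adj_mult mult.assoc)
  also have "\<dots> \<simeq> poly_adj (mon (head E e) p) * mon (head E e) p"
    by (rule eqv_left[OF mon_adj_P[OF e(2)] S_adj_mon[OF e]])
  also have "\<dots> \<simeq> V w" by (rule Cons.IH[OF e(2)])
  finally show ?case .
qed

text \<open>
  Compare the paths edge by edge: common edges cancel by \<open>S\<^sub>e\<^sup>* S\<^sub>e = P\<^bsub>r(e)\<^esub>\<close>, and as neither path is a
  prefix of the other, they eventually differ.
\<close>

lemma mon_orth: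
  "\<lbrakk>awalk u p w; awalk u' q w'; take (length p) q \<noteq> p; take (length q) p \<noteq> q\<rbrakk>
    \<Longrightarrow> poly_adj (mon u p) * mon u' q \<simeq> 0"
proof (induction p arbitrary: q u u')
  case (Cons e p)
  then obtain f q' where q: "q = f # q'" by (cases q) auto
  have e: "e \<in> arcs E" "awalk (head E e) p w" and f: "f \<in> arcs E" "awalk (head E f) q' w'"
    using Cons.prems q by (auto simp: awalk_Cons_iff)
  have eq: "poly_adj (mon u (e # p)) * mon u' q = poly_adj (mon (head E e) p) * (poly_adj (S e) * (S f * mon (head E f) q'))"
    by (simp add: poly.adj_mult mult.assoc q)
  show ?case
  proof (cases "e = f")
    case False
    show ?thesis unfolding eq
      by (intro eqv_left0 S_adj_mon0 mon_adj_P[OF e(2)] e f False mon_P[OF f(2)])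
  next
    case True
    have "poly_adj (mon (head E e) p) * (poly_adj (S e) * (S e * mon (head E e) q'))
        \<simeq> poly_adj (mon (head E e) p) * mon (head E e) q'"
      by (intro eqv_left S_adj_mon[where w=w'] mon_adj_P[OF e(2)] e) (use f True in simp)
    also have "\<dots> \<simeq> 0"
      by (rule Cons.IH[OF e(2)]) (use f True Cons.prems q in auto)
    finally show ?thesis unfolding eq using True by simp
  qed
qed simp

lemma cl_const_eq: "p \<simeq> q \<Longrightarrow> cl (\<lambda>n. p) = cl (\<lambda>n. q)"
  using L_const[OF A_diff] by (intro cl_eqI CS_const) (auto simp: eqv_def fun_diff_def)

lemma vproj_eq: "vproj E v = cl (\<lambda>n. V v)"
  by (simp add: vproj_def universal_gen_def)

lemma eiso_eq: "eiso E e = cl (\<lambda>n. S e)"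
  by (simp add: eiso_def universal_gen_def)

lemma path_iso_eq: "awalk v p w \<Longrightarrow> path_iso E (v, p) = cl (\<lambda>n. mon v p)"
proof (induction p arbitrary: v)
  case (Cons e p)
  then have e: "e \<in> arcs E" "awalk (head E e) p w" by (auto simp: awalk_Cons_iff)
  show ?case
  proof (cases p)
    case Nil
    then show ?thesis using cl_const_eq[OF mon_single[OF e(1)]] by (simp add: eiso_eq)
  next
    case (Cons f q)
    then have "path_iso E (v, e # p) = cmult alg (eiso E e) (path_iso E (head E e, p))"
      by (simp add: graph_cstar_def)
    then show ?thesis using Cons.IH[OF e(2)] e
      by (simp add: eiso_eq cl_mult CS_const) (simp add: times_fun_def)
  qed
qed (simp add: vproj_eq)

definition rangeproj :: "'e set \<Rightarrow> ('v + 'e) star_poly" where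
  "rangeproj K = (\<Sum>k\<in>K. S k * poly_adj (S k))"

lemma rangeproj_sa: "poly_adj (rangeproj K) = rangeproj K"
  by (simp add: rangeproj_def poly.adj_sum poly.adj_mult poly.adj_adj)

lemma eqv_sum_delta:
  assumes "finite Y" "y \<in> Y" "f y \<simeq> a" "\<And>z. z \<in> Y \<Longrightarrow> z \<noteq> y \<Longrightarrow> f z \<simeq> 0"
  shows "sum f Y \<simeq> a"
proof -
  have "sum f Y = f y + sum f (Y - {y})" using assms by (simp add: sum.remove)
  also have "\<dots> \<simeq> a + (\<Sum>z\<in>Y - {y}. 0)" by (intro eqv_add eqv_sum assms) auto
  finally show ?thesis by simp
qed

lemma eqv_sum0: "(\<And>z. z \<in> Y \<Longrightarrow> f z \<simeq> 0) \<Longrightarrow> sum f Y \<simeq> 0"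
  using eqv_sum[of Y f "\<lambda>z. 0"] by simp

lemma S_adj_V: assumes "e \<in> arcs E" shows "poly_adj (S e) * V (tail E e) \<simeq> poly_adj (S e)"
proof -
  have "poly_adj (S e) * V (tail E e) \<simeq> poly_adj (S e) * poly_adj (V (tail E e))"
    by (intro eqv_left eqv_sym[OF V_sa]) (use assms in auto)
  also have "\<dots> \<simeq> poly_adj (S e)" using eqv_adj[OF V_S[OF assms]] by (simp add: poly.adj_mult)
  finally show ?thesis .
qed

lemma S_adj_mon_tail:
  assumes e: "e \<in> arcs E" and p: "awalk u p w" and ne: "tail E e \<noteq> u"
  shows "poly_adj (S e) * mon u p \<simeq> 0"
proof -
  have "poly_adj (S e) * mon u p \<simeq> poly_adj (S e) * V (tail E e) * mon u p"
    by (intro eqv_right mon_P[OF p] eqv_sym[OF S_adj_V] e)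
  also have "\<dots> = poly_adj (S e) * (V (tail E e) * mon u p)" by (simp add: mult.assoc)
  also have "\<dots> \<simeq> 0" by (intro eqv_left0 V_mon0[OF p]) (use e ne in auto)
  finally show ?thesis .
qed

text \<open>
  Such sums are partial isometries between the ranges of two finite sets of edges, matched by pairs
  with a common end. The finite truncations of the action of a loop have this form.
\<close>

lemma matching_sum:
  assumes Y: "finite Y" and a: "inj_on a Y" "a ` Y \<subseteq> arcs E" and b: "inj_on b Y" "b ` Y \<subseteq> arcs E"
    and hd: "\<And>y. y \<in> Y \<Longrightarrow> head E (a y) = head E (b y)"
  defines "W \<equiv> \<Sum>y\<in>Y. S (a y) * poly_adj (S (b y))"
  shows "W \<in> P" "poly_adj W * W \<simeq> rangeproj (b ` Y)"
proof -
  have arcs: "a y \<in> arcs E" "b y \<in> arcs E" if "y \<in> Y" for y using a b that by auto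
  show "W \<in> P" unfolding W_def by (rule A_sum) (auto intro: A_mult simp: arcs)
  have adj: "poly_adj W = (\<Sum>y\<in>Y. S (b y) * poly_adj (S (a y)))"
    by (simp add: W_def poly.adj_sum poly.adj_mult poly.adj_adj)
  have "poly_adj W * W = (\<Sum>y\<in>Y. \<Sum>z\<in>Y. S (b y) * poly_adj (S (a y)) * (S (a z) * poly_adj (S (b z))))"
    unfolding adj unfolding W_def by (rule sum_product)
  also have "\<dots> \<simeq> (\<Sum>y\<in>Y. S (b y) * poly_adj (S (b y)))"
  proof (intro eqv_sum eqv_sum_delta[OF Y])
    fix y assume y: "y \<in> Y"
    have "S (b y) * poly_adj (S (a y)) * (S (a y) * poly_adj (S (b y)))
        = S (b y) * (poly_adj (S (a y)) * S (a y)) * poly_adj (S (b y))" by (simp add: mult.assoc)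
    also have "\<dots> \<simeq> S (b y) * V (head E (a y)) * poly_adj (S (b y))"
      by (intro eqv_right eqv_left S_adj_S S_P Sadj_P arcs y)
    also have "\<dots> \<simeq> S (b y) * poly_adj (S (b y))"
      unfolding hd[OF y] by (intro eqv_right S_V Sadj_P arcs y)
    finally show "S (b y) * poly_adj (S (a y)) * (S (a y) * poly_adj (S (b y))) \<simeq> S (b y) * poly_adj (S (b y))" .
    fix z assume z: "z \<in> Y" "z \<noteq> y"
    then have "a y \<noteq> a z" using a(1) y by (auto simp: inj_on_def)
    have "S (b y) * poly_adj (S (a y)) * (S (a z) * poly_adj (S (b z)))
        = S (b y) * (poly_adj (S (a y)) * S (a z)) * poly_adj (S (b z))" by (simp add: mult.assoc)
    also have "\<dots> \<simeq> 0"
      by (intro eqv_right0 eqv_left0 S_adj_S0 S_P Sadj_P arcs y z \<open>a y \<noteq> a z\<close>)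
    finally show "S (b y) * poly_adj (S (a y)) * (S (a z) * poly_adj (S (b z))) \<simeq> 0" .
  qed
  also have "(\<Sum>y\<in>Y. S (b y) * poly_adj (S (b y))) = rangeproj (b ` Y)"
    unfolding rangeproj_def using b(1) by (simp add: sum.reindex)
  finally show "poly_adj W * W \<simeq> rangeproj (b ` Y)" .
qed

lemma rangeproj_idem: assumes "finite K" "K \<subseteq> arcs E" shows "rangeproj K * rangeproj K \<simeq> rangeproj K"
  using matching_sum(2)[of K "\<lambda>k. k" "\<lambda>k. k"] assms by (simp add: rangeproj_sa flip: rangeproj_def)

lemma U_rangeproj: assumes "finite K" "K \<subseteq> arcs E" shows "U (rangeproj K) \<le> 1"
  using rangeproj_idem[OF assms] by (intro projection_norm_le_1) (auto simp: eqv_def rangeproj_sa N_zero)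

lemma rangeproj_orth:
  assumes "K \<subseteq> arcs E" "M \<subseteq> arcs E" "K \<inter> M = {}" shows "rangeproj K * rangeproj M \<simeq> 0"
proof -
  have "rangeproj K * rangeproj M = (\<Sum>k\<in>K. \<Sum>m\<in>M. S k * poly_adj (S k) * (S m * poly_adj (S m)))"
    unfolding rangeproj_def by (rule sum_product)
  also have "\<dots> \<simeq> 0"
  proof (intro eqv_sum0)
    fix k m assume km: "k \<in> K" "m \<in> M"
    then have k: "k \<in> arcs E" "m \<in> arcs E" "k \<noteq> m" using assms by auto
    have "S k * poly_adj (S k) * (S m * poly_adj (S m)) = S k * (poly_adj (S k) * S m) * poly_adj (S m)"
      by (simp add: mult.assoc)
    also have "\<dots> \<simeq> 0" by (intro eqv_right0 eqv_left0 S_adj_S0 S_P Sadj_P k)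
    finally show "S k * poly_adj (S k) * (S m * poly_adj (S m)) \<simeq> 0" .
  qed
  finally show ?thesis .
qed

text \<open>
  The defect \<open>Z = W - W q\<close> satisfies \<open>Z\<^sup>* Z = q - q - q + q = 0\<close>.
\<close>

lemma partial_isometry:
  assumes W: "W \<in> P" "poly_adj W * W \<simeq> q" and q: "q * q \<simeq> q" "poly_adj q = q"
  shows "W * q \<simeq> W"
proof -
  have qP: "q \<in> P" using q by (auto simp: eqv_def)
  let ?Z = "W - W * q"
  have ZP: "?Z \<in> P" using W qP by (simp add: A_closed)
  have "poly_adj ?Z * ?Z = poly_adj W * W - (poly_adj W * W) * q - (q * (poly_adj W * W) - q * (poly_adj W * W) * q)"
    by (simp add: poly.adj_simps q algebra_simps)
  also have "\<dots> \<simeq> q - q - (q - q)"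
  proof (intro eqv_diff)
    show "poly_adj W * W * q \<simeq> q" using eqv_trans[OF eqv_right[OF qP W(2)] q(1)] .
    show *: "q * (poly_adj W * W) \<simeq> q" using eqv_trans[OF eqv_left[OF qP W(2)] q(1)] .
    show "q * (poly_adj W * W) * q \<simeq> q" using eqv_trans[OF eqv_right[OF qP *] q(1)] .
  qed (rule W)
  finally have "U (poly_adj ?Z * ?Z) = 0" using eqv_U[of _ 0] by (simp add: N_zero)
  then have "U ?Z = 0" using N_cstar[OF ZP] by simp
  then have "W - W * q \<simeq> 0" using ZP by (simp add: eqv_def A_zero)
  then show ?thesis using W qP N_minus_commute[of W "W * q"] by (auto simp: eqv_def A_mult)
qed

lemma rangeproj_mon:
  assumes K: "finite K" "K \<subseteq> arcs E" and p: "awalk u (g # p) w" and g: "g \<in> K"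
  shows "rangeproj K * mon u (g # p) \<simeq> mon u (g # p)"
proof -
  have g': "g \<in> arcs E" "awalk (head E g) p w" using p by (auto simp: awalk_Cons_iff)
  have "rangeproj K * mon u (g # p) = (\<Sum>k\<in>K. S k * (poly_adj (S k) * (S g * mon (head E g) p)))"
    by (simp add: rangeproj_def sum_distrib_right mult.assoc)
  also have "\<dots> \<simeq> S g * mon (head E g) p"
  proof (rule eqv_sum_delta[OF K(1) g])
    show "S g * (poly_adj (S g) * (S g * mon (head E g) p)) \<simeq> S g * mon (head E g) p"
      by (rule eqv_left[OF S_P[OF g'(1)] S_adj_mon[OF g']])
    fix k assume k: "k \<in> K" "k \<noteq> g"
    then have "k \<in> arcs E" using K by auto
    then show "S k * (poly_adj (S k) * (S g * mon (head E g) p)) \<simeq> 0"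
      by (intro eqv_left0[OF S_P S_adj_mon0] k g' mon_P[OF g'(2)])
  qed
  finally show ?thesis by simp
qed

lemma rangeproj_mon0:
  assumes K: "K \<subseteq> arcs E" and p: "awalk u p w" and tl: "\<And>k. k \<in> K \<Longrightarrow> tail E k \<noteq> u"
  shows "rangeproj K * mon u p \<simeq> 0"
  unfolding rangeproj_def sum_distrib_right mult.assoc
  by (intro eqv_sum0 eqv_left0[OF S_P S_adj_mon_tail[OF _ p]]) (use K tl in auto)

lemma V_rangeproj:
  assumes K: "K \<subseteq> out_arcs E v" and v: "v \<in> verts E" shows "V v * rangeproj K \<simeq> rangeproj K"
  unfolding rangeproj_def sum_distrib_left mult.assoc[symmetric]
proof (rule eqv_sum)
  fix k assume "k \<in> K"
  then have "k \<in> arcs E" "tail E k = v" using K by auto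
  then show "V v * S k * poly_adj (S k) \<simeq> S k * poly_adj (S k)"
    using eqv_right[OF Sadj_P V_S] by blast
qed

lemma awalk_path: "awalk u p w \<Longrightarrow> (u, p) \<in> paths E" "awalk u p w \<Longrightarrow> path_range E (u, p) = w"
  by (auto simp: paths_def path_range_def)

lemma is_loop_edge: "e \<in> arcs E \<Longrightarrow> is_loop E (edge_path E e) \<longleftrightarrow> tail E e = head E e"
  using awalk_path[of "tail E e" "[e]" "head E e"]
  by (auto simp: is_loop_def edge_path_def path_source_def awalk_simps)

lemma pointed_iff: assumes "awalk u q w"
  shows "pointed_path E (u, q) \<longleftrightarrow> q = [] \<or> tail E (last q) \<noteq> head E (last q)"
proof -
  have "last q \<in> arcs E" if "q \<noteq> []" using assms that last_in_set by (auto simp: awalk_def)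
  then show ?thesis using awalk_path(1)[OF assms] is_loop_edge by (auto simp: pointed_path_def)
qed

lemma graph_cstar_eq: "graph_cstar E = alg"
  by (simp add: graph_cstar_def)

lemma cstar_algebra_graph: "cstar_algebra (graph_cstar E)"
  by (simp add: graph_cstar_eq cstar_algebra_universal)

text \<open>
  The uniqueness half of the definition is automatic, by \<open>star_hom_unique\<close>.
\<close>

lemma determined_homI:
  assumes B: "cstar_algebra B" and h: "hom_on_generators E B p s \<phi>" shows "determined_hom E B p s \<phi>"
proof -
  have "\<psi> = \<phi>" if h': "hom_on_generators E B p s \<psi>" for \<psi>
  proof (rule star_hom_unique[OF B])
    show "star_hom alg B \<psi>" "star_hom alg B \<phi>"
      using h h' by (simp_all add: hom_on_generators_def graph_cstar_eq)
    fix g assume "g \<in> gens"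
    then show "\<psi> (universal_gen gens (graph_relations E) g) = \<phi> (universal_gen gens (graph_relations E) g)"
      using h h' by (auto simp: hom_on_generators_def vproj_def eiso_def)
  qed
  then show ?thesis using h unfolding determined_hom_def by blast
qed

definition unit_poly :: "('v + 'e) star_poly" where
  "unit_poly = (\<Sum>v\<in>verts E. V v)"

lemma unit_poly_P: "unit_poly \<in> P"
  unfolding unit_poly_def by (rule A_sum) simp

lemma unit_poly_gen:
  assumes fin: "finite (verts E)" and g: "g \<in> gens"
  shows "unit_poly * poly_gen g \<simeq> poly_gen g" "poly_gen g * unit_poly \<simeq> poly_gen g"
proof -
  have "unit_poly * V w \<simeq> V w \<and> V w * unit_poly \<simeq> V w" if w: "w \<in> verts E" for w
    unfolding unit_poly_def sum_distrib_left sum_distrib_right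
    by (intro conjI eqv_sum_delta[OF fin w] V_idem V_orth w) auto
  moreover have "unit_poly * S e \<simeq> S e \<and> S e * unit_poly \<simeq> S e" if e: "e \<in> arcs E" for e
  proof -
    have ends: "tail E e \<in> verts E" "head E e \<in> verts E" using e by auto
    have "S e * V v \<simeq> 0" if "v \<in> verts E" "v \<noteq> head E e" for v
      using S_mon[OF e, of v "[]" v] that by (simp add: awalk_Nil_iff)
    then show ?thesis unfolding unit_poly_def sum_distrib_left sum_distrib_right
      by (intro conjI eqv_sum_delta[OF fin ends(1)] eqv_sum_delta[OF fin ends(2)] V_S S_V V_S0 e) auto
  qed
  ultimately show "unit_poly * poly_gen g \<simeq> poly_gen g" "poly_gen g * unit_poly \<simeq> poly_gen g"
    using g by auto
qed

lemma unit_poly_neutral: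
  assumes fin: "finite (verts E)" and p: "p \<in> P"
  shows "unit_poly * p \<simeq> p \<and> p * unit_poly \<simeq> p"
  using p
proof (induction p rule: star_polys_induct)
  case zero then show ?case by (simp add: eqv_refl A_zero)
next
  case (add p q) then show ?case by (simp add: distrib_left distrib_right eqv_add)
next
  case (scale c p) then show ?case
    by (simp add: poly.k_left_comm[of unit_poly] mult.assoc eqv_scale)
next
  case (mult p q)
  then show ?case using eqv_right[OF mult(2), of "unit_poly * p" p] eqv_left[OF mult(1), of "q * unit_poly" q]
    by (simp add: mult.assoc)
next
  case (gen g) then show ?case using unit_poly_gen[OF fin] by blast
next
  case (adj p)
  have sa: "poly_adj unit_poly \<simeq> unit_poly"
    unfolding unit_poly_def poly.adj_sum by (intro eqv_sum V_sa)
  have "unit_poly * poly_adj p \<simeq> poly_adj unit_poly * poly_adj p"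
    "poly_adj p * unit_poly \<simeq> poly_adj p * poly_adj unit_poly"
    by (intro eqv_right eqv_left eqv_sym[OF sa] A_adj adj)+
  then show ?case
    using eqv_trans eqv_adj[of "p * unit_poly" p] eqv_adj[of "unit_poly * p" p] adj
    by (auto simp: poly.adj_mult)
qed

definition unit_elem :: "('v, 'e) graph_elem" where
  "unit_elem = cl (\<lambda>n. unit_poly)"

lemma unit_elem: assumes fin: "finite (verts E)" shows "is_cunit (graph_cstar E) unit_elem"
  unfolding is_cunit_def graph_cstar_eq
proof (intro conjI ballI)
  show "unit_elem \<in> celems alg" by (simp add: unit_elem_def cl_closed CS_const unit_poly_P)
  fix x assume "x \<in> celems alg"
  then obtain X where X: "X \<in> CS" "x = cl X" by (rule celems_E)
  let ?u = "\<lambda>n::nat. unit_poly"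
  have u: "?u \<in> CS" by (simp add: CS_const unit_poly_P)
  note n = unit_poly_neutral[OF fin CS_P[OF X(1)]]
  have "L (?u * X - X) = 0" "L (X * ?u - X) = 0"
    using n by (auto intro!: null_seq_CS(2) A_diff A_mult CS_P[OF X(1)] unit_poly_P simp: eqv_def times_fun_def)
  then show "cmult alg unit_elem x = x" "cmult alg x unit_elem = x"
    using X u by (simp_all add: unit_elem_def cl_mult cl_eq_iff CS_mult)
qed

end

section \<open>The ideal of a hereditary set of vertices\<close>

locale hereditary_set = graph_alg +
  fixes H :: "'a set"
  assumes H_verts: "H \<subseteq> verts E" and H_arc: "\<lbrakk>e \<in> arcs E; tail E e \<in> H\<rbrakk> \<Longrightarrow> head E e \<in> H"
begin

text \<open>
  The span of the elements \<open>S\<^sub>\<alpha> S\<^sub>\<beta>\<^sup>*\<close> with a common end in \<open>H\<close>, together with the *-polynomials equal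
  to them in \<open>C*(E)\<close>. It is not completed in norm: sums that are infinite in general act locally finitely on this ideal.
\<close>

inductive_set J :: "('a + 'b) star_poly set" where
  J_mon: "\<lbrakk>awalk u p w; awalk u' q w; w \<in> H\<rbrakk> \<Longrightarrow> mon u p * poly_adj (mon u' q) \<in> J"
| J_zero: "0 \<in> J"
| J_add: "\<lbrakk>x \<in> J; y \<in> J\<rbrakk> \<Longrightarrow> x + y \<in> J"
| J_scale: "x \<in> J \<Longrightarrow> scalar c * x \<in> J"
| J_eqv: "\<lbrakk>x \<in> J; x \<simeq> y\<rbrakk> \<Longrightarrow> y \<in> J"

lemma J_P: "x \<in> J \<Longrightarrow> x \<in> P"
  by (induction rule: J.induct) (auto intro: A_closed mon_P simp: eqv_def)

lemma J_null: "x \<simeq> 0 \<Longrightarrow> x \<in> J"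
  using J_eqv[OF J_zero eqv_sym] by blast

lemma J_adj: "x \<in> J \<Longrightarrow> poly_adj x \<in> J"
proof (induction rule: J.induct)
  case (J_mon u p w u' q)
  then show ?case using J.J_mon[of u' q w u p] by (simp add: poly.adj_mult poly.adj_adj)
next
  case (J_scale x c)
  then show ?case using J.J_scale[of "poly_adj x" "cnj c"] by (simp add: poly.adj_mult poly.adj_k poly.k_comm)
qed (auto intro: J.J_zero J.J_add J.J_eqv eqv_adj simp: poly.adj_zero poly.adj_add)

lemma J_left_gen:
  assumes a: "a \<in> P" and base: "\<And>u p w u' q. \<lbrakk>awalk u p w; awalk u' q w; w \<in> H\<rbrakk>
    \<Longrightarrow> a * (mon u p * poly_adj (mon u' q)) \<in> J"
  shows "x \<in> J \<Longrightarrow> a * x \<in> J"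
proof (induction rule: J.induct)
  case (J_mon u p w u' q) then show ?case by (rule base)
next
  case (J_scale x c)
  then show ?case using J.J_scale[of "a * x" c] by (metis poly.k_left_comm)
next
  case (J_eqv x y)
  then show ?case using J.J_eqv eqv_left[OF a] by blast
qed (auto intro: J.J_zero J.J_add simp: distrib_left)

lemma J_left_V: assumes v: "v \<in> verts E" and x: "x \<in> J" shows "V v * x \<in> J"
proof (rule J_left_gen[OF _ _ x])
  fix u p w u' q assume w: "awalk u p w" "awalk u' q w" "w \<in> H"
  have "V v * mon u p * poly_adj (mon u' q) \<in> J"
  proof (cases "v = u")
    case True
    show ?thesis unfolding True
      by (rule J_eqv[OF J_mon[OF w] eqv_sym[OF eqv_right[OF mon_adj_P[OF w(2)] V_mon[OF w(1)]]]])
  next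
    case False
    show ?thesis by (rule J_null[OF eqv_right0[OF mon_adj_P[OF w(2)] V_mon0[OF w(1) v False]]])
  qed
  then show "V v * (mon u p * poly_adj (mon u' q)) \<in> J" by (simp add: mult.assoc)
qed (simp add: v)

lemma J_left_S: assumes e: "e \<in> arcs E" and x: "x \<in> J" shows "S e * x \<in> J"
proof (rule J_left_gen[OF _ _ x])
  fix u p w u' q assume w: "awalk u p w" "awalk u' q w" "w \<in> H"
  have "S e * mon u p * poly_adj (mon u' q) \<in> J"
  proof (cases "head E e = u")
    case True
    have "awalk (tail E e) (e # p) w" using w True e by (simp add: awalk_Cons_iff)
    from J_mon[OF this w(2,3)] show ?thesis by (simp add: True)
  next
    case False
    show ?thesis by (rule J_null[OF eqv_right0[OF mon_adj_P[OF w(2)] S_mon[OF e w(1) False]]])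
  qed
  then show "S e * (mon u p * poly_adj (mon u' q)) \<in> J" by (simp add: mult.assoc)
qed (simp add: e)

text \<open>
  This is where heredity enters: if \<open>\<alpha>\<close> is the vertex \<open>w\<close> in \<open>H\<close> and \<open>e\<close> leaves \<open>w\<close>, then
  \<open>S\<^sub>e\<^sup>* S\<^sub>\<beta>\<^sup>* = (S\<^sub>\<beta> S\<^sub>e)\<^sup>*\<close> belongs to the ideal because \<open>e\<close> ends in \<open>H\<close>.
\<close>

lemma J_left_S_adj: assumes e: "e \<in> arcs E" and x: "x \<in> J" shows "poly_adj (S e) * x \<in> J"
proof (rule J_left_gen[OF _ _ x])
  fix u p w u' q assume w: "awalk u p w" "awalk u' q w" "w \<in> H"
  have "poly_adj (S e) * mon u p * poly_adj (mon u' q) \<in> J"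
  proof (cases p)
    case Nil
    then have u: "u = w" "w \<in> verts E" using w by (auto simp: awalk_Nil_iff)
    show ?thesis
    proof (cases "tail E e = w")
      case True
      let ?h = "head E e"
      have h: "?h \<in> H" "awalk ?h [] ?h" "awalk w [e] ?h"
        using H_arc[OF e] True w e by (auto simp: awalk_simps)
      have q: "awalk u' (q @ [e]) ?h" using w h by (auto simp: awalk_append_iff)
      have Vs: "poly_adj (V w) \<in> P" "V w \<in> P" using u by (auto intro: A_adj)
      have "poly_adj (S e) * V w \<simeq> poly_adj (S e) * poly_adj (V w)"
        by (intro eqv_left eqv_sym[OF V_sa]) (use e u in auto)
      also have "\<dots> = poly_adj (V w * S e)" by (simp add: poly.adj_mult)
      also have "\<dots> \<simeq> poly_adj (S e)" using eqv_adj[OF V_S[OF e]] True by simp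
      finally have "poly_adj (S e) * V w * poly_adj (mon u' q) \<simeq> poly_adj (S e) * poly_adj (mon u' q)"
        by (rule eqv_right[OF mon_adj_P[OF w(2)]])
      also have "\<dots> = poly_adj (mon u' q * S e)" by (simp add: poly.adj_mult)
      also have "\<dots> \<simeq> poly_adj (mon u' q * mon w [e])"
        by (intro eqv_adj eqv_left eqv_sym[OF mon_single] mon_P[OF w(2)] e)
      also have "\<dots> \<simeq> poly_adj (mon u' (q @ [e]))" by (intro eqv_adj mon_append[OF w(2) h(3)])
      also have "\<dots> \<simeq> poly_adj (mon u' (q @ [e]) * V ?h)"
        by (rule eqv_adj[OF eqv_sym[OF mon_V[OF q]]])
      also have "\<dots> = poly_adj (V ?h) * poly_adj (mon u' (q @ [e]))" by (simp add: poly.adj_mult)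
      also have "\<dots> \<simeq> V ?h * poly_adj (mon u' (q @ [e]))"
        by (intro eqv_right mon_adj_P[OF q] V_sa) (use e in simp)
      finally have *: "poly_adj (S e) * V w * poly_adj (mon u' q) \<simeq> mon ?h [] * poly_adj (mon u' (q @ [e]))"
        by simp
      show ?thesis using J_eqv[OF J_mon[OF h(2) q h(1)] eqv_sym[OF *]] by (simp add: Nil u)
    next
      case False
      have "poly_adj (S e) * V w \<simeq> poly_adj (S e) * poly_adj (V w)"
        by (intro eqv_left eqv_sym[OF V_sa]) (use e u in auto)
      also have "\<dots> = poly_adj (V w * S e)" by (simp add: poly.adj_mult)
      also have "\<dots> \<simeq> 0" by (rule eqv_adj0[OF V_S0[OF e u(2)]]) (use False in simp)
      finally show ?thesis using J_null[OF eqv_right0[OF mon_adj_P[OF w(2)]]] by (simp add: Nil u)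
    qed
  next
    case (Cons f p')
    then have f: "f \<in> arcs E" "awalk (head E f) p' w" using w by (auto simp: awalk_Cons_iff)
    show ?thesis
    proof (cases "e = f")
      case True
      show ?thesis unfolding Cons True mon.simps
        by (rule J_eqv[OF J_mon[OF f(2) w(2,3)] eqv_sym[OF eqv_right[OF mon_adj_P[OF w(2)] S_adj_mon[OF f]]]])
    next
      case False
      show ?thesis unfolding Cons mon.simps
        by (rule J_null[OF eqv_right0[OF mon_adj_P[OF w(2)] S_adj_mon0[OF e f(1) False mon_P[OF f(2)]]]])
    qed
  qed
  then show "poly_adj (S e) * (mon u p * poly_adj (mon u' q)) \<in> J" by (simp add: mult.assoc)
qed (simp add: e)

lemma J_left: assumes "a \<in> P" "x \<in> J" shows "a * x \<in> J"
proof -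
  have "\<forall>x\<in>J. a * x \<in> J \<and> poly_adj a * x \<in> J"
    using assms(1)
  proof (induction a rule: star_polys_induct)
    case zero then show ?case by (simp add: poly.adj_zero J_zero)
  next
    case (add p q) then show ?case by (simp add: poly.adj_add distrib_right J_add)
  next
    case (scale c p)
    have "scalar c * p * x = scalar c * (p * x)" "poly_adj (scalar c * p) * x = scalar (cnj c) * (poly_adj p * x)" for x
      by (simp_all add: mult.assoc poly.adj_mult poly.adj_k poly.k_left_comm)
    then show ?case using scale by (simp add: J_scale)
  next
    case (mult p q) then show ?case by (simp add: poly.adj_mult mult.assoc)
  next
    case (gen g)
    show ?case
    proof (cases g)
      case (Inl v)
      then have v: "v \<in> verts E" using gen by auto
      have "poly_adj (V v) * x \<in> J" if "x \<in> J" for x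
        by (rule J_eqv[OF J_left_V[OF v that] eqv_sym[OF eqv_right[OF J_P[OF that] V_sa[OF v]]]])
      then show ?thesis using J_left_V[OF v] Inl by simp
    next
      case (Inr e)
      then show ?thesis using gen J_left_S J_left_S_adj by auto
    qed
  next
    case (adj p) then show ?case by (simp add: poly.adj_adj)
  qed
  then show ?thesis using assms(2) by blast
qed

sublocale star_ideal scalar poly_adj P U J
  by unfold_locales (auto intro: J_P J_zero J_add J_scale J_left J_adj)

lemma V_J: assumes "w \<in> H" shows "V w \<in> J"
proof -
  have w: "awalk w [] w" "w \<in> verts E" using assms H_verts by (auto simp: awalk_Nil_iff)
  have "V w * poly_adj (V w) \<simeq> V w"
    using eqv_trans[OF eqv_left[OF V_P V_sa] V_idem] w by blast
  then show ?thesis using J_eqv[OF J_mon[OF w(1) w(1) assms]] by simp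
qed

lemma S_J: assumes "e \<in> arcs E" "head E e \<in> H" shows "S e \<in> J"
  using J_eqv[OF J_left[OF S_P V_J] S_V] assms by blast

text \<open>
  Only the first edge of a path \<open>\<alpha>\<close> survives in \<open>S\<^sub>g\<^sup>* S\<^sub>\<alpha>\<close>. Edges leaving \<open>H\<close> must be excluded because of
  the paths of length zero.
\<close>

lemma J_finite_support:
  "j \<in> J \<Longrightarrow> \<exists>Y. finite Y \<and> (\<forall>g\<in>arcs E - Y. tail E g \<notin> H \<longrightarrow> poly_adj (S g) * j \<simeq> 0)"
proof (induction rule: J.induct)
  case (J_mon u p w u' q)
  let ?Y = "if p = [] then {} else {hd p}"
  have "poly_adj (S g) * (mon u p * poly_adj (mon u' q)) \<simeq> 0"
    if g: "g \<in> arcs E - ?Y" "tail E g \<notin> H" for g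
  proof -
    have "poly_adj (S g) * mon u p \<simeq> 0"
    proof (cases p)
      case Nil
      then have "u = w" using J_mon by (simp add: awalk_Nil_iff)
      then show ?thesis using g J_mon(3) by (intro S_adj_mon_tail[OF _ J_mon(1)]) auto
    next
      case (Cons f p')
      then have "f \<in> arcs E" "awalk (head E f) p' w" "g \<noteq> f" using J_mon(1) g by (auto simp: awalk_Cons_iff)
      then show ?thesis using g S_adj_mon0[OF _ _ _ mon_P] Cons by simp
    qed
    from eqv_right0[OF mon_adj_P[OF J_mon(2)] this] show ?thesis by (simp add: mult.assoc)
  qed
  then show ?case by (intro exI[of _ ?Y]) auto
next
  case J_zero then show ?case by (intro exI[of _ "{}"]) (auto intro: eqv_refl A_zero)
next
  case (J_add x y)
  then obtain Y Z where "finite Y" "finite Z"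
    and Y: "\<And>g. g \<in> arcs E - Y \<Longrightarrow> tail E g \<notin> H \<Longrightarrow> poly_adj (S g) * x \<simeq> 0"
    and Z: "\<And>g. g \<in> arcs E - Z \<Longrightarrow> tail E g \<notin> H \<Longrightarrow> poly_adj (S g) * y \<simeq> 0" by metis
  moreover have "poly_adj (S g) * (x + y) \<simeq> 0" if "g \<in> arcs E - (Y \<union> Z)" "tail E g \<notin> H" for g
    using eqv_add[OF Y[of g] Z[of g]] that by (simp add: distrib_left)
  ultimately show ?case by (intro exI[of _ "Y \<union> Z"]) auto
next
  case (J_scale x c)
  then obtain Y where "finite Y"
    and Y: "\<And>g. g \<in> arcs E - Y \<Longrightarrow> tail E g \<notin> H \<Longrightarrow> poly_adj (S g) * x \<simeq> 0" by metis
  moreover have "poly_adj (S g) * (scalar c * x) \<simeq> 0" if "g \<in> arcs E - Y" "tail E g \<notin> H" for g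
    using eqv_scale[OF Y[OF that], of c] by (simp add: poly.k_left_comm[of "poly_adj (S g)"])
  ultimately show ?case by (intro exI[of _ Y]) auto
next
  case (J_eqv x y)
  then obtain Y where "finite Y"
    and Y: "\<And>g. g \<in> arcs E - Y \<Longrightarrow> tail E g \<notin> H \<Longrightarrow> poly_adj (S g) * x \<simeq> 0" by metis
  moreover have "poly_adj (S g) * y \<simeq> 0" if "g \<in> arcs E - Y" "tail E g \<notin> H" for g
    using eqv_trans[OF eqv_left[OF Sadj_P eqv_sym[OF J_eqv(2)]] Y[OF that]] that by simp
  ultimately show ?case by (intro exI[of _ Y]) auto
qed

end

section \<open>Admissible inclusions\<close>

lemma graph_alg_of_directed: "directed_graph E \<Longrightarrow> graph_alg E"
  by (simp add: directed_graph_def graph_alg_def)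

locale admissible_inclusion =
  fixes F E :: "('v, 'e) pre_digraph"
  assumes adm: "admissible F E"
begin

lemma F_sub: "verts F \<subseteq> verts E" "arcs F \<subseteq> arcs E" "head F = head E" "tail F = tail E"
  using adm by (auto simp: admissible_def subgraph_def compatible_def)

lemma arcs_F: "e \<in> arcs F \<longleftrightarrow> e \<in> arcs E \<and> head E e \<in> verts F"
  using adm by (auto simp: admissible_def)

abbreviation H where "H \<equiv> verts E - verts F"

sublocale F: graph_alg F
  using adm by (intro graph_alg_of_directed) (simp add: admissible_def)

lemma H_arc: assumes "e \<in> arcs E" "tail E e \<in> H" shows "head E e \<in> H"
proof -
  interpret E: graph_alg E
    using adm by (intro graph_alg_of_directed) (simp add: admissible_def)
  have "E.awalk (tail E e) [e] (head E e)" using assms by (simp add: E.awalk_simps)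
  then have "(tail E e, [e]) \<in> paths E" "path_range E (tail E e, [e]) = head E e"
    by (auto simp: paths_def path_range_def)
  then show ?thesis using adm assms unfolding admissible_def hereditary_def path_source_def
    by (metis fst_conv)
qed

sublocale E: hereditary_set E H
proof -
  interpret E: graph_alg E
    using adm by (intro graph_alg_of_directed) (simp add: admissible_def)
  show "hereditary_set E H" by unfold_locales (use H_arc in auto)
qed

text \<open>
  The assignment that defines the canonical surjection: generators outside the subgraph become \<open>0\<close>.
\<close>

definition restrict_gen :: "'v + 'e \<Rightarrow> ('v + 'e) star_poly" where
  "restrict_gen g = (if g \<in> F.gens then poly_gen g else 0)"

abbreviation rest where "rest \<equiv> subst restrict_gen"

lemma rest_V: "rest (vertex_var v) = (if v \<in> verts F then vertex_var v else 0)"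
  and rest_S: "rest (edge_var e) = (if e \<in> arcs F then edge_var e else 0)"
  by (auto simp: subst_gen restrict_gen_def)

lemma out_arcs_F: "out_arcs F v = {e \<in> out_arcs E v. head E e \<in> verts F}"
  by (auto simp: out_arcs_def arcs_F F_sub)

lemma out_arcs_H: "v \<in> H \<Longrightarrow> out_arcs F v = {}"
  using F.wellformed by (auto simp: F_sub(4))

lemma regular_F: assumes "regular_vertex E v" "v \<in> verts F" shows "regular_vertex F v"
proof -
  have "\<not> head E ` out_arcs E v \<subseteq> H" using adm assms unfolding admissible_def saturated_def by blast
  then have "out_arcs F v \<noteq> {}" using assms by (auto simp: out_arcs_F)
  moreover have "out_arcs F v \<subseteq> out_arcs E v" by (auto simp: out_arcs_F)
  ultimately show ?thesis using assms by (auto simp: regular_vertex_def intro: finite_subset)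
qed

text \<open>
  Condition (A3): a vertex with finitely many but some edges into the subgraph emits only finitely
  many edges into the complement.
\<close>

lemma regular_E: assumes "regular_vertex F v" shows "regular_vertex E v"
proof -
  have v: "v \<in> verts E" and fin: "finite {e \<in> out_arcs E v. head E e \<in> verts F}"
    and ne: "{e \<in> out_arcs E v. head E e \<in> verts F} \<noteq> {}"
    using assms F_sub(1) unfolding regular_vertex_def out_arcs_F by blast+
  have "finite {e \<in> out_arcs E v. head E e \<in> H}"
    using adm v fin ne unfolding admissible_def by blast
  then have "finite ({e \<in> out_arcs E v. head E e \<in> verts F} \<union> {e \<in> out_arcs E v. head E e \<in> H})"
    using fin by simp
  moreover have "out_arcs E v \<subseteq> {e \<in> out_arcs E v. head E e \<in> verts F} \<union> {e \<in> out_arcs E v. head E e \<in> H}"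
    by (auto simp: E.head_in_verts)
  ultimately show ?thesis using v ne by (auto simp: regular_vertex_def intro: finite_subset)
qed

lemma rest_relation: assumes "r \<in> graph_relations E" shows "F.U (rest r) = 0"
proof -
  have Fzero: "F.U 0 = 0" by (rule F.N_zero)
  show ?thesis using assms
  proof (cases rule: graph_relations_cases)
    case (idem v)
    then show ?thesis using F.U_relation[OF graph_relationsI(1)[of v F]] Fzero
      by (simp add: subst_simps(1-5,7-) rest_V)
  next
    case (sa v)
    then show ?thesis using F.U_relation[OF graph_relationsI(2)[of v F]] Fzero
      by (simp add: subst_simps(1-5,7-) rest_V poly.adj_zero)
  next
    case (orth v w)
    then show ?thesis using F.U_relation[OF graph_relationsI(3)[of v F w]] Fzero
      by (simp add: subst_simps(1-5,7-) rest_V)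
  next
    case (pisom e)
    then show ?thesis using F.U_relation[OF graph_relationsI(4)[of e F]] Fzero
      by (simp add: subst_simps(1-5,7-) rest_S poly.adj_zero)
  next
    case (GA1 e)
    then show ?thesis using F.U_relation[OF graph_relationsI(5)[of e F]] Fzero
      by (auto simp: subst_simps(1-5,7-) rest_S rest_V poly.adj_zero arcs_F F_sub)
  next
    case (GA1' e f)
    then show ?thesis using F.U_relation[OF graph_relationsI(6)[of e F f]] Fzero
      by (simp add: subst_simps(1-5,7-) rest_S poly.adj_zero)
  next
    case (GA2 v)
    have fin: "finite (out_arcs E v)" using GA2 by (simp add: regular_vertex_def)
    have "rest r = (\<Sum>e\<in>out_arcs E v. if e \<in> arcs F then edge_var e * poly_adj (edge_var e) else 0)
        - (if v \<in> verts F then vertex_var v else 0)"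
      by (simp add: GA2 subst_simps(1-5,7-) rest_S rest_V) (intro sum.cong, auto simp: poly.adj_zero)
    also have "(\<Sum>e\<in>out_arcs E v. if e \<in> arcs F then edge_var e * poly_adj (edge_var e) else 0)
        = (\<Sum>e\<in>out_arcs F v. edge_var e * poly_adj (edge_var e))"
      using fin by (intro sum.mono_neutral_cong_right) (auto simp: arcs_F F_sub)
    finally have r: "rest r = (\<Sum>e\<in>out_arcs F v. edge_var e * poly_adj (edge_var e))
        - (if v \<in> verts F then vertex_var v else 0)" .
    show ?thesis
    proof (cases "v \<in> verts F")
      case True
      then show ?thesis using F.U_relation[OF graph_relationsI(7)[OF regular_F[OF GA2(1) True]]] by (simp add: r)
    next
      case False
      then have "out_arcs F v = {}" using GA2 by (intro out_arcs_H) (auto simp: regular_vertex_def)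
      then show ?thesis using False Fzero by (simp add: r)
    qed
  next
    case (GA3 e)
    have "tail E e \<in> verts F" if "e \<in> arcs F" using F.tail_in_verts[OF that] by (simp add: F_sub)
    then show ?thesis using GA3 F.U_relation[OF graph_relationsI(8)[of e F]] Fzero
      by (auto simp: subst_simps(1-5,7-) rest_S rest_V poly.adj_zero F_sub)
  qed
qed

sublocale pi: universal_hom E.gens "graph_relations E" F.gens "graph_relations F" restrict_gen
  by unfold_locales
    (auto simp: restrict_gen_def star_polys_gen star_polys_zero intro: rest_relation)

lemma F_P_sub: "p \<in> F.P \<Longrightarrow> p \<in> E.P"
  using star_polys_mono[of F.gens E.gens] F_sub by auto

abbreviation D where "D \<equiv> E.quotient_norm"

text \<open>
  Apart from (GA2), the relations of the subgraph are relations of the whole graph. In (GA2) the sums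
  differ by the \<open>S\<^sub>e S\<^sub>e\<^sup>*\<close> with \<open>e\<close> ending in \<open>H\<close>, which lie in the ideal.
\<close>

lemma D_relation: assumes "r \<in> graph_relations F" shows "D r = 0"
proof -
  have ER: "D r = 0" if "r \<in> graph_relations E" for r
    using E.quotient_norm_le_N[of r] E.quotient_norm_nonneg[of r] E.U_relation[OF that] that E.R_sub by force
  show ?thesis using assms
  proof (cases rule: graph_relations_cases)
    case (GA2 v)
    have v: "regular_vertex E v" by (rule regular_E[OF GA2(1)])
    have fin: "finite (out_arcs E v)" using v by (simp add: regular_vertex_def)
    let ?s = "\<lambda>e. edge_var e * poly_adj (edge_var e) :: ('v + 'e) star_poly"
    have sP: "?s e \<in> E.P" if "e \<in> out_arcs E v" for e using that by (auto intro: E.A_mult)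
    have "(\<Sum>e\<in>out_arcs E v. ?s e) = (\<Sum>e\<in>out_arcs F v. ?s e) + (\<Sum>e\<in>out_arcs E v - out_arcs F v. ?s e)"
      using fin by (subst add.commute, intro sum.subset_diff) (auto simp: out_arcs_F)
    then have r: "r = ((\<Sum>e\<in>out_arcs E v. ?s e) - vertex_var v) - (\<Sum>e\<in>out_arcs E v - out_arcs F v. ?s e)"
      by (simp add: GA2)
    have sum: "(\<Sum>e\<in>A. ?s e) \<in> E.J" if "A \<subseteq> out_arcs E v - out_arcs F v" for A
      using that
    proof (induction A rule: infinite_finite_induct)
      case (insert e A)
      then have e: "e \<in> arcs E" "head E e \<in> H" using E.head_in_verts by (auto simp: out_arcs_F)
      then show ?case using insert E.J_add E.J_right[OF E.Sadj_P[OF e(1)] E.S_J[OF e]] by auto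
    qed (auto intro: E.J_zero)
    have "(\<Sum>e\<in>out_arcs E v. ?s e) - vertex_var v \<in> E.J"
      using v by (intro E.J_null) (auto simp: E.eqv_def E.U_relation graph_relationsI
        intro!: E.A_diff E.A_sum sP E.A_zero simp: regular_vertex_def)
    then have "r \<in> E.J" unfolding r by (rule E.J_diff) (rule sum, simp)
    then show ?thesis by (rule E.quotient_norm_J)
  qed (use F_sub in \<open>auto intro!: ER graph_relationsI\<close>)
qed

lemma D_le_F: assumes "p \<in> F.P" shows "D p \<le> F.U p"
proof (rule F.U_upper[OF _ assms])
  interpret D: cstar_seminormed scalar poly_adj E.P D by (rule E.quotient_norm_cstar)
  have "cstar_seminormed scalar poly_adj F.P D"
    by (rule poly.cstar_seminormedI)
      (auto simp: F.A_closed D.N_nonneg D.N_scale D.N_triangle D.N_mult D.N_cstar F_P_sub)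
  then show "D \<in> F.seminorms" by (simp add: F.seminorms_def cstar_seminorm_iff D_relation)
qed

lemma D_rest: assumes "p \<in> E.P" shows "D (p - rest p) = 0"
proof -
  interpret D: cstar_seminormed scalar poly_adj E.P D by (rule E.quotient_norm_cstar)
  have null_add: "D (p + q) = 0" if "p \<in> E.P" "q \<in> E.P" "D p = 0" "D q = 0" for p q
    using D.N_triangle[of p q] D.N_nonneg[of "p + q"] that by (simp add: E.A_add)
  have null_mult: "D (p * q) = 0" if "p \<in> E.P" "q \<in> E.P" "D p = 0 \<or> D q = 0" for p q
    using D.N_mult[of p q] D.N_nonneg[of "p * q"] that E.A_mult by force
  have rP: "rest p \<in> E.P" if "p \<in> E.P" for p using pi.subst_P[OF that] F_P_sub by blast
  show ?thesis using assms
  proof (induction p rule: star_polys_induct)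
    case zero then show ?case by (simp add: subst_zero D.N_zero)
  next
    case (add p q)
    have "D ((p - rest p) + (q - rest q)) = 0" using add by (intro null_add E.A_diff rP)
    then show ?case by (simp add: subst_add algebra_simps)
  next
    case (scale c p)
    then show ?case using D.N_scale[of "p - rest p" c] E.A_diff[OF scale(1) rP[OF scale(1)]]
      by (simp add: subst_scale right_diff_distrib)
  next
    case (mult p q)
    have "D ((p - rest p) * q + rest p * (q - rest q)) = 0"
      using mult by (intro null_add null_mult E.A_mult E.A_diff rP) auto
    then show ?case by (simp add: subst_mult algebra_simps)
  next
    case (gen g)
    show ?case
    proof (cases "g \<in> F.gens")
      case True then show ?thesis by (simp add: subst_gen restrict_gen_def D.N_zero)
    next
      case False
      then have "poly_gen g \<in> E.J" using gen E.V_J E.S_J arcs_F E.head_in_verts by (cases g) auto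
      then show ?thesis using False by (simp add: subst_gen restrict_gen_def E.quotient_norm_J)
    qed
  next
    case (adj p)
    then show ?case using D.N_adj[of "p - rest p"] E.A_diff[OF adj(1) rP[OF adj(1)]]
      by (simp add: subst_adj poly.adj_diff)
  qed
qed

text \<open>
  So the distance to the ideal is dominated by the norm in the quotient graph algebra. This is the
  inequality that carries both the kernel and the surjectivity statement.
\<close>

lemma D_le: assumes "p \<in> E.P" shows "D p \<le> F.U (rest p)"
proof -
  interpret D: cstar_seminormed scalar poly_adj E.P D by (rule E.quotient_norm_cstar)
  have rP: "rest p \<in> F.P" using pi.subst_P[OF assms] .
  have "D p \<le> D (p - rest p) + D (rest p)"
    using D.N_triangle[of "p - rest p" "rest p"] F_P_sub[OF rP] assms by (simp add: E.A_diff)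
  then show ?thesis using D_rest[OF assms] D_le_F[OF rP] by simp
qed

lemma rest_F: "p \<in> F.P \<Longrightarrow> rest p = p"
  by (induction p rule: star_polys_induct) (auto simp: subst_simps restrict_gen_def)

lemma rest_mon: "E.awalk u p w \<Longrightarrow> w \<notin> verts F \<Longrightarrow> rest (E.mon u p) = 0"
  by (induction p arbitrary: u) (auto simp: E.awalk_simps subst_mult rest_V)

lemma rest_J: "j \<in> E.J \<Longrightarrow> F.U (rest j) = 0"
proof (induction rule: E.J.induct)
  case (J_mon u p w u' q)
  then show ?case by (simp add: subst_mult rest_mon F.N_zero)
next
  case (J_add x y)
  then show ?case using F.U_null_add[of "rest x" "rest y"] E.J_P pi.subst_P by (simp add: subst_add)
next
  case (J_scale x c)
  then show ?case using F.N_scale[of "rest x" c] E.J_P pi.subst_P by (simp add: subst_scale)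
next
  case (J_eqv x y)
  have P: "rest x \<in> F.P" "rest y \<in> F.P" using J_eqv pi.subst_P by (auto simp: E.eqv_def)
  have "F.U (rest x - rest y) \<le> 0"
    using pi.U_subst_le[of "x - y"] J_eqv(2) by (auto simp: E.eqv_def subst_diff E.A_diff)
  then show ?case using F.N_abs_diff[OF P] J_eqv F.N_nonneg[OF P(2)] by simp
qed (simp add: subst_zero F.N_zero)

text \<open>
  If the image tends to \<open>0\<close>, so does the distance to the ideal, by \<open>D_le\<close>.
\<close>

theorem kernel_pi:
  assumes X: "X \<in> E.CS" and null: "F.L (\<lambda>n. rest (X n)) = 0"
  obtains Y where "\<And>n. Y n \<in> E.J" "Y \<in> E.CS" "E.L (X - Y) = 0"
proof -
  have "\<exists>j\<in>E.J. E.U (X n - j) < D (X n) + inverse (Suc n)" for n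
    using E.quotient_norm_less[of "X n" "D (X n) + inverse (Suc n)"] by auto
  then obtain Y where Y: "\<And>n. Y n \<in> E.J" "\<And>n. E.U (X n - Y n) < D (X n) + inverse (Suc n)" by metis
  have "(\<lambda>n. F.U (rest (X n)) + inverse (real (Suc n))) \<longlonglongrightarrow> 0 + 0"
    using F.L_lim[OF pi.CS_subst[OF X]] null by (intro tendsto_add LIMSEQ_inverse_real_of_nat) simp
  then have lim: "(\<lambda>n. F.U (rest (X n)) + inverse (real (Suc n))) \<longlonglongrightarrow> 0" by simp
  have XY: "(X - Y) n \<in> E.P" for n using E.CS_P[OF X] E.J_P[OF Y(1)] by (simp add: E.A_diff)
  have "(\<lambda>n. E.U ((X - Y) n)) \<longlonglongrightarrow> 0"
  proof (rule tendsto_sandwich[OF _ _ tendsto_const lim])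
    show "eventually (\<lambda>n. 0 \<le> E.U ((X - Y) n)) sequentially"
      by (intro always_eventually allI E.N_nonneg XY)
    have "E.U ((X - Y) n) \<le> F.U (rest (X n)) + inverse (real (Suc n))" for n
      using Y(2)[of n] D_le[OF E.CS_P[OF X]] by (simp add: fun_diff_def) (meson add_right_mono less_imp_le order_trans)
    then show "eventually (\<lambda>n. E.U ((X - Y) n) \<le> F.U (rest (X n)) + inverse (real (Suc n))) sequentially" by simp
  qed
  note Z = E.null_seq_CS[OF XY this]
  have "X - (X - Y) = Y" by (rule ext) simp
  then have "Y \<in> E.CS" using E.S.A_diff[OF X Z(1)] by (simp only:)
  then show thesis using that Y(1) Z(2) by blast
qed

text \<open>
  Pass to a subsequence with increments below \<open>2\<^bsup>-k\<^esup>\<close>. By \<open>D_le\<close> each increment can be corrected by an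
  element of the ideal, invisible in the quotient, so that it becomes as small upstairs; the
  corrected series converges.
\<close>

theorem surjective_pi:
  assumes Y: "Y \<in> F.CS"
  obtains X where "X \<in> E.CS" "F.L ((\<lambda>n. rest (X n)) - Y) = 0"
proof -
  have "\<exists>M. \<forall>m\<ge>M. \<forall>n\<ge>M. F.U (Y m - Y n) < (1/2) ^ k" for k
    by (rule F.CS_cauchy[OF Y]) simp
  then obtain M where M: "\<And>k m n. m \<ge> M k \<Longrightarrow> n \<ge> M k \<Longrightarrow> F.U (Y m - Y n) < (1/2) ^ k" by metis
  \<comment> \<open>summing the thresholds makes \<open>r\<close> monotone, above \<open>M k\<close> and above \<open>k\<close>\<close>
  define r where "r k = k + (\<Sum>i\<le>k. M i)" for k
  have r: "k \<le> r k" "M k \<le> r k" "r k \<le> r (Suc k)" for k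
    by (auto simp: r_def) (metis atMost_iff finite_atMost le_refl le_add2 order_trans member_le_sum zero_le)
  let ?d = "\<lambda>k. Y (r (Suc k)) - Y (r k)"
  have YP: "Y n \<in> F.P" for n by (rule F.CS_P[OF Y])
  have dP: "?d k \<in> F.P" for k by (intro F.A_diff YP)
  have "\<exists>j\<in>E.J. E.U (?d k - j) < (1/2) ^ k" for k
  proof -
    \<comment> \<open>the increments are polynomials over the subgraph, on which \<open>D\<close> is below the norm there\<close>
    have "D (?d k) < (1/2) ^ k"
      using D_le_F[OF dP[of k]] M[of k "r (Suc k)" "r k"] r[of k] by linarith
    then show ?thesis by (auto elim: E.quotient_norm_less)
  qed
  then obtain j where j: "\<And>k. j k \<in> E.J" "\<And>k. E.U (?d k - j k) < (1/2) ^ k" by metis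
  define X where "X k = Y (r 0) + (\<Sum>i<k. ?d i - j i)" for k
  have djP: "?d i - j i \<in> E.P" for i by (intro E.A_diff F_P_sub[OF dP] E.J_P j)
  have XP: "X k \<in> E.P" for k unfolding X_def by (intro E.A_add E.A_sum djP F_P_sub YP)
  have step: "E.U (X (n + m) - X n) \<le> 2 * (1/2) ^ n" for n m
  proof -
    have "E.U (X (n + m) - X n) \<le> (\<Sum>i<m. (1/2) ^ (n + i))"
    proof (induction m)
      case 0 then show ?case by (simp add: E.N_zero)
    next
      case (Suc m)
      have "E.U (X (n + Suc m) - X n) \<le> E.U (X (n + Suc m) - X (n + m)) + E.U (X (n + m) - X n)"
        by (intro E.N_diff_triangle XP)
      also have "X (n + Suc m) - X (n + m) = ?d (n + m) - j (n + m)" by (simp add: X_def)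
      also have "E.U \<dots> \<le> (1/2) ^ (n + m)" using j(2)[of "n + m"] by simp
      finally show ?case using Suc by simp
    qed
    also have "\<dots> = (1/2) ^ n * (\<Sum>i<m. (1/2) ^ i)" by (simp add: power_add sum_distrib_left)
    also have "\<dots> \<le> (1/2) ^ n * (2 :: real)"
      by (intro mult_left_mono) (auto simp: sum_gp_strict)
    finally show ?thesis by simp
  qed
  have XCS: "X \<in> E.CS"
  proof (rule E.CS_I)
    fix e :: real assume e: "0 < e"
    have "(\<lambda>n. 2 * (1/2) ^ n :: real) \<longlonglongrightarrow> 2 * 0"
      by (intro tendsto_mult_left LIMSEQ_power_zero) auto
    then have "eventually (\<lambda>n. 2 * (1/2) ^ n < e) sequentially"
      by (rule order_tendstoD(2)) (use e in simp)
    then obtain m where m: "2 * (1/2) ^ n < e" if "n \<ge> m" for n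
      by (auto simp: eventually_sequentially)
    have "E.U (X k - X l) < e" if "m \<le> l" "l \<le> k" for k l
      using step[of l "k - l"] m[of l] that by simp
    then have "\<forall>k\<ge>m. \<forall>l\<ge>m. E.U (X k - X l) < e"
      using E.N_minus_commute[OF XP XP] by (metis nle_le)
    then show "\<exists>m. \<forall>k\<ge>m. \<forall>l\<ge>m. E.U (X k - X l) < e" by blast
  qed (rule XP)
  have restX: "F.U (rest (X k) - Y (r k)) = 0" for k
  proof (induction k)
    case 0 then show ?case using rest_F[OF YP] by (simp add: X_def F.N_zero)
  next
    case (Suc k)
    have rP: "rest (X k) \<in> F.P" "rest (j k) \<in> F.P" using pi.subst_P XP E.J_P[OF j(1)] by auto
    have "rest (X (Suc k)) - Y (r (Suc k)) = (rest (X k) - Y (r k)) - rest (j k)"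
      using rest_F[OF YP] by (simp add: X_def subst_add subst_diff)
    then show ?case
      using F.N_diff[OF F.A_diff[OF rP(1) YP[of "r k"]] rP(2)] Suc rest_J[OF j(1)[of k]]
        F.N_nonneg[OF F.A_diff[OF F.A_diff[OF rP(1) YP[of "r k"]] rP(2)]] by simp
  qed
  let ?Z = "(\<lambda>n. rest (X n)) - Y"
  have ZP: "?Z n \<in> F.P" for n using pi.subst_P[OF XP] YP by (simp add: F.A_diff)
  have "(\<lambda>n. F.U (?Z n)) \<longlonglongrightarrow> 0"
  proof (rule LIMSEQ_I)
    fix e :: real assume "0 < e"
    then obtain i where i: "(1/2) ^ i < e" using real_arch_pow_inv[of e "1/2"] by auto
    have "F.U (?Z n) < e" if "n \<ge> M i + i" for n
    proof -
      have "F.U (?Z n) \<le> F.U (rest (X n) - Y (r n)) + F.U (Y (r n) - Y n)"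
        using F.N_diff_triangle[OF pi.subst_P[OF XP[of n]] YP[of "r n"] YP[of n]] by simp
      also have "\<dots> \<le> (1/2) ^ i"
        using restX[of n] M[of i "r n" n] r(1)[of n] that by simp
      finally show ?thesis using i by simp
    qed
    then show "\<exists>m. \<forall>n\<ge>m. norm (F.U (?Z n) - 0) < e"
      using F.N_nonneg[OF ZP] by (intro exI[of _ "M i + i"]) simp
  qed
  note F.null_seq_CS[OF ZP this]
  then show thesis using that XCS by blast
qed

end

section \<open>Functors onto the pointed paths\<close>

locale pointed_functor = E1: graph_alg E1 + E2: graph_alg E2
  for E1 :: "('v, 'e) pre_digraph" and E2 :: "('v, 'd) pre_digraph" +
  fixes f0 :: "'v \<Rightarrow> 'v" and f1 :: "('v, 'e) path \<Rightarrow> ('v, 'd) path"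
  assumes verts_eq: "verts E1 = verts E2"
    and func: "path_functor E1 E2 f0 f1"
    and reflects: "\<lbrakk>\<alpha> \<in> paths E1; \<beta> \<in> paths E1; path_le E2 (f1 \<alpha>) (f1 \<beta>)\<rbrakk> \<Longrightarrow> path_le E1 \<alpha> \<beta>"
    and f0_id: "v \<in> verts E1 \<Longrightarrow> f0 v = v"
    and image: "f1 ` paths E1 = {\<alpha>. pointed_path E2 \<alpha>}"
begin

text \<open>
  The edge list of \<open>f(\<alpha>)\<close>; the source of \<open>f(\<alpha>)\<close> is that of \<open>\<alpha>\<close> since \<open>f\<close> is the identity on vertices.
  For a single edge the list is \<open>fe\<close>.
\<close>

definition fp :: "'v \<Rightarrow> 'e list \<Rightarrow> 'd list" where "fp u p = snd (f1 (u, p))"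

definition fe :: "'e \<Rightarrow> 'd list" where "fe g = fp (tail E1 g) [g]"

abbreviation loop :: "'d \<Rightarrow> bool" where "loop l \<equiv> tail E2 l = head E2 l"

lemma f1_awalk: assumes "E1.awalk u p w" shows "f1 (u, p) = (u, fp u p)" "E2.awalk u (fp u p) w"
proof -
  have *: "f1 (u, p) \<in> paths E2" "path_source (f1 (u, p)) = f0 u" "path_range E2 (f1 (u, p)) = f0 w"
    using func E1.awalk_path(1)[OF assms] E1.awalk_path(2)[OF assms] unfolding path_functor_def
    by (auto simp: path_source_def)
  have f0: "f0 u = u" "f0 w = w" using E1.awalk_verts_in[OF assms] f0_id by auto
  show eq: "f1 (u, p) = (u, fp u p)" using * f0 by (simp add: fp_def path_source_def prod_eq_iff)
  obtain x where x: "E2.awalk u (fp u p) x" using *(1) eq by (auto simp: paths_def)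
  then show "E2.awalk u (fp u p) w" using *(3) f0 E2.awalk_path(2)[OF x] eq by simp
qed

lemma fp_Nil: "u \<in> verts E1 \<Longrightarrow> fp u [] = []"
  using func f0_id unfolding path_functor_def fp_def vertex_path_def by simp

lemma fp_append: assumes "E1.awalk u p w" "E1.awalk w q x" shows "fp u (p @ q) = fp u p @ fp w q"
proof -
  have "f1 (path_concat (u, p) (w, q)) = path_concat (f1 (u, p)) (f1 (w, q))"
    using func E1.awalk_path(1)[OF assms(1)] E1.awalk_path(1)[OF assms(2)] E1.awalk_path(2)[OF assms(1)]
    unfolding path_functor_def path_source_def by (metis fst_conv)
  then show ?thesis by (simp add: fp_def path_concat_def)
qed

lemma fp_prefix:
  assumes p: "E1.awalk u p w" and q: "E1.awalk u q x" and eq: "fp u q = fp u p @ r"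
  obtains r' where "q = p @ r'"
proof -
  have "E2.awalk u (fp u p @ r) x" using f1_awalk(2)[OF q] eq by simp
  then have r: "E2.awalk w r x" using f1_awalk(2)[OF p] by (auto simp: E2.awalk_append_iff)
  have "path_le E2 (f1 (u, p)) (f1 (u, q))"
    unfolding path_le_def f1_awalk(1)[OF p] f1_awalk(1)[OF q] eq
    using E2.awalk_path(1)[OF r] E2.awalk_path(2)[OF f1_awalk(2)[OF p]]
    by (intro bexI[of _ "(w, r)"]) (auto simp: path_source_def path_concat_def)
  then have "path_le E1 (u, p) (u, q)" by (intro reflects E1.awalk_path(1)[OF p] E1.awalk_path(1)[OF q])
  then show thesis using that by (auto simp: path_le_def path_concat_def)
qed

lemma fp_inj: assumes "E1.awalk u p w" "E1.awalk u q x" "fp u p = fp u q" shows "p = q"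
proof -
  have eq: "fp u q = fp u p @ []" "fp u p = fp u q @ []" using assms(3) by simp_all
  obtain r where r: "q = p @ r" by (rule fp_prefix[OF assms(1,2) eq(1)])
  obtain s where s: "p = q @ s" by (rule fp_prefix[OF assms(2,1) eq(2)])
  have "length q \<le> length p" by (subst s) simp
  then show ?thesis unfolding r by simp
qed

lemma fp_pointed: assumes "E1.awalk u p w" shows "fp u p = [] \<or> \<not> loop (last (fp u p))"
proof -
  have "pointed_path E2 (f1 (u, p))" using image E1.awalk_path(1)[OF assms] by blast
  then show ?thesis using f1_awalk[OF assms] E2.pointed_iff by simp
qed

lemma fp_surj: assumes "E2.awalk u q w" "q = [] \<or> \<not> loop (last q)"
  obtains p where "E1.awalk u p w" "fp u p = q"
proof -
  have "(u, q) \<in> f1 ` paths E1" using assms E2.pointed_iff by (simp add: image)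
  then obtain u' p where p: "(u', p) \<in> paths E1" "f1 (u', p) = (u, q)" by auto
  then obtain x where x: "E1.awalk u' p x" by (auto simp: paths_def)
  then have u: "u' = u" "fp u p = q" "E2.awalk u q x" using f1_awalk[OF x] p by auto
  then have "x = w" using assms E2.awalk_path(2) by metis
  then show thesis using that x u by simp
qed

lemma awalk_edge: "g \<in> arcs E1 \<Longrightarrow> E1.awalk (tail E1 g) [g] (head E1 g)"
  by (simp add: E1.awalk_simps)

lemma fe_awalk: "g \<in> arcs E1 \<Longrightarrow> E2.awalk (tail E1 g) (fe g) (head E1 g)"
  unfolding fe_def by (rule f1_awalk(2)[OF awalk_edge])

lemma fe_not_Nil: assumes "g \<in> arcs E1" shows "fe g \<noteq> []"
proof
  assume "fe g = []"
  then have "fp (tail E1 g) [g] = fp (tail E1 g) []" using assms by (simp add: fe_def fp_Nil)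
  moreover have "E1.awalk (tail E1 g) [] (tail E1 g)" using assms by (simp add: E1.awalk_simps)
  ultimately show False using fp_inj[OF awalk_edge[OF assms]] by blast
qed

lemma tail_hd_fe: assumes "g \<in> arcs E1" shows "tail E2 (hd (fe g)) = tail E1 g"
  using fe_awalk[OF assms] fe_not_Nil[OF assms] by (cases "fe g") (auto simp: E2.awalk_simps)

lemma fe_prefix_imp_eq: assumes g: "g \<in> arcs E1" and h: "h \<in> arcs E1" and eq: "fe h = fe g @ r"
  shows "g = h"
proof -
  have t: "tail E1 h = tail E1 g"
    using tail_hd_fe[OF g] tail_hd_fe[OF h] fe_not_Nil[OF g] eq by simp
  obtain r' where "[h] = [g] @ r'"
    using fp_prefix[OF awalk_edge[OF g]] awalk_edge[OF h] eq t unfolding fe_def by metis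
  then show ?thesis by simp
qed

lemma fe_inj: "g \<in> arcs E1 \<Longrightarrow> h \<in> arcs E1 \<Longrightarrow> fe g = fe h \<Longrightarrow> g = h"
  using fe_prefix_imp_eq[of g h "[]"] by simp

text \<open>
  A path \<open>l\<^sub>1 \<dots> l\<^sub>n e\<close> is indecomposable among pointed paths: every proper nonempty prefix ends in a loop.
  So its preimage under \<open>f\<close> is a single edge.
\<close>

lemma edge_exists:
  assumes q: "E2.awalk v (ls @ [e]) w" and ls: "\<And>l. l \<in> set ls \<Longrightarrow> loop l" and e: "\<not> loop e"
  obtains g where "g \<in> arcs E1" "tail E1 g = v" "head E1 g = w" "fe g = ls @ [e]"
proof -
  obtain p where p: "E1.awalk v p w" "fp v p = ls @ [e]"
    using fp_surj[OF q] e by auto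
  have "p \<noteq> []" using p E1.awalk_verts_in(1)[OF p(1)] fp_Nil by auto
  then obtain g p' where gp: "p = g # p'" by (cases p) auto
  have g: "g \<in> arcs E1" "tail E1 g = v" "E1.awalk (head E1 g) p' w"
    using p gp by (auto simp: E1.awalk_Cons_iff)
  have app: "fe g @ fp (head E1 g) p' = ls @ [e]"
    using fp_append[OF awalk_edge[OF g(1)] g(3)] p(2) g(2) gp by (simp add: fe_def)
  have "fp (head E1 g) p' = []"
  proof (rule ccontr)
    assume "fp (head E1 g) p' \<noteq> []"
    then have "set (fe g) \<subseteq> set ls"
      using app by (metis append_butlast_last_id append_assoc butlast_snoc set_append sup_ge1)
    then have "loop (last (fe g))" using ls fe_not_Nil[OF g(1)] last_in_set by blast
    then show False using fp_pointed[OF awalk_edge[OF g(1)]] fe_not_Nil[OF g(1)] by (simp add: fe_def)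
  qed
  then have "fe g = ls @ [e]" "fp (head E1 g) p' = fp (head E1 g) []"
    using app g fp_Nil by auto
  moreover have "p' = []"
    by (rule fp_inj[OF g(3) _ calculation(2)]) (use g in \<open>simp add: E1.awalk_simps\<close>)
  ultimately show thesis using that g p(1) gp by (simp add: E1.awalk_simps)
qed

text \<open>
  Cut \<open>f(g)\<close> after its first edge that is no loop. The initial part is the image of an edge, by
  \<open>edge_exists\<close>, and this edge is a prefix of \<open>g\<close> since \<open>f\<close> reflects prefixes.
\<close>

lemma fe_form:
  assumes g: "g \<in> arcs E1"
  obtains ls e where "fe g = ls @ [e]" "\<And>l. l \<in> set ls \<Longrightarrow> loop l" "\<not> loop e"
proof -
  define ls where "ls = takeWhile loop (fe g)"
  have nl: "\<not> loop (last (fe g))"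
    using fp_pointed[OF awalk_edge[OF g]] fe_not_Nil[OF g] by (simp add: fe_def)
  have "dropWhile loop (fe g) \<noteq> []"
  proof
    assume "dropWhile loop (fe g) = []"
    then have "\<forall>x\<in>set (fe g). loop x" by (simp add: dropWhile_eq_Nil_conv)
    then show False using nl last_in_set[OF fe_not_Nil[OF g]] by blast
  qed
  then obtain e r where er: "dropWhile loop (fe g) = e # r" by (cases "dropWhile loop (fe g)") auto
  have e: "\<not> loop e" using er hd_dropWhile[of loop "fe g"] by force
  have ls: "loop l" if "l \<in> set ls" for l using that set_takeWhileD unfolding ls_def by fast
  have fe: "fe g = (ls @ [e]) @ r" using er takeWhile_dropWhile_id[of loop "fe g"] by (simp add: ls_def)
  then have "E2.awalk (tail E1 g) ((ls @ [e]) @ r) (head E1 g)" using fe_awalk[OF g] by simp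
  then obtain x where "E2.awalk (tail E1 g) (ls @ [e]) x" unfolding E2.awalk_append_iff by blast
  from edge_exists[OF this ls e] obtain h where h: "h \<in> arcs E1" "fe h = ls @ [e]" by blast
  then have "h = g" using fe_prefix_imp_eq[OF h(1) g, of r] fe by simp
  then show thesis using that h ls e by blast
qed

lemma arc_of_list: "e \<in> set (fe g) \<Longrightarrow> g \<in> arcs E1 \<Longrightarrow> e \<in> arcs E2"
  using fe_awalk by (auto simp: E2.awalk_def)

text \<open>
  The preimages of the two kinds of generating pointed paths: \<open>edge1 e\<close> lies over the single edge \<open>e\<close>,
  and \<open>shift l g\<close> is the edge \<open>lg\<close> over \<open>l f(g)\<close>.
\<close>

definition edge1 :: "'d \<Rightarrow> 'e" where
  "edge1 e = (SOME g. g \<in> arcs E1 \<and> fe g = [e])"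

definition shift :: "'d \<Rightarrow> 'e \<Rightarrow> 'e" where
  "shift l g = (SOME h. h \<in> arcs E1 \<and> fe h = l # fe g)"

lemma edge1: assumes e: "e \<in> arcs E2" "\<not> loop e"
  shows "edge1 e \<in> arcs E1" "fe (edge1 e) = [e]" "tail E1 (edge1 e) = tail E2 e" "head E1 (edge1 e) = head E2 e"
proof -
  obtain g where "g \<in> arcs E1" "fe g = [e]"
    using edge_exists[of "tail E2 e" "[]" e "head E2 e"] e by (auto simp: E2.awalk_simps)
  then have *: "edge1 e \<in> arcs E1 \<and> fe (edge1 e) = [e]" unfolding edge1_def by (intro someI[of "\<lambda>g. g \<in> arcs E1 \<and> fe g = [e]" g] conjI)
  then show "edge1 e \<in> arcs E1" "fe (edge1 e) = [e]" by auto
  show "tail E1 (edge1 e) = tail E2 e" "head E1 (edge1 e) = head E2 e"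
    using fe_awalk[of "edge1 e"] * by (auto simp: E2.awalk_simps)
qed

lemma shift: assumes l: "l \<in> arcs E2" "loop l" and g: "g \<in> arcs E1" "tail E1 g = tail E2 l"
  shows "shift l g \<in> arcs E1" "fe (shift l g) = l # fe g" "tail E1 (shift l g) = tail E2 l"
    "head E1 (shift l g) = head E1 g"
proof -
  obtain ls e where f: "fe g = ls @ [e]" "\<And>l. l \<in> set ls \<Longrightarrow> loop l" "\<not> loop e"
    using fe_form[OF g(1)] by blast
  have "E2.awalk (tail E2 l) ((l # ls) @ [e]) (head E1 g)"
    using fe_awalk[OF g(1)] f(1) g(2) l by (simp add: E2.awalk_Cons_iff del: E2.awalk_append_iff)
  then obtain h where "h \<in> arcs E1" "fe h = l # fe g"
    using edge_exists[of "tail E2 l" "l # ls" e "head E1 g"] f l by auto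
  then have *: "shift l g \<in> arcs E1 \<and> fe (shift l g) = l # fe g" unfolding shift_def by (intro someI[of "\<lambda>h. h \<in> arcs E1 \<and> fe h = l # fe g" h] conjI)
  then show "shift l g \<in> arcs E1" "fe (shift l g) = l # fe g" by auto
  show "tail E1 (shift l g) = tail E2 l"
    using fe_awalk[of "shift l g"] * by (auto simp: E2.awalk_simps)
  have "E2.awalk (tail E2 l) (l # fe g) (head E1 (shift l g))"
    using fe_awalk[of "shift l g"] * \<open>tail E1 (shift l g) = tail E2 l\<close> by simp
  then have "E2.awalk (tail E1 g) (fe g) (head E1 (shift l g))" using l g by (simp add: E2.awalk_simps)
  then show "head E1 (shift l g) = head E1 g" using fe_awalk[OF g(1)] E2.awalk_path(2) by metis
qed

lemma shift_inj: assumes "l \<in> arcs E2" "loop l" "g \<in> arcs E1" "tail E1 g = tail E2 l"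
    "h \<in> arcs E1" "tail E1 h = tail E2 l" "shift l g = shift l h" shows "g = h"
  using shift(2)[OF assms(1-4)] shift(2)[OF assms(1,2,5,6)] assms fe_inj by simp

lemma edge_cases [consumes 1, case_names single extended]:
  assumes g: "g \<in> arcs E1"
  obtains (single) e where "e \<in> out_arcs E2 (tail E1 g)" "\<not> loop e" "g = edge1 e"
  | (extended) l h where "l \<in> out_arcs E2 (tail E1 g)" "loop l" "h \<in> out_arcs E1 (tail E1 g)" "g = shift l h"
proof -
  obtain ls e where f: "fe g = ls @ [e]" "\<And>l. l \<in> set ls \<Longrightarrow> loop l" "\<not> loop e"
    using fe_form[OF g] by blast
  show thesis
  proof (cases ls)
    case Nil
    then have e: "e \<in> arcs E2" "tail E2 e = tail E1 g"
      using f tail_hd_fe[OF g] arc_of_list[OF _ g] by auto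
    moreover have "g = edge1 e" by (rule fe_inj[OF g]) (use edge1[OF e(1) f(3)] f Nil in auto)
    ultimately show thesis using single f by auto
  next
    case (Cons l ls')
    then have l: "l \<in> arcs E2" "tail E2 l = tail E1 g" "loop l"
      using f tail_hd_fe[OF g] arc_of_list[OF _ g] by auto
    have "E2.awalk (tail E1 g) (ls' @ [e]) (head E1 g)"
      using fe_awalk[OF g] f(1) Cons l by (simp add: E2.awalk_Cons_iff del: E2.awalk_append_iff)
    then obtain h where h: "h \<in> arcs E1" "tail E1 h = tail E1 g" "fe h = ls' @ [e]"
      using edge_exists[of "tail E1 g" ls' e "head E1 g"] f Cons by auto
    moreover have "g = shift l h"
      by (rule fe_inj[OF g]) (use shift[OF l(1,3) h(1)] h l f Cons in auto)
    ultimately show thesis using extended l by auto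
  qed
qed

text \<open>
  A loop \<open>l\<close> at \<open>v\<close> would produce the infinitely many edges \<open>l\<^sup>n g\<close> leaving \<open>v\<close>.
\<close>

lemma regular_no_loop:
  assumes v: "regular_vertex E1 v" and l: "l \<in> out_arcs E2 v" shows "\<not> loop l"
proof
  assume loop: "loop l"
  have l': "l \<in> arcs E2" "tail E2 l = v" using l by auto
  obtain g where g: "g \<in> out_arcs E1 v" using v unfolding regular_vertex_def by blast
  have it: "(shift l ^^ n) g \<in> out_arcs E1 v \<and> length (fe ((shift l ^^ n) g)) = n + length (fe g)" for n
  proof (induction n)
    case (Suc n)
    then show ?case using shift[OF l'(1) loop, of "(shift l ^^ n) g"] l' by simp
  qed (use g in simp)
  have "inj (\<lambda>n. (shift l ^^ n) g)"
    by (rule injI) (metis add_right_cancel it)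
  then have "infinite (range (\<lambda>n. (shift l ^^ n) g))" by (rule range_inj_infinite)
  moreover have "range (\<lambda>n. (shift l ^^ n) g) \<subseteq> out_arcs E1 v" using it by blast
  ultimately show False using v finite_subset by (auto simp: regular_vertex_def)
qed

lemma edge1_bij: assumes "\<And>l. l \<in> out_arcs E2 v \<Longrightarrow> \<not> loop l"
  shows "bij_betw edge1 (out_arcs E2 v) (out_arcs E1 v)"
proof (rule bij_betwI')
  fix e e' assume e: "e \<in> out_arcs E2 v" "e' \<in> out_arcs E2 v"
  have "fe (edge1 e) = [e]" "fe (edge1 e') = [e']" using e assms by (intro edge1(2); simp)+
  then show "edge1 e = edge1 e' \<longleftrightarrow> e = e'" by (metis list.inject)
next
  fix e assume "e \<in> out_arcs E2 v"
  then show "edge1 e \<in> out_arcs E1 v" using edge1[of e] assms by auto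
next
  fix g assume g: "g \<in> out_arcs E1 v"
  then have g': "g \<in> arcs E1" "tail E1 g = v" by auto
  show "\<exists>e\<in>out_arcs E2 v. g = edge1 e"
    using g'(1)
  proof (cases rule: edge_cases)
    case (single e) then show ?thesis using g' by auto
  next
    case (extended l h) then show ?thesis using assms[of l] g' by simp
  qed
qed

lemma regular_iff: assumes "v \<in> verts E1" "\<And>l. l \<in> out_arcs E2 v \<Longrightarrow> \<not> loop l"
  shows "regular_vertex E1 v \<longleftrightarrow> regular_vertex E2 v"
proof -
  have b: "bij_betw edge1 (out_arcs E2 v) (out_arcs E1 v)" by (rule edge1_bij[OF assms(2)])
  have "out_arcs E1 v = {} \<longleftrightarrow> out_arcs E2 v = {}" using bij_betw_imp_surj_on[OF b] by blast
  then show ?thesis using bij_betw_finite[OF b] assms(1) verts_eq by (simp add: regular_vertex_def)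
qed

definition fgen :: "'v + 'e \<Rightarrow> ('v + 'd) star_poly" where
  "fgen g = (case g of Inl v \<Rightarrow> vertex_var v | Inr e \<Rightarrow> E2.mon (tail E1 e) (fe e))"

abbreviation ft where "ft \<equiv> subst fgen"

lemma ft_V: "ft (vertex_var v) = vertex_var v"
  and ft_S: "ft (edge_var e) = E2.mon (tail E1 e) (fe e)"
  by (simp_all add: subst_gen fgen_def)

notation E2.eqv (infix "\<simeq>\<^sub>2" 50)

lemma mon_fe: assumes "g \<in> arcs E1"
  defines "m \<equiv> E2.mon (tail E1 g) (fe g)"
  shows "m \<in> E2.P" "poly_adj m \<in> E2.P" "poly_adj m * m \<simeq>\<^sub>2 vertex_var (head E1 g)"
    "vertex_var (tail E1 g) * m \<simeq>\<^sub>2 m" "m * vertex_var (head E1 g) \<simeq>\<^sub>2 m"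
  unfolding m_def using fe_awalk[OF assms(1)]
  by (auto intro: E2.mon_adj_mon E2.V_mon E2.mon_V simp: E2.mon_P E2.mon_adj_P)

lemma U_of_eqv: "p \<simeq>\<^sub>2 q \<Longrightarrow> E2.U (p - q) = 0" and U_of_eqv0: "p \<simeq>\<^sub>2 0 \<Longrightarrow> E2.U p = 0"
  by (auto simp: E2.eqv_def)

text \<open>
  For (GA1), the images of distinct edges are prefix-incomparable because \<open>f\<close> reflects prefixes. For
  (GA2), a regular vertex carries no loop, so \<open>f\<close> identifies the edges leaving it in both graphs.
\<close>

lemma ft_relation: assumes "r \<in> graph_relations E1" shows "E2.U (ft r) = 0"
  using assms
proof (cases rule: graph_relations_cases)
  case (idem v)
  then show ?thesis using E2.U_relation[OF graph_relationsI(1)[of v E2]]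
    by (simp add: subst_simps(1-5,7-) ft_V verts_eq)
next
  case (sa v)
  then show ?thesis using E2.U_relation[OF graph_relationsI(2)[of v E2]]
    by (simp add: subst_simps(1-5,7-) ft_V verts_eq)
next
  case (orth v w)
  then show ?thesis using E2.U_relation[OF graph_relationsI(3)[of v E2 w]]
    by (simp add: subst_simps(1-5,7-) ft_V verts_eq)
next
  case (pisom e)
  let ?m = "E2.mon (tail E1 e) (fe e)"
  note m = mon_fe[OF pisom(1)]
  have "?m * poly_adj ?m * ?m = ?m * (poly_adj ?m * ?m)" by (simp add: mult.assoc)
  also have "\<dots> \<simeq>\<^sub>2 ?m * vertex_var (head E1 e)" by (intro E2.eqv_left m)
  also have "\<dots> \<simeq>\<^sub>2 ?m" by (rule m)
  finally show ?thesis using U_of_eqv by (simp add: pisom subst_simps(1-5,7-) ft_S)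
next
  case (GA1 e)
  then show ?thesis using U_of_eqv[OF mon_fe(3)[OF GA1(1)]] by (simp add: subst_simps(1-5,7-) ft_S ft_V)
next
  case (GA1' e f)
  have neq: "take (length (fe a)) (fe b) \<noteq> fe a" if "a \<in> arcs E1" "b \<in> arcs E1" "a \<noteq> b" for a b
    using fe_prefix_imp_eq[OF that(1,2)] that(3) by (metis append_take_drop_id)
  have "poly_adj (E2.mon (tail E1 e) (fe e)) * E2.mon (tail E1 f) (fe f) \<simeq>\<^sub>2 0"
    using GA1' by (intro E2.mon_orth[OF fe_awalk fe_awalk] neq) auto
  then show ?thesis using U_of_eqv0 by (simp add: GA1' subst_simps(1-5,7-) ft_S)
next
  case (GA2 v)
  have v: "v \<in> verts E1" using GA2 by (simp add: regular_vertex_def)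
  note nl = regular_no_loop[OF GA2(1)]
  have "(\<Sum>g\<in>out_arcs E1 v. E2.mon (tail E1 g) (fe g) * poly_adj (E2.mon (tail E1 g) (fe g)))
      = (\<Sum>e\<in>out_arcs E2 v. E2.mon (tail E1 (edge1 e)) (fe (edge1 e)) * poly_adj (E2.mon (tail E1 (edge1 e)) (fe (edge1 e))))"
    by (rule sum.reindex_bij_betw[OF edge1_bij[OF nl], symmetric])
  also have "\<dots> \<simeq>\<^sub>2 (\<Sum>e\<in>out_arcs E2 v. edge_var e * poly_adj (edge_var e))"
  proof (rule E2.eqv_sum)
    fix e assume e: "e \<in> out_arcs E2 v"
    have "E2.mon (tail E1 (edge1 e)) (fe (edge1 e)) \<simeq>\<^sub>2 edge_var e"
      using edge1(2)[OF _ nl[OF e]] E2.mon_single e by simp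
    then show "E2.mon (tail E1 (edge1 e)) (fe (edge1 e)) * poly_adj (E2.mon (tail E1 (edge1 e)) (fe (edge1 e)))
      \<simeq>\<^sub>2 edge_var e * poly_adj (edge_var e)" by (intro E2.eqv_mult E2.eqv_adj)
  qed
  also have "\<dots> \<simeq>\<^sub>2 vertex_var v"
    by (rule E2.CK) (use regular_iff[OF v nl] GA2 in blast)
  finally show ?thesis using U_of_eqv by (simp add: GA2 subst_simps(1-5,7-) ft_S ft_V)
next
  case (GA3 e)
  let ?m = "E2.mon (tail E1 e) (fe e)"
  note m = mon_fe[OF GA3(1)]
  have "vertex_var (tail E1 e) * (?m * poly_adj ?m) = vertex_var (tail E1 e) * ?m * poly_adj ?m"
    by (simp add: mult.assoc)
  also have "\<dots> \<simeq>\<^sub>2 ?m * poly_adj ?m" by (intro E2.eqv_right m)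
  finally show ?thesis using U_of_eqv by (simp add: GA3 subst_simps(1-5,7-) ft_S ft_V)
qed

sublocale fh: universal_hom E1.gens "graph_relations E1" E2.gens "graph_relations E2" fgen
proof
  fix g assume "g \<in> E1.gens"
  then show "fgen g \<in> E2.P" using mon_fe(1) by (auto simp: fgen_def verts_eq)
qed (rule ft_relation)

lemma ft_mon: "E1.awalk u p w \<Longrightarrow> ft (E1.mon u p) \<simeq>\<^sub>2 E2.mon u (fp u p)"
proof (induction p arbitrary: u)
  case Nil
  then have "u \<in> verts E1" by (auto simp: E1.awalk_simps)
  then show ?case by (simp add: ft_V fp_Nil verts_eq E2.eqv_refl)
next
  case (Cons g p)
  then have g: "g \<in> arcs E1" "u = tail E1 g" "E1.awalk (head E1 g) p w" by (auto simp: E1.awalk_simps)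
  have "ft (E1.mon u (g # p)) = E2.mon (tail E1 g) (fe g) * ft (E1.mon (head E1 g) p)"
    by (simp add: subst_mult ft_S)
  also have "\<dots> \<simeq>\<^sub>2 E2.mon (tail E1 g) (fe g) * E2.mon (head E1 g) (fp (head E1 g) p)"
    by (intro E2.eqv_left mon_fe g Cons.IH)
  also have "\<dots> \<simeq>\<^sub>2 E2.mon (tail E1 g) (fe g @ fp (head E1 g) p)"
    by (rule E2.mon_append[OF fe_awalk[OF g(1)] f1_awalk(2)[OF g(3)]])
  also have "fe g @ fp (head E1 g) p = fp u (g # p)"
    using fp_append[OF awalk_edge[OF g(1)] g(3)] g by (simp add: fe_def)
  finally show ?case using g by simp
qed

end

section \<open>The action of the target graph on the ideal\<close>

locale pointed_functor_ideal = pointed_functor E1 E2 f0 f1 + E1: hereditary_set E1 H + E2: hereditary_set E2 H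
  for E1 :: "('v, 'e) pre_digraph" and E2 :: "('v, 'd) pre_digraph" and f0 f1 H +
  assumes no_loop_H: "\<lbrakk>l \<in> arcs E2; loop l\<rbrakk> \<Longrightarrow> tail E2 l \<notin> H"
begin

notation E1.eqv (infix "\<simeq>\<^sub>1" 50)

text \<open>
  The truncation to a finite set \<open>X\<close> of edges of the operator by which a loop acts. For finite \<open>X\<close> it is
  an element of the algebra, so the truncated action \<open>T X\<close> is an honest substitution homomorphism.
\<close>

definition shift_op :: "'e set \<Rightarrow> 'd \<Rightarrow> ('v + 'e) star_poly" where
  "shift_op X l = (\<Sum>g\<in>X \<inter> out_arcs E1 (tail E2 l). edge_var (shift l g) * poly_adj (edge_var g))"

definition action_gen :: "'e set \<Rightarrow> 'v + 'd \<Rightarrow> ('v + 'e) star_poly" where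
  "action_gen X g = (case g of Inl v \<Rightarrow> vertex_var v
     | Inr e \<Rightarrow> if loop e then shift_op X e else edge_var (edge1 e))"

abbreviation T where "T X \<equiv> subst (action_gen X)"

lemma T_V: "T X (vertex_var v) = vertex_var v"
  and T_S: "T X (edge_var e) = (if loop e then shift_op X e else edge_var (edge1 e))"
  by (simp_all add: subst_gen action_gen_def)

text \<open>
  The edges of the source graph whose image begins with \<open>e\<close>, as far as the truncation sees them.
\<close>

definition K :: "'e set \<Rightarrow> 'd \<Rightarrow> 'e set" where
  "K X e = (if loop e then shift e ` (X \<inter> out_arcs E1 (tail E2 e)) else {edge1 e})"

lemma K_sub: "e \<in> arcs E2 \<Longrightarrow> K X e \<subseteq> out_arcs E1 (tail E2 e)"
  using shift edge1 by (auto simp: K_def)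

lemma K_hd: "e \<in> arcs E2 \<Longrightarrow> k \<in> K X e \<Longrightarrow> hd (fe k) = e"
  using shift(2) edge1(2) by (auto simp: K_def split: if_splits)

lemma K_finite: "finite X \<Longrightarrow> finite (K X e)"
  by (simp add: K_def)

lemma shift_op:
  assumes l: "l \<in> arcs E2" "loop l" and X: "finite X"
  shows "shift_op X l \<in> E1.P" "poly_adj (shift_op X l) * shift_op X l \<simeq>\<^sub>1 E1.rangeproj (X \<inter> out_arcs E1 (tail E2 l))"
    "shift_op X l * poly_adj (shift_op X l) \<simeq>\<^sub>1 E1.rangeproj (K X l)"
proof -
  let ?Y = "X \<inter> out_arcs E1 (tail E2 l)"
  have inj: "inj_on (shift l) ?Y" by (rule inj_onI) (use shift_inj[OF l] in auto)
  have sub: "shift l ` ?Y \<subseteq> arcs E1" "(\<lambda>g. g) ` ?Y \<subseteq> arcs E1" using shift(1)[OF l] by auto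
  have hd: "head E1 (shift l g) = head E1 g" if "g \<in> ?Y" for g using shift(4)[OF l] that by auto
  note m = E1.matching_sum[OF _ inj sub(1) inj_on_id2 sub(2) hd, folded shift_op_def]
  show "shift_op X l \<in> E1.P" using m(1) X by simp
  show "poly_adj (shift_op X l) * shift_op X l \<simeq>\<^sub>1 E1.rangeproj ?Y" using m(2) X by simp
  have adj: "poly_adj (shift_op X l) = (\<Sum>g\<in>?Y. edge_var g * poly_adj (edge_var (shift l g)))"
    by (simp add: shift_op_def poly.adj_sum poly.adj_mult poly.adj_adj)
  have "poly_adj (poly_adj (shift_op X l)) * poly_adj (shift_op X l) \<simeq>\<^sub>1 E1.rangeproj (shift l ` ?Y)"
    unfolding adj by (rule E1.matching_sum(2)) (use X inj sub hd in auto)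
  then show "shift_op X l * poly_adj (shift_op X l) \<simeq>\<^sub>1 E1.rangeproj (K X l)"
    using l by (simp add: poly.adj_adj K_def)
qed

lemma action_edge:
  assumes e: "e \<in> arcs E2" and X: "finite X"
  defines "t \<equiv> T X (edge_var e)"
  shows "t \<in> E1.P" "t * poly_adj t \<simeq>\<^sub>1 E1.rangeproj (K X e)" "t * poly_adj t * t \<simeq>\<^sub>1 t"
    "E1.rangeproj (K X e) * t \<simeq>\<^sub>1 t" "E1.U t \<le> 1"
proof -
  show tP: "t \<in> E1.P" and tt: "t * poly_adj t \<simeq>\<^sub>1 E1.rangeproj (K X e)"
    unfolding t_def T_S using shift_op[OF e _ X] edge1[OF e]
    by (auto simp: E1.rangeproj_def K_def intro!: E1.eqv_refl E1.A_mult)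
  have Ksub: "K X e \<subseteq> arcs E1" using K_sub[OF e, of X] by auto
  have "poly_adj t * E1.rangeproj (K X e) \<simeq>\<^sub>1 poly_adj t"
    by (rule E1.partial_isometry)
      (use tt tP K_finite[OF X] Ksub in \<open>auto intro: E1.A_adj E1.rangeproj_idem simp: poly.adj_adj E1.rangeproj_sa\<close>)
  then have "poly_adj (poly_adj t * E1.rangeproj (K X e)) \<simeq>\<^sub>1 poly_adj (poly_adj t)" by (rule E1.eqv_adj)
  then show *: "E1.rangeproj (K X e) * t \<simeq>\<^sub>1 t" by (simp add: poly.adj_simps E1.rangeproj_sa)
  show "t * poly_adj t * t \<simeq>\<^sub>1 t" using E1.eqv_trans[OF E1.eqv_right[OF tP tt] *] .
  have "(E1.U t)\<^sup>2 = E1.U (poly_adj (poly_adj t) * poly_adj t)"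
    using E1.N_cstar[OF E1.A_adj[OF tP]] E1.N_adj[OF tP] by simp
  also have "\<dots> \<le> 1" using E1.eqv_U[OF tt] E1.U_rangeproj[OF K_finite[OF X] Ksub] by (simp add: poly.adj_adj)
  finally show "E1.U t \<le> 1" using E1.N_nonneg[OF tP] by (simp add: power_le_one_iff)
qed

abbreviation FX where "FX \<equiv> finite_subsets_at_top (arcs E1)"

lemma ev_FX:
  assumes "finite Y" "\<And>X. finite X \<Longrightarrow> Y \<inter> arcs E1 \<subseteq> X \<Longrightarrow> Q X"
  shows "eventually Q FX"
  unfolding eventually_finite_subsets_at_top using assms by (intro exI[of _ "Y \<inter> arcs E1"]) auto

lemma T_closed: assumes "p \<in> E2.P" "finite X" shows "T X p \<in> E1.P"
proof (rule subst_closed[OF assms(1)])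
  fix g assume "g \<in> E2.gens"
  moreover have "action_gen X g = T X (poly_gen g)" by (simp add: subst_gen)
  moreover have "vertex_var v \<in> E1.P" if "v \<in> verts E2" for v using that verts_eq by (intro E1.V_P) simp
  ultimately show "action_gen X g \<in> E1.P"
    using action_edge(1)[OF _ assms(2)] by (cases g) (auto simp: T_V)
qed

lemma T_bounded: "p \<in> E2.P \<Longrightarrow> \<exists>C\<ge>0. \<forall>X. finite X \<longrightarrow> E1.U (T X p) \<le> C"
proof (induction p rule: star_polys_induct)
  case zero then show ?case by (intro exI[of _ 0]) (simp add: subst_zero E1.N_zero)
next
  case (add p q)
  then obtain C D where C: "0 \<le> C" "\<And>X. finite X \<Longrightarrow> E1.U (T X p) \<le> C"
    "0 \<le> D" "\<And>X. finite X \<Longrightarrow> E1.U (T X q) \<le> D" by metis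
  have "E1.U (T X (p + q)) \<le> C + D" if "finite X" for X
    using E1.N_triangle[OF T_closed[OF add(1) that] T_closed[OF add(2) that]] C that
    by (simp add: subst_add) (meson add_mono order_trans)
  then show ?case using C by (intro exI[of _ "C + D"]) auto
next
  case (scale c p)
  then obtain C where C: "0 \<le> C" "\<And>X. finite X \<Longrightarrow> E1.U (T X p) \<le> C" by metis
  then show ?case using E1.N_scale[OF T_closed[OF scale(1)]]
    by (intro exI[of _ "cmod c * C"]) (auto simp: subst_scale mult_left_mono)
next
  case (mult p q)
  then obtain C D where C: "0 \<le> C" "\<And>X. finite X \<Longrightarrow> E1.U (T X p) \<le> C"
    "0 \<le> D" "\<And>X. finite X \<Longrightarrow> E1.U (T X q) \<le> D" by metis
  have "E1.U (T X (p * q)) \<le> C * D" if X: "finite X" for X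
  proof -
    have "E1.U (T X p * T X q) \<le> E1.U (T X p) * E1.U (T X q)"
      by (intro E1.N_mult T_closed mult X)
    also have "\<dots> \<le> C * D" by (intro mult_mono C X E1.N_nonneg T_closed mult)
    finally show ?thesis by (simp add: subst_mult)
  qed
  then show ?case using C by (intro exI[of _ "C * D"]) auto
next
  case (gen g)
  show ?case
  proof (cases g)
    case (Inl v)
    then have "v \<in> verts E1" using gen verts_eq by auto
    then have "vertex_var v \<in> E1.P" by (rule E1.V_P)
    then show ?thesis using E1.N_nonneg[of "vertex_var v"] Inl
      by (intro exI[of _ "E1.U (vertex_var v)"]) (simp add: T_V)
  next
    case (Inr e)
    then show ?thesis using gen action_edge(5) by (intro exI[of _ 1]) auto
  qed
next
  case (adj p)
  then show ?case using E1.N_adj[OF T_closed[OF adj(1)]] by (simp add: subst_adj)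
qed

text \<open>
  The element \<open>p\<close> sends \<open>j\<close> to \<open>k\<close>: the truncated actions of \<open>p\<close> on \<open>j\<close> are eventually constant, equal to
  \<open>k\<close>. This defines the action on the ideal without infinite sums.
\<close>

definition stable :: "('v + 'd) star_poly \<Rightarrow> ('v + 'e) star_poly \<Rightarrow> ('v + 'e) star_poly \<Rightarrow> bool" where
  "stable p j k \<longleftrightarrow> p \<in> E2.P \<and> j \<in> E1.J \<and> k \<in> E1.J \<and> eventually (\<lambda>X. finite X \<and> T X p * j \<simeq>\<^sub>1 k) FX"

lemma stableD: "stable p j k \<Longrightarrow> p \<in> E2.P" "stable p j k \<Longrightarrow> j \<in> E1.J" "stable p j k \<Longrightarrow> k \<in> E1.J"
  "stable p j k \<Longrightarrow> eventually (\<lambda>X. finite X \<and> T X p * j \<simeq>\<^sub>1 k) FX"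
  by (auto simp: stable_def)

lemma stable_add: assumes "stable p j k" "stable q j m" shows "stable (p + q) j (k + m)"
  using assms eventually_conj[OF stableD(4)[OF assms(1)] stableD(4)[OF assms(2)]]
  by (auto simp: stable_def E2.A_add E1.J_add subst_add distrib_right elim!: eventually_mono intro: E1.eqv_add)

lemma stable_add_right: assumes "stable p j k" "stable p j' k'" shows "stable p (j + j') (k + k')"
  using assms eventually_conj[OF stableD(4)[OF assms(1)] stableD(4)[OF assms(2)]]
  by (auto simp: stable_def E1.J_add distrib_left elim!: eventually_mono intro: E1.eqv_add)

lemma stable_scale: assumes "stable p j k" shows "stable (scalar c * p) j (scalar c * k)"
  using assms
  by (auto simp: stable_def E2.A_scale E1.J_scale subst_scale mult.assoc elim!: eventually_mono intro: E1.eqv_scale)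

lemma stable_scale_right: assumes "stable p j k" shows "stable p (scalar c * j) (scalar c * k)"
  using assms
  by (auto simp: stable_def E1.J_scale poly.k_left_comm[of "T _ p"] elim!: eventually_mono intro: E1.eqv_scale)

lemma stable_eqv_right: assumes "stable p j k" "j \<simeq>\<^sub>1 j'" shows "stable p j' k"
proof -
  have "T X p * j' \<simeq>\<^sub>1 k" if "finite X" "T X p * j \<simeq>\<^sub>1 k" for X
    by (rule E1.eqv_trans[OF E1.eqv_left[OF T_closed[OF stableD(1)[OF assms(1)] that(1)] E1.eqv_sym[OF assms(2)]] that(2)])
  then show ?thesis using assms E1.J_eqv by (auto simp: stable_def elim!: eventually_mono)
qed

lemma stable_mult: assumes "stable q j k" "stable p k m" shows "stable (p * q) j m"
proof -
  have "eventually (\<lambda>X. (finite X \<and> T X q * j \<simeq>\<^sub>1 k) \<and> finite X \<and> T X p * k \<simeq>\<^sub>1 m) FX"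
    by (intro eventually_conj stableD(4) assms)
  then have "eventually (\<lambda>X. finite X \<and> T X (p * q) * j \<simeq>\<^sub>1 m) FX"
  proof eventually_elim
    case (elim X)
    have "T X (p * q) * j = T X p * (T X q * j)" by (simp add: subst_mult mult.assoc)
    also have "\<dots> \<simeq>\<^sub>1 T X p * k" by (intro E1.eqv_left T_closed stableD(1)[OF assms(2)]) (use elim in auto)
    also have "\<dots> \<simeq>\<^sub>1 m" using elim by simp
    finally show ?case using elim by simp
  qed
  then show ?thesis using assms by (simp add: stable_def E2.A_mult)
qed

lemma stable_unique: assumes "stable p j k" "stable p j k'" shows "k \<simeq>\<^sub>1 k'"
proof -
  have "eventually (\<lambda>X. (finite X \<and> T X p * j \<simeq>\<^sub>1 k) \<and> finite X \<and> T X p * j \<simeq>\<^sub>1 k') FX"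
    by (intro eventually_conj stableD(4) assms)
  then obtain X where "T X p * j \<simeq>\<^sub>1 k" "T X p * j \<simeq>\<^sub>1 k'"
    using eventually_happens by force
  then show ?thesis using E1.eqv_trans E1.eqv_sym by blast
qed

lemma stable_const:
  assumes "p \<in> E2.P" "j \<in> E1.J" "a \<in> E1.P" "\<And>X. finite X \<Longrightarrow> T X p = a"
  shows "stable p j (a * j)"
  unfolding stable_def
  by (intro conjI ev_FX[of "{}"] E1.J_left assms)
    (simp_all add: assms E1.eqv_refl E1.A_mult E1.J_P)

lemma stable_sum:
  assumes p: "p \<in> E2.P" "j \<in> E1.J" and a: "\<And>g. g \<in> out_arcs E1 v \<Longrightarrow> a g \<in> E1.P"
    and T: "\<And>X. finite X \<Longrightarrow> T X p = (\<Sum>g\<in>X \<inter> out_arcs E1 v. a g)"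
    and Y: "finite Y" "\<And>g. g \<in> out_arcs E1 v - Y \<Longrightarrow> a g * j \<simeq>\<^sub>1 0"
  shows "stable p j ((\<Sum>g\<in>Y \<inter> out_arcs E1 v. a g) * j)"
proof -
  have "T X p * j \<simeq>\<^sub>1 (\<Sum>g\<in>Y \<inter> out_arcs E1 v. a g) * j"
    if X: "finite X" "Y \<inter> arcs E1 \<subseteq> X" for X
  proof -
    have sub: "Y \<inter> out_arcs E1 v \<subseteq> X \<inter> out_arcs E1 v" using X by auto
    have "T X p * j = (\<Sum>g\<in>X \<inter> out_arcs E1 v - Y \<inter> out_arcs E1 v. a g * j) + (\<Sum>g\<in>Y \<inter> out_arcs E1 v. a g * j)"
      unfolding T[OF X(1)] sum_distrib_right by (rule sum.subset_diff[OF sub]) (use X in auto)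
    also have "\<dots> \<simeq>\<^sub>1 0 + (\<Sum>g\<in>Y \<inter> out_arcs E1 v. a g * j)"
      by (intro E1.eqv_add E1.eqv_sum0 E1.eqv_refl E1.A_sum E1.A_mult a E1.J_P p Y(2)) auto
    finally show ?thesis by (simp add: sum_distrib_right)
  qed
  moreover have "(\<Sum>g\<in>Y \<inter> out_arcs E1 v. a g) * j \<in> E1.J"
    by (intro E1.J_left p E1.A_sum a) auto
  ultimately show ?thesis using p by (auto simp: stable_def intro: ev_FX[OF Y(1)])
qed

lemma stable_exists:
  assumes "p \<in> E2.P" "j \<in> E1.J" shows "\<exists>k. stable p j k"
proof -
  have "\<forall>j\<in>E1.J. (\<exists>k. stable p j k) \<and> (\<exists>k. stable (poly_adj p) j k)"
    using assms(1)
  proof (induction p rule: star_polys_induct)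
    case zero
    have "stable 0 j (0 * j)" if "j \<in> E1.J" for j
      by (rule stable_const) (auto simp: that E2.A_zero E1.A_zero subst_zero)
    then show ?case by (auto simp: poly.adj_zero)
  next
    case (add p q)
    then show ?case using stable_add by (simp add: poly.adj_add) blast
  next
    case (scale c p)
    have "poly_adj (scalar c * p) = scalar (cnj c) * poly_adj p"
      by (simp add: poly.adj_mult poly.adj_k poly.k_comm)
    then show ?case using stable_scale scale by metis
  next
    case (mult p q)
    have comp: "\<exists>k. stable (a * b) j k"
      if "\<forall>j\<in>E1.J. \<exists>k. stable a j k" "\<forall>j\<in>E1.J. \<exists>k. stable b j k" "j \<in> E1.J" for a b j
      using that stable_mult stableD(3) by meson
    show ?case unfolding poly.adj_mult using mult(3,4) by (intro ballI conjI comp) blast+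
  next
    case (gen g)
    show ?case
    proof (cases g)
      case (Inl v)
      then have v: "v \<in> verts E2" "v \<in> verts E1" using gen verts_eq by auto
      then have "stable (vertex_var v) j (vertex_var v * j)"
        "stable (poly_adj (vertex_var v)) j (poly_adj (vertex_var v) * j)" if "j \<in> E1.J" for j
        using that by (intro stable_const; auto simp: T_V subst_adj intro: E1.A_adj E2.A_adj)+
      then show ?thesis using Inl by blast
    next
      case (Inr e)
      then have e: "e \<in> arcs E2" using gen by auto
      show ?thesis
      proof (cases "loop e")
        case False
        have "stable (edge_var e) j (edge_var (edge1 e) * j)"
          "stable (poly_adj (edge_var e)) j (poly_adj (edge_var (edge1 e)) * j)" if "j \<in> E1.J" for j
          using that e False edge1(1)[OF e False] by (intro stable_const; auto simp: T_S subst_adj)+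
        then show ?thesis using Inr by blast
      next
        case True
        let ?v = "tail E2 e"
        have nH: "?v \<notin> H" by (rule no_loop_H[OF e True])
        show ?thesis
        proof (intro ballI conjI)
          fix j assume j: "j \<in> E1.J"
          obtain Y where Y: "finite Y" "\<And>g. g \<in> arcs E1 - Y \<Longrightarrow> tail E1 g \<notin> H \<Longrightarrow> poly_adj (edge_var g) * j \<simeq>\<^sub>1 0"
            using E1.J_finite_support[OF j] by metis
          have sh: "shift e g \<in> arcs E1" "tail E1 (shift e g) = ?v" if "g \<in> out_arcs E1 ?v" for g
            using shift[OF e True] that by auto
          have "stable (edge_var e) j ((\<Sum>g\<in>Y \<inter> out_arcs E1 ?v. edge_var (shift e g) * poly_adj (edge_var g)) * j)"
          proof (rule stable_sum[OF _ j _ _ Y(1)])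
            fix g assume g: "g \<in> out_arcs E1 ?v - Y"
            have "edge_var (shift e g) * (poly_adj (edge_var g) * j) \<simeq>\<^sub>1 0"
              by (intro E1.eqv_left0 Y(2)) (use g sh nH in auto)
            then show "edge_var (shift e g) * poly_adj (edge_var g) * j \<simeq>\<^sub>1 0" by (simp add: mult.assoc)
          qed (use e True sh in \<open>auto simp: T_S shift_op_def intro: E1.A_mult\<close>)
          then show "\<exists>k. stable (poly_gen g) j k" using Inr by blast
          let ?Z = "{g \<in> out_arcs E1 ?v. shift e g \<in> Y}"
          have "finite ?Z"
            by (rule inj_on_finite[OF _ _ Y(1), of "shift e"]) (auto intro!: inj_onI intro: shift_inj[OF e True])
          have "stable (poly_adj (edge_var e)) j ((\<Sum>g\<in>?Z \<inter> out_arcs E1 ?v. edge_var g * poly_adj (edge_var (shift e g))) * j)"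
          proof (rule stable_sum[OF _ j _ _ \<open>finite ?Z\<close>])
            fix g assume g: "g \<in> out_arcs E1 ?v - ?Z"
            have "edge_var g * (poly_adj (edge_var (shift e g)) * j) \<simeq>\<^sub>1 0"
              by (intro E1.eqv_left0 Y(2)) (use g sh nH in auto)
            then show "edge_var g * poly_adj (edge_var (shift e g)) * j \<simeq>\<^sub>1 0" by (simp add: mult.assoc)
          next
            fix X :: "'e set"
            show "T X (poly_adj (edge_var e)) = (\<Sum>g\<in>X \<inter> out_arcs E1 ?v. edge_var g * poly_adj (edge_var (shift e g)))"
              using True by (simp add: subst_adj T_S shift_op_def poly.adj_sum poly.adj_mult poly.adj_adj)
          qed (use e sh in \<open>auto intro: E1.A_mult\<close>)
          then show "\<exists>k. stable (poly_adj (poly_gen g)) j k" using Inr by blast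
        qed
      qed
    qed
  next
    case (adj p)
    then show ?case by (simp add: poly.adj_adj)
  qed
  then show ?thesis using assms(2) by blast
qed

text \<open>
  Compute for one large truncation: \<open>(T p j)\<^sup>* (T p j) = j\<^sup>* T(p\<^sup>* p) j\<close>. It yields the C*-identity for the
  operator norm of the action.
\<close>

lemma stable_adj:
  assumes "stable p j k" "stable (poly_adj p * p) j m" shows "(E1.U k)\<^sup>2 \<le> E1.U j * E1.U m"
proof -
  have "eventually (\<lambda>X. (finite X \<and> T X p * j \<simeq>\<^sub>1 k) \<and> finite X \<and> T X (poly_adj p * p) * j \<simeq>\<^sub>1 m) FX"
    by (intro eventually_conj stableD(4) assms)
  then obtain X where X: "finite X" "T X p * j \<simeq>\<^sub>1 k" "T X (poly_adj p * p) * j \<simeq>\<^sub>1 m"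
    using eventually_happens by force
  have P: "j \<in> E1.P" "m \<in> E1.P" "T X p \<in> E1.P"
    using stableD(2,3)[OF assms(2)] E1.J_P T_closed[OF stableD(1)[OF assms(1)] X(1)] by auto
  have "(E1.U k)\<^sup>2 = E1.U (poly_adj (T X p * j) * (T X p * j))"
    using E1.eqv_U[OF X(2)] E1.N_cstar[OF E1.A_mult[OF P(3,1)]] by simp
  also have "poly_adj (T X p * j) * (T X p * j) = poly_adj j * (T X (poly_adj p * p) * j)"
    by (simp add: poly.adj_mult subst_mult subst_adj mult.assoc)
  also have "E1.U \<dots> = E1.U (poly_adj j * m)"
    by (rule E1.eqv_U[OF E1.eqv_left[OF E1.A_adj[OF P(1)] X(3)]])
  also have "\<dots> \<le> E1.U j * E1.U m"
    using E1.N_mult[OF E1.A_adj[OF P(1)] P(2)] E1.N_adj[OF P(1)] by simp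
  finally show ?thesis .
qed

definition action_norm :: "('v + 'd) star_poly \<Rightarrow> real" where
  "action_norm p = Sup {E1.U k | j k. stable p j k \<and> E1.U j \<le> 1}"

lemma stable_bounded: assumes "p \<in> E2.P" obtains C where "0 \<le> C" "\<And>j k. stable p j k \<Longrightarrow> E1.U k \<le> C * E1.U j"
proof -
  obtain C where C: "0 \<le> C" "\<And>X. finite X \<Longrightarrow> E1.U (T X p) \<le> C" using T_bounded[OF assms] by blast
  have "E1.U k \<le> C * E1.U j" if jk: "stable p j k" for j k
  proof -
    obtain X where X: "finite X" "T X p * j \<simeq>\<^sub>1 k"
      using eventually_happens[OF stableD(4)[OF jk]] by force
    have j: "j \<in> E1.P" by (rule E1.J_P[OF stableD(2)[OF jk]])
    have "E1.U k = E1.U (T X p * j)" using E1.eqv_U[OF X(2)] by simp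
    also have "\<dots> \<le> E1.U (T X p) * E1.U j" by (intro E1.N_mult T_closed assms X j)
    also have "\<dots> \<le> C * E1.U j" by (intro mult_right_mono C X E1.N_nonneg j)
    finally show ?thesis .
  qed
  then show thesis using that C by blast
qed

lemma action_norm_upper: assumes "stable p j k" "E1.U j \<le> 1" shows "E1.U k \<le> action_norm p"
  unfolding action_norm_def
proof (rule cSup_upper)
  obtain C where C: "0 \<le> C" "\<And>j k. stable p j k \<Longrightarrow> E1.U k \<le> C * E1.U j"
    using stable_bounded[OF stableD(1)[OF assms(1)]] by blast
  have "E1.U k \<le> C" if "stable p j k" "E1.U j \<le> 1" for j k
    using C(2)[OF that(1)] mult_left_mono[OF that(2) C(1)] by simp
  then show "bdd_above {E1.U k | j k. stable p j k \<and> E1.U j \<le> 1}" by (auto intro!: bdd_aboveI[of _ C])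
qed (use assms in blast)

lemma stable_zero_right: assumes "p \<in> E2.P" shows "stable p 0 0"
  unfolding stable_def
  by (intro conjI ev_FX[of "{}"]) (auto simp: assms E1.J_zero E1.eqv_refl E1.A_zero)

lemma action_norm_least:
  assumes "p \<in> E2.P" "\<And>j k. stable p j k \<Longrightarrow> E1.U j \<le> 1 \<Longrightarrow> E1.U k \<le> C" shows "action_norm p \<le> C"
  unfolding action_norm_def
  by (rule cSup_least) (use assms stable_zero_right[OF assms(1)] E1.N_zero in force)+

lemma action_norm_nonneg: "p \<in> E2.P \<Longrightarrow> 0 \<le> action_norm p"
  using action_norm_upper[OF stable_zero_right] by (simp add: E1.N_zero)

lemma action_norm_stable: assumes jk: "stable p j k" shows "E1.U k \<le> action_norm p * E1.U j"
proof (cases "E1.U j = 0")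
  case True
  then show ?thesis using stable_bounded[OF stableD(1)[OF jk]] jk by (metis mult_zero_right)
next
  case False
  have P: "j \<in> E1.P" "k \<in> E1.P" using stableD[OF jk] E1.J_P by auto
  have pos: "0 < E1.U j" using False E1.N_nonneg[OF P(1)] by simp
  obtain c :: complex where c: "cmod c = 1 / E1.U j"
    using pos norm_of_real[of "1 / E1.U j", where 'a=complex] by (metis abs_of_pos zero_less_divide_1_iff)
  have "E1.U (scalar c * k) \<le> action_norm p"
    by (rule action_norm_upper[OF stable_scale_right[OF jk]]) (use E1.N_scale[OF P(1)] c pos in simp)
  then show ?thesis using E1.N_scale[OF P(2)] c pos by (simp add: field_simps)
qed

lemma action_norm_cstar: "cstar_seminormed scalar poly_adj E2.P action_norm"
proof (rule poly.cstar_seminormedI)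
  fix p assume p: "p \<in> E2.P"
  show "0 \<le> action_norm p" by (rule action_norm_nonneg[OF p])
  show "action_norm (scalar c * p) \<le> cmod c * action_norm p" for c
  proof (rule action_norm_least[OF E2.A_scale[OF p]])
    fix j k assume jk: "stable (scalar c * p) j k" "E1.U j \<le> 1"
    obtain m where m: "stable p j m" using stable_exists[OF p stableD(2)[OF jk(1)]] by blast
    have "E1.U k = E1.U (scalar c * m)"
      by (rule E1.eqv_U[OF stable_unique[OF jk(1) stable_scale[OF m]]])
    also have "\<dots> = cmod c * E1.U m" by (rule E1.N_scale[OF E1.J_P[OF stableD(3)[OF m]]])
    also have "\<dots> \<le> cmod c * action_norm p" by (intro mult_left_mono action_norm_upper[OF m] jk) simp
    finally show "E1.U k \<le> cmod c * action_norm p" .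
  qed
  show "(action_norm p)\<^sup>2 \<le> action_norm (poly_adj p * p)"
  proof -
    have pp: "poly_adj p * p \<in> E2.P" using p by (simp add: E2.A_closed)
    have "action_norm p \<le> sqrt (action_norm (poly_adj p * p))"
    proof (rule action_norm_least[OF p], rule real_le_rsqrt)
      fix j k assume jk: "stable p j k" "E1.U j \<le> 1"
      obtain m where m: "stable (poly_adj p * p) j m" using stable_exists[OF pp stableD(2)[OF jk(1)]] by blast
      have "(E1.U k)\<^sup>2 \<le> E1.U j * E1.U m" by (rule stable_adj[OF jk(1) m])
      also have "\<dots> \<le> 1 * action_norm (poly_adj p * p)"
        by (intro mult_mono jk action_norm_upper[OF m] E1.N_nonneg E1.J_P stableD(3)[OF m]) simp
      finally show "(E1.U k)\<^sup>2 \<le> action_norm (poly_adj p * p)" by simp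
    qed
    then have "(action_norm p)\<^sup>2 \<le> (sqrt (action_norm (poly_adj p * p)))\<^sup>2" by (intro power_mono action_norm_nonneg p)
    then show ?thesis using action_norm_nonneg[OF pp] by simp
  qed
next
  fix p q assume p: "p \<in> E2.P" and q: "q \<in> E2.P"
  show "action_norm (p + q) \<le> action_norm p + action_norm q"
  proof (rule action_norm_least[OF E2.A_add[OF p q]])
    fix j k assume jk: "stable (p + q) j k" "E1.U j \<le> 1"
    obtain m n where m: "stable p j m" "stable q j n"
      using stable_exists[OF _ stableD(2)[OF jk(1)]] p q by blast
    have "E1.U k = E1.U (m + n)"
      by (rule E1.eqv_U[OF stable_unique[OF jk(1) stable_add[OF m]]])
    also have "\<dots> \<le> E1.U m + E1.U n" by (intro E1.N_triangle E1.J_P stableD(3)[OF m(1)] stableD(3)[OF m(2)])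
    also have "\<dots> \<le> action_norm p + action_norm q" by (intro add_mono action_norm_upper[OF m(1)] action_norm_upper[OF m(2)] jk)
    finally show "E1.U k \<le> action_norm p + action_norm q" .
  qed
  show "action_norm (p * q) \<le> action_norm p * action_norm q"
  proof (rule action_norm_least[OF E2.A_mult[OF p q]])
    fix j k assume jk: "stable (p * q) j k" "E1.U j \<le> 1"
    obtain m where m: "stable q j m" using stable_exists[OF q stableD(2)[OF jk(1)]] by blast
    obtain n where n: "stable p m n" using stable_exists[OF p stableD(3)[OF m]] by blast
    have "E1.U k = E1.U n"
      by (rule E1.eqv_U[OF stable_unique[OF jk(1) stable_mult[OF m n]]])
    also have "\<dots> \<le> action_norm p * E1.U m" by (rule action_norm_stable[OF n])
    also have "\<dots> \<le> action_norm p * action_norm q" by (intro mult_left_mono action_norm_upper[OF m] jk action_norm_nonneg p)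
    finally show "E1.U k \<le> action_norm p * action_norm q" .
  qed
qed (auto simp: E2.A_closed)

text \<open>
  Relations need to be checked on the elements \<open>S\<^sub>\<alpha>\<close> only, since they act from the left.
\<close>

lemma stable_zero:
  assumes p: "p \<in> E2.P" and base: "\<And>u r w. \<lbrakk>E1.awalk u r w; w \<in> H\<rbrakk>
    \<Longrightarrow> eventually (\<lambda>X. finite X \<longrightarrow> T X p * E1.mon u r \<simeq>\<^sub>1 0) FX"
  shows "j \<in> E1.J \<Longrightarrow> stable p j 0"
proof (induction rule: E1.J.induct)
  case (J_mon u r w u' q)
  have fin: "eventually finite FX" by (rule ev_FX[of "{}"]) auto
  have "eventually (\<lambda>X. finite X \<and> T X p * (E1.mon u r * poly_adj (E1.mon u' q)) \<simeq>\<^sub>1 0) FX"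
    using base[OF J_mon(1,3)] fin
  proof eventually_elim
    case (elim X)
    then have "T X p * E1.mon u r \<simeq>\<^sub>1 0" by simp
    from E1.eqv_right0[OF E1.mon_adj_P[OF J_mon(2)] this] elim show ?case by (simp add: mult.assoc)
  qed
  then show ?case using E1.J.J_mon[OF J_mon] p by (simp add: stable_def E1.J_zero)
next
  case J_zero then show ?case by (rule stable_zero_right[OF p])
next
  case (J_add x y) then show ?case using stable_add_right[of p x 0 y 0] by simp
next
  case (J_scale x c) then show ?case using stable_scale_right[of p x 0 c] by simp
next
  case (J_eqv x y) then show ?case using stable_eqv_right by blast
qed

lemma stable_zero_exact:
  assumes p: "p \<in> E2.P" and T: "\<And>X. finite X \<Longrightarrow> T X p \<simeq>\<^sub>1 0" and j: "j \<in> E1.J"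
  shows "stable p j 0"
proof (rule stable_zero[OF p _ j])
  fix u r w assume w: "E1.awalk u r w"
  show "eventually (\<lambda>X. finite X \<longrightarrow> T X p * E1.mon u r \<simeq>\<^sub>1 0) FX"
    by (rule always_eventually) (auto intro: E1.eqv_right0 T E1.mon_P[OF w])
qed

lemma eqv1_diff0: "p \<simeq>\<^sub>1 q \<Longrightarrow> p - q \<simeq>\<^sub>1 0"
  using E1.eqv_diff[of p q q q] E1.eqv_refl[of q] by (auto dest: E1.eqvD(2))

text \<open>
  The truncations satisfy the relations exactly, except that two may hold only in the limit:
  \<open>S\<^sub>l\<^sup>* S\<^sub>l = P\<^sub>v\<close> for a loop \<open>l\<close> at \<open>v\<close>, and (GA2) at vertices outside \<open>H\<close>. There the left-hand side is the
  projection onto the ranges of a finite set of edges leaving \<open>v\<close>. It agrees with \<open>P\<^sub>v\<close> on \<open>S\<^sub>\<alpha>\<close> once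
  the truncation is large enough for the first edge of \<open>\<alpha>\<close> to be among them.
\<close>

lemma stable_relation: assumes r: "r \<in> graph_relations E2" and j: "j \<in> E1.J" shows "stable r j 0"
proof -
  have rP: "r \<in> E2.P" using r E2.R_sub by blast
  note exact = stable_zero_exact[OF rP _ j] and base = stable_zero[OF rP _ j]
  show ?thesis using r
  proof (cases rule: graph_relations_cases)
    case (idem v)
    then show ?thesis
      by (intro exact) (simp add: subst_simps(1-5,7-) T_V eqv1_diff0 E1.V_idem verts_eq)
  next
    case (sa v)
    then show ?thesis
      by (intro exact) (simp add: subst_simps(1-5,7-) T_V eqv1_diff0 E1.V_sa verts_eq)
  next
    case (orth v w)
    then show ?thesis
      by (intro exact) (simp add: subst_simps(1-5,7-) T_V E1.V_orth verts_eq)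
  next
    case (pisom e)
    then show ?thesis
      by (intro exact) (simp add: subst_simps(1-5,7-) eqv1_diff0 action_edge(3))
  next
    case (GA1 e)
    show ?thesis
    proof (cases "loop e")
      case False
      then show ?thesis using edge1[OF GA1(1) False] E1.S_adj_S[of "edge1 e"]
        by (intro exact) (simp add: GA1 subst_simps(1-5,7-) T_V T_S eqv1_diff0)
    next
      case True
      let ?v = "tail E2 e"
      have v: "?v \<in> verts E1" using GA1 verts_eq by simp
      have main: "T X r * E1.mon u p \<simeq>\<^sub>1 0"
        if X: "finite X" and p: "E1.awalk u p w" "w \<in> H" and X': "set p \<subseteq> X" for X u p w
      proof -
        let ?K = "X \<inter> out_arcs E1 ?v"
        have K: "?K \<subseteq> arcs E1" "finite ?K" using X by auto
        have "T X r * E1.mon u p = poly_adj (shift_op X e) * shift_op X e * E1.mon u p - vertex_var ?v * E1.mon u p"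
          using GA1 True by (simp add: subst_simps(1-5,7-) T_V T_S left_diff_distrib)
        also have "\<dots> \<simeq>\<^sub>1 E1.rangeproj ?K * E1.mon u p - vertex_var ?v * E1.mon u p"
          by (intro E1.eqv_diff E1.eqv_right shift_op GA1 True X E1.mon_P[OF p(1)] E1.eqv_refl E1.A_mult E1.V_P v)
        also have "\<dots> \<simeq>\<^sub>1 0"
        proof (cases "u = ?v")
          case False
          then show ?thesis
            using E1.eqv_diff[OF E1.rangeproj_mon0[OF K(1) p(1)] E1.V_mon0[OF p(1) v]] by auto
        next
          case uv: True
          have "p \<noteq> []" using p no_loop_H[OF GA1(1) True] uv by (auto simp: E1.awalk_Nil_iff)
          then obtain g p' where gp: "p = g # p'" by (cases p) auto
          then have "g \<in> ?K" using X' p uv by (auto simp: E1.awalk_Cons_iff)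
          then have "E1.rangeproj ?K * E1.mon u p \<simeq>\<^sub>1 E1.mon u p"
            using E1.rangeproj_mon[OF K(2,1)] p(1) unfolding gp by blast
          from eqv1_diff0[OF E1.eqv_trans[OF this E1.eqv_sym[OF E1.V_mon[OF p(1)]]]]
          show ?thesis using uv by simp
        qed
        finally show ?thesis .
      qed
      show ?thesis
      proof (rule base)
        fix u p w assume p: "E1.awalk u p w" "w \<in> H"
        then have "set p \<subseteq> arcs E1" by (auto simp: E1.awalk_def)
        then show "eventually (\<lambda>X. finite X \<longrightarrow> T X r * E1.mon u p \<simeq>\<^sub>1 0) FX"
          using main[OF _ p] by (intro ev_FX[of "set p"]) auto
      qed
    qed
  next
    case (GA1' e f)
    show ?thesis
    proof (rule exact)
      fix X :: "'e set" assume X: "finite X"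
      let ?s = "T X (edge_var e)" and ?t = "T X (edge_var f)"
      let ?K = "E1.rangeproj (K X e)" and ?M = "E1.rangeproj (K X f)"
      have sub: "K X e \<subseteq> arcs E1" "K X f \<subseteq> arcs E1" using K_sub[of e X] K_sub[of f X] GA1' by auto
      have disj: "K X e \<inter> K X f = {}" using K_hd[of e _ X] K_hd[of f _ X] GA1' by blast
      have P: "?s \<in> E1.P" "?t \<in> E1.P" by (intro action_edge GA1' X)+
      have "poly_adj ?s * ?t \<simeq>\<^sub>1 poly_adj (?K * ?s) * (?M * ?t)"
        by (intro E1.eqv_mult E1.eqv_adj E1.eqv_sym[OF action_edge(4)] GA1' X)
      also have "\<dots> = poly_adj ?s * (?K * ?M) * ?t" by (simp add: poly.adj_mult E1.rangeproj_sa mult.assoc)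
      also have "\<dots> \<simeq>\<^sub>1 0" by (intro E1.eqv_right0 E1.eqv_left0 E1.rangeproj_orth sub disj P E1.A_adj)
      finally show "T X r \<simeq>\<^sub>1 0" by (simp add: GA1' subst_mult subst_adj)
    qed
  next
    case (GA2 v)
    have v: "v \<in> verts E1" and fin: "finite (out_arcs E2 v)" using GA2 verts_eq by (auto simp: regular_vertex_def)
    have TK: "T X r * m \<simeq>\<^sub>1 (\<Sum>e\<in>out_arcs E2 v. E1.rangeproj (K X e)) * m - vertex_var v * m"
      if X: "finite X" and m: "m \<in> E1.P" for X m
    proof -
      have "T X r * m = (\<Sum>e\<in>out_arcs E2 v. T X (edge_var e) * poly_adj (T X (edge_var e))) * m - vertex_var v * m"
        by (simp add: GA2 subst_simps(1-5,7-) T_V left_diff_distrib)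
      also have "\<dots> \<simeq>\<^sub>1 (\<Sum>e\<in>out_arcs E2 v. E1.rangeproj (K X e)) * m - vertex_var v * m"
        by (intro E1.eqv_diff E1.eqv_right E1.eqv_sum action_edge(2) m X E1.eqv_refl E1.A_mult E1.V_P v) auto
      finally show ?thesis .
    qed
    show ?thesis
    proof (cases "v \<in> H")
      case True
      then have nl: "\<not> loop l" if "l \<in> out_arcs E2 v" for l using no_loop_H that by auto
      have "(\<Sum>e\<in>out_arcs E2 v. E1.rangeproj (K X e)) \<simeq>\<^sub>1 vertex_var v" for X
      proof -
        have "(\<Sum>e\<in>out_arcs E2 v. E1.rangeproj (K X e))
            = (\<Sum>e\<in>out_arcs E2 v. edge_var (edge1 e) * poly_adj (edge_var (edge1 e)))"
          using nl by (intro sum.cong) (auto simp: K_def E1.rangeproj_def)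
        also have "\<dots> = (\<Sum>g\<in>out_arcs E1 v. edge_var g * poly_adj (edge_var g))"
          by (rule sum.reindex_bij_betw[OF edge1_bij[OF nl]])
        also have "\<dots> \<simeq>\<^sub>1 vertex_var v" by (rule E1.CK) (use regular_iff[OF v nl] GA2 in blast)
        finally show ?thesis .
      qed
      then have z: "T X r * m \<simeq>\<^sub>1 0" if "finite X" "m \<in> E1.P" for X m
        using E1.eqv_trans[OF TK[OF that] eqv1_diff0[OF E1.eqv_right[OF that(2)]]] by blast
      show ?thesis
      proof (rule base)
        fix u p w assume p: "E1.awalk u p w" "w \<in> H"
        show "eventually (\<lambda>X. finite X \<longrightarrow> T X r * E1.mon u p \<simeq>\<^sub>1 0) FX"
          by (rule always_eventually) (auto intro: z E1.mon_P[OF p(1)])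
      qed
    next
      case False
      show ?thesis
      proof (rule base)
        fix u p w assume p: "E1.awalk u p w" "w \<in> H"
        let ?M = "\<lambda>X. \<Union>e\<in>out_arcs E2 v. K X e"
        have M: "?M X \<subseteq> out_arcs E1 v" for X using K_sub[of _ X] by fastforce
        have "out_arcs E1 v \<subseteq> arcs E1" by auto
        note Marcs = subset_trans[OF M this]
        have Mtail: "tail E1 k = v" if "k \<in> ?M X" for k X using subsetD[OF M that] by simp
        have disj: "K X e \<inter> K X f = {}" if "e \<in> out_arcs E2 v" "f \<in> out_arcs E2 v" "e \<noteq> f" for X e f
          using K_hd[of e _ X] K_hd[of f _ X] that by (simp add: disjoint_iff) metis
        have sum: "(\<Sum>e\<in>out_arcs E2 v. E1.rangeproj (K X e)) = E1.rangeproj (?M X)" if "finite X" for X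
          unfolding E1.rangeproj_def
          by (rule sum.UNION_disjoint[symmetric])
            (use fin K_finite[OF that] disj in auto)
        have zero: "T X r * E1.mon u p \<simeq>\<^sub>1 0"
          if X: "finite X" and c: "u \<noteq> v \<or> (\<exists>g p'. p = g # p' \<and> g \<in> ?M X)" for X
        proof -
          have "E1.rangeproj (?M X) * E1.mon u p - vertex_var v * E1.mon u p \<simeq>\<^sub>1 0"
          proof (cases "u = v")
            case False
            have "E1.rangeproj (?M X) * E1.mon u p \<simeq>\<^sub>1 0"
              by (rule E1.rangeproj_mon0[OF Marcs p(1)]) (use Mtail False in blast)
            from E1.eqv_diff[OF this E1.V_mon0[OF p(1) v]] show ?thesis using False by simp
          next
            case True
            with c obtain g p' where g: "p = g # p'" "g \<in> ?M X" by blast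
            have fM: "finite (?M X)" using fin K_finite[OF X] by auto
            have "E1.rangeproj (?M X) * E1.mon u p \<simeq>\<^sub>1 E1.mon u p"
              using E1.rangeproj_mon[OF fM Marcs _ g(2)] p(1) unfolding g(1) by blast
            from eqv1_diff0[OF E1.eqv_trans[OF this E1.eqv_sym[OF E1.V_mon[OF p(1)]]]]
            show ?thesis using True by simp
          qed
          then show ?thesis using E1.eqv_trans[OF TK[OF X E1.mon_P[OF p(1)]]] by (simp only: sum[OF X])
        qed
        show "eventually (\<lambda>X. finite X \<longrightarrow> T X r * E1.mon u p \<simeq>\<^sub>1 0) FX"
        proof (cases "u = v")
          case False
          then show ?thesis using zero by (intro always_eventually) auto
        next
          case uv: True
          have "p \<noteq> []" using p False uv by (auto simp: E1.awalk_Nil_iff)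
          then obtain g p' where gp: "p = g # p'" by (cases p) auto
          then have g: "g \<in> arcs E1" "tail E1 g = v" using p uv by (auto simp: E1.awalk_Cons_iff)
          obtain h where h: "\<And>X. h \<in> X \<Longrightarrow> g \<in> ?M X" "h \<in> arcs E1"
            using g(1)
          proof (cases rule: edge_cases)
            case (single e)
            have "g \<in> ?M X" for X using single g by (auto simp: K_def intro!: bexI[of _ e])
            then show ?thesis using that g by blast
          next
            case (extended l h)
            have "g \<in> ?M X" if "h \<in> X" for X
              using extended g that by (intro UN_I[of l]) (auto simp: K_def)
            then show ?thesis using that[of h] extended by auto
          qed
          show ?thesis by (rule ev_FX[of "{h}"]) (use zero gp h in auto)
        qed
      qed
    qed
  next
    case (GA3 e)
    have e: "e \<in> arcs E2" by (rule GA3)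
    have v: "tail E2 e \<in> verts E1" using e verts_eq by simp
    show ?thesis
    proof (rule exact)
      fix X :: "'e set" assume X: "finite X"
      let ?t = "T X (edge_var e)"
      have "vertex_var (tail E2 e) * (?t * poly_adj ?t) \<simeq>\<^sub>1 vertex_var (tail E2 e) * E1.rangeproj (K X e)"
        by (intro E1.eqv_left action_edge(2) e X E1.V_P v)
      also have "\<dots> \<simeq>\<^sub>1 E1.rangeproj (K X e)" by (rule E1.V_rangeproj[OF K_sub[OF e] v])
      also have "\<dots> \<simeq>\<^sub>1 ?t * poly_adj ?t" by (rule E1.eqv_sym[OF action_edge(2)[OF e X]])
      finally show "T X r \<simeq>\<^sub>1 0"
        using eqv1_diff0 by (simp add: GA3 subst_simps(1-5,7-) T_V)
    qed
  qed
qed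

lemma action_norm_le: assumes "p \<in> E2.P" shows "action_norm p \<le> E2.U p"
proof (rule E2.U_upper[OF _ assms])
  have "action_norm r = 0" if r: "r \<in> graph_relations E2" for r
  proof -
    have rP: "r \<in> E2.P" using r E2.R_sub by blast
    have "action_norm r \<le> 0"
    proof (rule action_norm_least[OF rP])
      fix j k assume jk: "stable r j k"
      have "k \<simeq>\<^sub>1 0" by (rule stable_unique[OF jk stable_relation[OF r stableD(2)[OF jk]]])
      then show "E1.U k \<le> 0" using E1.eqv_U by (fastforce simp: E1.N_zero)
    qed
    then show ?thesis using action_norm_nonneg[OF rP] by simp
  qed
  then show "action_norm \<in> E2.seminorms" by (simp add: E2.seminorms_def cstar_seminorm_iff action_norm_cstar)
qed

text \<open>
  Induction on the number of loops: \<open>S\<^bsub>lh\<^esub> S\<^sub>h\<^sup>* S\<^sub>h = S\<^bsub>lh\<^esub>\<close>, as soon as \<open>h\<close> lies in the truncation.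
\<close>

lemma T_mon_loops:
  "\<lbrakk>E2.awalk v (ls @ [e]) w; \<And>l. l \<in> set ls \<Longrightarrow> loop l; \<not> loop e; g \<in> arcs E1; fe g = ls @ [e]\<rbrakk>
    \<Longrightarrow> eventually (\<lambda>X. finite X \<and> T X (E2.mon v (ls @ [e])) \<simeq>\<^sub>1 edge_var g) FX"
proof (induction ls arbitrary: v g)
  case Nil
  then have e: "e \<in> arcs E2" by (simp add: E2.awalk_Cons_iff)
  note ed = edge1[OF e Nil(3)]
  have g: "g = edge1 e" by (rule fe_inj[OF Nil(4) ed(1)]) (use Nil ed in simp)
  have "edge_var (edge1 e) * vertex_var (head E2 e) \<simeq>\<^sub>1 edge_var (edge1 e)"
    using E1.S_V[OF ed(1)] ed by simp
  then show ?case using Nil(3) by (intro ev_FX[of "{}"]) (auto simp: subst_mult T_S T_V g)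
next
  case (Cons l ls)
  have l: "l \<in> arcs E2" "loop l" "v = tail E2 l" "E2.awalk v (ls @ [e]) w"
    using Cons.prems by (auto simp: E2.awalk_Cons_iff simp del: E2.awalk_append_iff)
  obtain h where h: "h \<in> arcs E1" "tail E1 h = v" "fe h = ls @ [e]"
    using edge_exists[OF l(4) _ Cons.prems(3)] Cons.prems(2) by (metis list.set_intros(2))
  have g: "g = shift l h"
    by (rule fe_inj[OF Cons.prems(4)]) (use shift[OF l(1,2) h(1)] h l Cons.prems in auto)
  have gP: "edge_var g \<in> E1.P" "head E1 g = head E1 h"
    using Cons.prems(4) shift(4)[OF l(1,2) h(1)] h l g by auto
  have IH: "eventually (\<lambda>X. finite X \<and> T X (E2.mon v (ls @ [e])) \<simeq>\<^sub>1 edge_var h) FX"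
    by (rule Cons.IH[OF l(4) _ Cons.prems(3) h(1,3)]) (use Cons.prems(2) in auto)
  have hX: "eventually (\<lambda>X. h \<in> X) FX" by (rule ev_FX[of "{h}"]) (use h in auto)
  show ?case using IH hX
  proof eventually_elim
    case (elim X)
    have X: "finite X" using elim by simp
    let ?Y = "X \<inter> out_arcs E1 (tail E2 l)"
    have "T X (E2.mon v ((l # ls) @ [e])) = shift_op X l * T X (E2.mon v (ls @ [e]))"
      using l by (simp add: subst_mult T_S)
    also have "\<dots> \<simeq>\<^sub>1 shift_op X l * edge_var h"
      by (intro E1.eqv_left shift_op l X) (use elim in simp)
    also have "\<dots> = (\<Sum>k\<in>?Y. edge_var (shift l k) * (poly_adj (edge_var k) * edge_var h))"
      by (simp add: shift_op_def sum_distrib_right mult.assoc)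
    also have "\<dots> \<simeq>\<^sub>1 edge_var g * vertex_var (head E1 g)"
    proof (rule E1.eqv_sum_delta)
      show "finite ?Y" "h \<in> ?Y" using X elim h l by auto
      show "edge_var (shift l h) * (poly_adj (edge_var h) * edge_var h) \<simeq>\<^sub>1 edge_var g * vertex_var (head E1 g)"
        unfolding gP(2) g[symmetric] by (intro E1.eqv_left gP E1.S_adj_S h)
      fix k assume k: "k \<in> ?Y" "k \<noteq> h"
      then show "edge_var (shift l k) * (poly_adj (edge_var k) * edge_var h) \<simeq>\<^sub>1 0"
        using shift(1)[OF l(1,2)] h by (intro E1.eqv_left0 E1.S_adj_S0) auto
    qed
    also have "\<dots> \<simeq>\<^sub>1 edge_var g" by (rule E1.S_V[OF Cons.prems(4)])
    finally show ?case using X by simp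
  qed
qed

text \<open>
  The action restricted along \<open>f\<^sub>*\<close> is left multiplication, already for large truncations.
\<close>

lemma T_ft: "p \<in> E1.P \<Longrightarrow> eventually (\<lambda>X. finite X \<and> T X (ft p) \<simeq>\<^sub>1 p) FX"
proof (induction p rule: star_polys_induct)
  case zero
  show ?case by (rule ev_FX[of "{}"]) (auto simp: subst_zero intro: E1.eqv_refl E1.A_zero)
next
  case (add p q)
  show ?case using add(3,4) by eventually_elim (auto simp: subst_add intro: E1.eqv_add)
next
  case (scale c p)
  then show ?case by (auto elim!: eventually_mono simp: subst_scale intro: E1.eqv_scale)
next
  case (mult p q)
  show ?case using mult(3,4) by eventually_elim (auto simp: subst_mult intro: E1.eqv_mult)
next
  case (gen g)
  show ?case
  proof (cases g)
    case (Inl v)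
    then show ?thesis using gen
      by (intro ev_FX[of "{}"]) (auto simp: ft_V T_V intro: E1.eqv_refl)
  next
    case (Inr e)
    then have e: "e \<in> arcs E1" using gen by auto
    obtain ls d where f: "fe e = ls @ [d]" "\<And>l. l \<in> set ls \<Longrightarrow> loop l" "\<not> loop d"
      using fe_form[OF e] by blast
    have "E2.awalk (tail E1 e) (ls @ [d]) (head E1 e)" using fe_awalk[OF e] f by simp
    from T_mon_loops[OF this f(2,3) e f(1)] show ?thesis using Inr f by (simp add: ft_S)
  qed
next
  case (adj p)
  then show ?case by (auto elim!: eventually_mono simp: subst_adj intro: E1.eqv_adj)
qed

text \<open>
  Let \<open>f\<^sub>* x\<close> act on \<open>x\<^sup>*\<close>: the result is \<open>x x\<^sup>*\<close>, of norm \<open>\<parallel>x\<parallel>\<^sup>2\<close>.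
\<close>

theorem ft_isometric: assumes x: "x \<in> E1.J" shows "E2.U (ft x) = E1.U x"
proof -
  have xP: "x \<in> E1.P" and fP: "ft x \<in> E2.P" using x E1.J_P fh.subst_P by auto
  have adj: "poly_adj x \<in> E1.J" "poly_adj x \<in> E1.P" using x by (auto intro: E1.J_adj E1.J_P)
  have "eventually (\<lambda>X. finite X \<and> T X (ft x) * poly_adj x \<simeq>\<^sub>1 x * poly_adj x) FX"
    using T_ft[OF xP] by (auto elim!: eventually_mono intro: E1.eqv_right adj)
  then have "stable (ft x) (poly_adj x) (x * poly_adj x)"
    using fP adj E1.J_left[OF xP adj(1)] by (simp add: stable_def)
  then have "E1.U (x * poly_adj x) \<le> action_norm (ft x) * E1.U (poly_adj x)" by (rule action_norm_stable)
  moreover have "E1.U (x * poly_adj x) = E1.U x * E1.U x"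
    using E1.N_cstar[OF adj(2)] E1.N_adj[OF xP] by (simp add: poly.adj_adj power2_eq_square)
  ultimately have "E1.U x * E1.U x \<le> action_norm (ft x) * E1.U x" using E1.N_adj[OF xP] by simp
  then have "E1.U x \<le> action_norm (ft x)"
    using E1.N_nonneg[OF xP] action_norm_nonneg[OF fP] by (cases "E1.U x = 0") (auto simp: mult_le_cancel_right)
  then show ?thesis using action_norm_le[OF fP] fh.U_subst_le[OF xP] by simp
qed

text \<open>
  A path ending in \<open>H\<close> is pointed, because its last edge would otherwise be a loop at a vertex of \<open>H\<close>.
\<close>

theorem ft_onto_ideal: "y \<in> E2.J \<Longrightarrow> \<exists>x\<in>E1.J. ft x \<simeq>\<^sub>2 y"
proof (induction rule: E2.J.induct)
  case (J_mon u p w u' q)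
  have lift: "\<exists>r. E1.awalk v r w \<and> fp v r = s" if s: "E2.awalk v s w" for v s
  proof -
    have "\<not> loop (last s)" if "s \<noteq> []"
    proof
      assume lp: "loop (last s)"
      obtain s' d where d: "s = s' @ [d]" using \<open>s \<noteq> []\<close> by (metis append_butlast_last_id)
      then have "d \<in> arcs E2" "head E2 d = w" using s by (auto simp: E2.awalk_simps)
      then show False using no_loop_H[of d] lp d J_mon(3) by simp
    qed
    then show ?thesis using fp_surj[OF s] by blast
  qed
  obtain r s where r: "E1.awalk u r w" "fp u r = p" and s: "E1.awalk u' s w" "fp u' s = q"
    using lift[OF J_mon(1)] lift[OF J_mon(2)] by blast
  have "ft (E1.mon u r * poly_adj (E1.mon u' s)) \<simeq>\<^sub>2 E2.mon u p * poly_adj (E2.mon u' q)"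
    unfolding subst_mult subst_adj using ft_mon[OF r(1)] ft_mon[OF s(1)] r s
    by (intro E2.eqv_mult E2.eqv_adj) auto
  then show ?case using E1.J_mon[OF r(1) s(1) J_mon(3)] by blast
next
  case J_zero
  show ?case by (intro bexI[of _ 0] E1.J_zero) (simp add: subst_zero E2.eqv_refl E2.A_zero)
next
  case (J_add x y)
  then obtain a b where "a \<in> E1.J" "b \<in> E1.J" "ft a \<simeq>\<^sub>2 x" "ft b \<simeq>\<^sub>2 y" by blast
  then show ?case by (intro bexI[of _ "a + b"] E1.J_add) (simp_all add: subst_add E2.eqv_add)
next
  case (J_scale x c)
  then obtain a where "a \<in> E1.J" "ft a \<simeq>\<^sub>2 x" by blast
  then show ?case by (intro bexI[of _ "scalar c * a"] E1.J_scale) (simp_all add: subst_scale E2.eqv_scale)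
next
  case (J_eqv x y)
  then show ?case using E2.eqv_trans by blast
qed

end

section \<open>The pullback square\<close>

context admissible_inclusion begin

text \<open>
  Since the complement is hereditary, a path ending in the subgraph never left it.
\<close>

lemma awalk_F: "F.awalk u p w \<longleftrightarrow> E.awalk u p w \<and> w \<in> verts F"
proof (induction p arbitrary: u)
  case Nil show ?case unfolding F.awalk_Nil_iff E.awalk_Nil_iff using F_sub(1) by blast
next
  case (Cons e p)
  have "F.awalk (head E e) p w \<Longrightarrow> head E e \<in> verts F" by (rule F.awalk_verts_in(1))
  then show ?case unfolding F.awalk_Cons_iff E.awalk_Cons_iff Cons[of "head F e"] F_sub(3,4) arcs_F
    using Cons[of "head E e"] by blast
qed

lemma pi_hom_generators:
  "hom_on_generators E (graph_cstar F)
     (\<lambda>v. if v \<in> verts F then vproj F v else czero (graph_cstar F))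
     (\<lambda>e. if e \<in> arcs F then eiso F e else czero (graph_cstar F)) pi.hom"
proof -
  have z: "F.cl (\<lambda>n. 0) = czero F.alg" by (simp add: F.cl_zero zero_fun_def)
  have "pi.hom (vproj E v) = (if v \<in> verts F then vproj F v else czero F.alg)" if "v \<in> verts E" for v
    using that by (simp add: E.vproj_eq F.vproj_eq pi.hom_cl E.CS_const rest_V z)
  moreover have "pi.hom (eiso E e) = (if e \<in> arcs F then eiso F e else czero F.alg)" if "e \<in> arcs E" for e
    using that by (simp add: E.eiso_eq F.eiso_eq pi.hom_cl E.CS_const rest_S z)
  ultimately show ?thesis
    using pi.star_hom_hom by (simp add: hom_on_generators_def E.graph_cstar_eq F.graph_cstar_eq)
qed

lemma canonical: "canonical_surjection E F pi.hom"
  unfolding canonical_surjection_def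
proof (intro conjI F.cstar_algebra_graph E.determined_homI pi_hom_generators)
  show "pi.hom ` celems (graph_cstar E) = celems (graph_cstar F)"
    unfolding E.graph_cstar_eq F.graph_cstar_eq
  proof
    show "pi.hom ` celems E.alg \<subseteq> celems F.alg"
      using star_hom_closed[OF pi.star_hom_hom] by blast
    show "celems F.alg \<subseteq> pi.hom ` celems E.alg"
    proof
      fix y assume "y \<in> celems F.alg"
      then obtain Y where Y: "Y \<in> F.CS" "y = F.cl Y" by (rule F.celems_E)
      obtain X where X: "X \<in> E.CS" "F.L ((\<lambda>n. rest (X n)) - Y) = 0" using surjective_pi[OF Y(1)] .
      then have "pi.hom (E.cl X) = y" using Y by (simp add: pi.hom_cl F.cl_eq_iff pi.CS_subst)
      then show "y \<in> pi.hom ` celems E.alg" using E.cl_closed[OF X(1)] by blast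
    qed
  qed
qed

lemma rest_unit: "finite (verts E) \<Longrightarrow> rest E.unit_poly = F.unit_poly"
  unfolding E.unit_poly_def F.unit_poly_def subst_sum rest_V using F_sub(1)
  by (intro sum.mono_neutral_cong_right) auto

lemma pi_unit: "finite (verts E) \<Longrightarrow> pi.hom E.unit_elem = F.unit_elem"
  by (simp add: E.unit_elem_def F.unit_elem_def pi.hom_cl E.CS_const E.unit_poly_P rest_unit)

end

context pointed_functor begin

lemma fh_hom_generators:
  "hom_on_generators E1 (graph_cstar E2) (\<lambda>v. vproj E2 (f0 v)) (\<lambda>e. path_iso E2 (f1 (edge_path E1 e))) fh.hom"
proof -
  have "fh.hom (vproj E1 v) = vproj E2 (f0 v)" if "v \<in> verts E1" for v
    using that by (simp add: E1.vproj_eq E2.vproj_eq fh.hom_cl E1.CS_const ft_V f0_id)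
  moreover have "fh.hom (eiso E1 e) = path_iso E2 (f1 (edge_path E1 e))" if e: "e \<in> arcs E1" for e
  proof -
    have "path_iso E2 (f1 (edge_path E1 e)) = E2.cl (\<lambda>n. E2.mon (tail E1 e) (fe e))"
      unfolding edge_path_def f1_awalk(1)[OF awalk_edge[OF e]] fe_def[symmetric]
      by (rule E2.path_iso_eq[OF fe_awalk[OF e]])
    then show ?thesis using e by (simp add: E1.eiso_eq fh.hom_cl E1.CS_const ft_S)
  qed
  ultimately show ?thesis
    using fh.star_hom_hom by (simp add: hom_on_generators_def E1.graph_cstar_eq E2.graph_cstar_eq)
qed

lemma induced: "functor_induced_hom E1 E2 f0 f1 fh.hom"
  unfolding functor_induced_hom_def
  by (intro E1.determined_homI E2.cstar_algebra_graph fh_hom_generators)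

lemma fh_unit: "fh.hom E1.unit_elem = E2.unit_elem"
  by (simp add: E1.unit_elem_def E2.unit_elem_def fh.hom_cl E1.CS_const E1.unit_poly_P)
    (simp add: E1.unit_poly_def E2.unit_poly_def subst_sum ft_V verts_eq)

end

lemma unital_mapI:
  assumes "cstar_algebra A" "is_cunit A u" "is_cunit B (\<phi> u)" shows "unital_map A B \<phi>"
  using cstar_algebra.cunit_unique[OF assms(1,2)] assms(3) by (auto simp: unital_map_def)

text \<open>
  The two inclusions and the functor of the theorem. The restricted functor between the subgraphs
  satisfies the same hypotheses, so everything proved for \<open>f\<close> applies to it as well.
\<close>

locale pointed_pullback =
  A1: admissible_inclusion F1 E1 + A2: admissible_inclusion F2 E2 + EE: pointed_functor E1 E2 f0 f1
  for E1 F1 :: "('v, 'e) pre_digraph" and E2 F2 :: "('v, 'd) pre_digraph" and f0 f1 +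
  assumes F_verts: "verts F1 = verts F2"
    and no_loop: "\<lbrakk>e \<in> arcs E2; tail E2 e \<in> verts E2 - verts F2\<rbrakk> \<Longrightarrow> tail E2 e \<noteq> head E2 e"
begin

lemma pathsF1: "(u, p) \<in> paths F1 \<longleftrightarrow> (\<exists>w. A1.E.awalk u p w \<and> w \<in> verts F1)"
  and pathsF2: "(u, q) \<in> paths F2 \<longleftrightarrow> (\<exists>w. A2.E.awalk u q w \<and> w \<in> verts F2)"
  by (auto simp: paths_def A1.awalk_F A2.awalk_F)

lemma functor_F: "path_functor F1 F2 f0 f1"
  unfolding path_functor_def
proof (intro conjI ballI impI)
  show "f0 v \<in> verts F2" "f1 (vertex_path v) = vertex_path (f0 v)" if "v \<in> verts F1" for v
    using that EE.func A1.F_sub(1) EE.f0_id F_verts by (auto simp: path_functor_def)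
  fix \<alpha> assume "\<alpha> \<in> paths F1"
  then obtain u p w where a: "\<alpha> = (u, p)" "A1.E.awalk u p w" "w \<in> verts F1"
    using pathsF1 by (cases \<alpha>) auto
  note f = EE.f1_awalk[OF a(2)]
  have F: "A1.F.awalk u p w" "A2.F.awalk u (EE.fp u p) w"
    using a f F_verts by (auto simp: A1.awalk_F A2.awalk_F)
  have ids: "f0 u = u" "f0 w = w" using A1.E.awalk_verts_in[OF a(2)] EE.f0_id by auto
  show "f1 \<alpha> \<in> paths F2" "path_source (f1 \<alpha>) = f0 (path_source \<alpha>)"
    "path_range F2 (f1 \<alpha>) = f0 (path_range F1 \<alpha>)"
    using A2.F.awalk_path[OF F(2)] A1.F.awalk_path[OF F(1)] by (simp_all add: a f ids path_source_def)
  fix \<beta> assume "\<beta> \<in> paths F1" "path_source \<beta> = path_range F1 \<alpha>"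
  moreover have "path_range F1 \<alpha> = path_range E1 \<alpha>"
    using A1.F.awalk_path(2)[OF F(1)] A1.E.awalk_path(2)[OF a(2)] a by simp
  moreover have "\<gamma> \<in> paths E1" if "\<gamma> \<in> paths F1" for \<gamma>
    using that pathsF1 A1.E.awalk_path(1) by (cases \<gamma>) auto
  ultimately show "f1 (path_concat \<alpha> \<beta>) = path_concat (f1 \<alpha>) (f1 \<beta>)"
    using EE.func \<open>\<alpha> \<in> paths F1\<close> unfolding path_functor_def by metis
qed

sublocale FF: pointed_functor F1 F2 f0 f1
proof (unfold_locales, goal_cases)
  case 1 show ?case by (rule F_verts)
next
  case 2 show ?case by (rule functor_F)
next
  case (3 \<alpha> \<beta>)
  obtain u p w where a: "\<alpha> = (u, p)" "A1.E.awalk u p w" "w \<in> verts F1"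
    using 3 pathsF1 by (cases \<alpha>) auto
  obtain u' q x where b: "\<beta> = (u', q)" "A1.E.awalk u' q x" "x \<in> verts F1"
    using 3 pathsF1 by (cases \<beta>) auto
  obtain r where r: "u' = u" "EE.fp u' q = EE.fp u p @ r"
    using 3 EE.f1_awalk(1)[OF a(2)] EE.f1_awalk(1)[OF b(2)] a(1) b(1)
    by (auto simp: path_le_def path_concat_def)
  obtain s where s: "q = p @ s"
    using EE.fp_prefix[OF a(2), of q x r] b r by auto
  have "A1.E.awalk w s x" using b(2) a(2) r s by (auto simp: A1.E.awalk_append_iff)
  then have "A1.F.awalk w s x" using b by (simp add: A1.awalk_F)
  moreover have "A1.F.awalk u p w" using a by (simp add: A1.awalk_F)
  ultimately show ?case unfolding path_le_def
    using A1.F.awalk_path a b r s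
    by (intro bexI[of _ "(w, s)"]) (auto simp: path_source_def path_concat_def)
next
  case (4 v) then show ?case using EE.f0_id A1.F_sub(1) by auto
next
  case 5
  have pointed: "pointed_path F2 (u, q) \<longleftrightarrow> pointed_path E2 (u, q)" if "A2.F.awalk u q w" for u q w
    using A2.F.pointed_iff[OF that] A2.E.pointed_iff[of u q w] that by (simp add: A2.awalk_F A2.F_sub)
  show ?case
  proof (intro equalityI subsetI)
    fix \<gamma> assume "\<gamma> \<in> f1 ` paths F1"
    then obtain u p w where a: "A1.E.awalk u p w" "w \<in> verts F1" "\<gamma> = f1 (u, p)"
      using pathsF1 by fastforce
    then have g: "\<gamma> = (u, EE.fp u p)" "A2.F.awalk u (EE.fp u p) w"
      using EE.f1_awalk[OF a(1)] F_verts by (auto simp: A2.awalk_F)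
    have "pointed_path E2 \<gamma>" using EE.image A1.E.awalk_path(1)[OF a(1)] a(3) by blast
    then show "\<gamma> \<in> {\<alpha>. pointed_path F2 \<alpha>}" using pointed[OF g(2)] g(1) by simp
  next
    fix \<gamma> assume "\<gamma> \<in> {\<alpha>. pointed_path F2 \<alpha>}"
    then obtain u q where g: "\<gamma> = (u, q)" "pointed_path F2 (u, q)" by (cases \<gamma>) auto
    then obtain w where w: "A2.E.awalk u q w" "w \<in> verts F2"
      using pathsF2 by (auto simp: pointed_path_def)
    then have "pointed_path E2 (u, q)" using pointed[of u q w] g by (simp add: A2.awalk_F)
    then obtain p where "A1.E.awalk u p w" "EE.fp u p = q"
      using EE.fp_surj[OF w(1)] A2.E.pointed_iff[OF w(1)] by blast
    then show "\<gamma> \<in> f1 ` paths F1"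
      using EE.f1_awalk(1)[of u p w] w F_verts g pathsF1 by (intro image_eqI[of _ _ "(u, p)"]) auto
  qed
qed

lemma ideal: "pointed_functor_ideal E1 E2 f0 f1 (verts E1 - verts F1)"
proof -
  have H: "verts E1 - verts F1 = verts E2 - verts F2" using EE.verts_eq F_verts by simp
  have "hereditary_set E2 (verts E1 - verts F1)" unfolding H by unfold_locales
  then interpret H2: hereditary_set E2 "verts E1 - verts F1" .
  show ?thesis
    by unfold_locales (metis no_loop H)
qed

lemma J2_eq: "hereditary_set.J E2 (verts E1 - verts F1) = A2.E.J"
  using EE.verts_eq F_verts by simp

lemma ft_isometric: "x \<in> A1.E.J \<Longrightarrow> A2.E.U (EE.ft x) = A1.E.U x"
  by (rule pointed_functor_ideal.ft_isometric[OF ideal])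

lemma ft_onto: "y \<in> A2.E.J \<Longrightarrow> \<exists>x\<in>A1.E.J. A2.E.eqv (EE.ft x) y"
  using pointed_functor_ideal.ft_onto_ideal[OF ideal] unfolding J2_eq by blast

lemma fe_F: "FF.fe g = EE.fe g"
  by (simp add: FF.fe_def EE.fe_def FF.fp_def EE.fp_def A1.F_sub(4))

lemma rest_mon_F: "A2.F.awalk u p w \<Longrightarrow> A2.rest (A2.E.mon u p) = A2.F.mon u p"
  by (induction p arbitrary: u)
    (auto simp: A2.F.awalk_Nil_iff A2.F.awalk_Cons_iff A2.rest_V A2.rest_S subst_mult A2.F_sub(3))

lemma commutes: "p \<in> A1.E.P \<Longrightarrow> A2.rest (EE.ft p) = FF.ft (A1.rest p)"
proof (induction p rule: star_polys_induct)
  case (gen g)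
  show ?case
  proof (cases g)
    case (Inl v)
    then show ?thesis using F_verts by (simp add: EE.ft_V A1.rest_V A2.rest_V FF.ft_V subst_zero)
  next
    case (Inr e)
    then have e: "e \<in> arcs E1" using gen by auto
    note w = EE.fe_awalk[OF e]
    show ?thesis
    proof (cases "head E1 e \<in> verts F1")
      case True
      then have "e \<in> arcs F1" "A2.F.awalk (tail E1 e) (EE.fe e) (head E1 e)"
        using e w F_verts by (auto simp: A1.arcs_F A2.awalk_F)
      then show ?thesis using Inr
        by (simp add: EE.ft_S A1.rest_S FF.ft_S rest_mon_F fe_F A1.F_sub(4))
    next
      case False
      then have "e \<notin> arcs F1" "head E1 e \<notin> verts F2" using F_verts by (auto simp: A1.arcs_F)
      then show ?thesis using Inr A2.rest_mon[OF w] by (simp add: EE.ft_S A1.rest_S subst_zero)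
    qed
  qed
qed (simp_all add: subst_zero subst_add subst_scalar subst_mult subst_adj)

lemma commutes_cl:
  assumes X: "X \<in> A1.E.CS"
  shows "FF.fh.hom (A1.pi.hom (A1.E.cl X)) = A2.F.cl (\<lambda>n. A2.rest (EE.ft (X n)))"
    "A2.pi.hom (EE.fh.hom (A1.E.cl X)) = A2.F.cl (\<lambda>n. A2.rest (EE.ft (X n)))"
  using X by (simp_all add: A1.pi.hom_cl FF.fh.hom_cl A2.pi.hom_cl EE.fh.hom_cl
    A1.pi.CS_subst EE.fh.CS_subst commutes A1.E.CS_P)

lemma L_ft_J:
  assumes Y: "Y \<in> A1.E.CS" "\<And>n. Y n \<in> A1.E.J"
  shows "A2.E.L (\<lambda>n. EE.ft (Y n)) = A1.E.L Y"
proof -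
  have "(\<lambda>n. A2.E.U (EE.ft (Y n))) = (\<lambda>n. A1.E.U (Y n))" using ft_isometric[OF Y(2)] by blast
  then show ?thesis
    using LIMSEQ_unique[OF A2.E.L_lim[OF EE.fh.CS_subst[OF Y(1)]]] A1.E.L_lim[OF Y(1)] by simp
qed

text \<open>
  Modulo null sequences \<open>X\<close> lies in the ideal, where \<open>f\<^sub>*\<close> preserves the norm.
\<close>

lemma jointly_injective:
  assumes X: "X \<in> A1.E.CS" and pi: "A1.F.L (\<lambda>n. A1.rest (X n)) = 0" and f: "A2.E.L (\<lambda>n. EE.ft (X n)) = 0"
  shows "A1.E.L X = 0"
proof -
  obtain Y where Y: "\<And>n. Y n \<in> A1.E.J" "Y \<in> A1.E.CS" "A1.E.L (X - Y) = 0"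
    using A1.kernel_pi[OF X pi] by blast
  have XY: "A1.E.cl X = A1.E.cl Y" using A1.E.cl_eq_iff[OF X Y(2)] Y(3) by simp
  then have "EE.fh.hom (A1.E.cl X) = EE.fh.hom (A1.E.cl Y)" by simp
  then have "A2.E.cl (\<lambda>n. EE.ft (X n)) = A2.E.cl (\<lambda>n. EE.ft (Y n))"
    by (simp add: EE.fh.hom_cl X Y(2))
  then have "A2.E.L (\<lambda>n. EE.ft (Y n)) = 0"
    using A2.E.L_eq_0[OF EE.fh.CS_subst[OF X]] A2.E.L_eq_0[OF EE.fh.CS_subst[OF Y(2)]] f by simp
  then have "A1.E.L Y = 0" using L_ft_J[OF Y(2,1)] by simp
  then show ?thesis using XY A1.E.L_eq_0[OF X] A1.E.L_eq_0[OF Y(2)] by simp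
qed

lemma lift_sequence:
  assumes Y: "Y \<in> A2.E.CS" "\<And>n. Y n \<in> A2.E.J"
  obtains Z where "Z \<in> A1.E.CS" "\<And>n. Z n \<in> A1.E.J" "A2.E.cl (\<lambda>n. EE.ft (Z n)) = A2.E.cl Y"
proof -
  have "\<forall>n. \<exists>x\<in>A1.E.J. A2.E.eqv (EE.ft x) (Y n)" using ft_onto[OF Y(2)] by blast
  then obtain Z where Z: "\<And>n. Z n \<in> A1.E.J" "\<And>n. A2.E.eqv (EE.ft (Z n)) (Y n)" by metis
  have "A1.E.U (Z m - Z n) = A2.E.U (Y m - Y n)" for m n
    using ft_isometric[OF A1.E.J_diff[OF Z(1)[of m] Z(1)[of n]]]
      A2.E.eqv_U[OF A2.E.eqv_diff[OF Z(2)[of m] Z(2)[of n]]] by (simp add: subst_diff)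
  then have CS: "Z \<in> A1.E.CS"
    using A2.E.CS_cauchy[OF Y(1)] by (intro A1.E.CS_I) (auto intro: A1.E.J_P Z)
  have fCS: "(\<lambda>n. EE.ft (Z n)) \<in> A2.E.CS" by (rule EE.fh.CS_subst[OF CS])
  have "A2.E.L ((\<lambda>n. EE.ft (Z n)) - Y) = 0"
  proof (rule A2.E.null_seq_CS(2))
    show "((\<lambda>n. EE.ft (Z n)) - Y) n \<in> A2.E.P" for n
      using A2.E.CS_P[OF fCS] A2.E.CS_P[OF Y(1)] by (simp add: A2.E.A_diff)
    show "(\<lambda>n. A2.E.U (((\<lambda>n. EE.ft (Z n)) - Y) n)) \<longlonglongrightarrow> 0"
      using Z(2) by (simp add: A2.E.eqv_def)
  qed
  then have "A2.E.cl (\<lambda>n. EE.ft (Z n)) = A2.E.cl Y" by (rule A2.E.cl_eqI[OF fCS Y(1)])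
  then show thesis using that CS Z(1) by blast
qed

text \<open>
  Lift \<open>Xa\<close> to \<open>X\<close>. Then \<open>Xb - f\<^sub>* X\<close> is in the kernel of the second canonical map, hence comes from the
  ideal on the other side, whose elements do not affect the first component.
\<close>

lemma jointly_surjective:
  assumes Xa: "Xa \<in> A1.F.CS" and Xb: "Xb \<in> A2.E.CS"
    and eq: "A2.F.cl (\<lambda>n. FF.ft (Xa n)) = A2.F.cl (\<lambda>n. A2.rest (Xb n))"
  obtains X where "X \<in> A1.E.CS" "A1.F.cl (\<lambda>n. A1.rest (X n)) = A1.F.cl Xa"
    "A2.E.cl (\<lambda>n. EE.ft (X n)) = A2.E.cl Xb"
proof -
  obtain X where X: "X \<in> A1.E.CS" "A1.F.L ((\<lambda>n. A1.rest (X n)) - Xa) = 0" using A1.surjective_pi[OF Xa] .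
  have rX: "(\<lambda>n. A1.rest (X n)) \<in> A1.F.CS" by (rule A1.pi.CS_subst[OF X(1)])
  have rXa: "A1.F.cl (\<lambda>n. A1.rest (X n)) = A1.F.cl Xa" by (rule A1.F.cl_eqI[OF rX Xa X(2)])
  define fX where "fX = (\<lambda>n. EE.ft (X n))"
  have fX: "fX \<in> A2.E.CS" unfolding fX_def by (rule EE.fh.CS_subst[OF X(1)])
  have W: "Xb - fX \<in> A2.E.CS" by (rule A2.E.S.A_diff[OF Xb fX])
  have "A2.F.cl (\<lambda>n. A2.rest (fX n)) = FF.fh.hom (A1.F.cl (\<lambda>n. A1.rest (X n)))"
    using X by (simp add: fX_def FF.fh.hom_cl rX commutes A1.E.CS_P)
  also have "\<dots> = A2.F.cl (\<lambda>n. A2.rest (Xb n))"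
    unfolding rXa using eq by (simp add: FF.fh.hom_cl Xa)
  finally have "A2.F.L ((\<lambda>n. A2.rest (Xb n)) - (\<lambda>n. A2.rest (fX n))) = 0"
    using A2.F.cl_eq_iff[OF A2.pi.CS_subst[OF Xb] A2.pi.CS_subst[OF fX]] by simp
  then have "A2.F.L (\<lambda>n. A2.rest ((Xb - fX) n)) = 0" by (simp add: fun_diff_def subst_diff)
  then obtain Y where Y: "\<And>n. Y n \<in> A2.E.J" "Y \<in> A2.E.CS" "A2.E.L ((Xb - fX) - Y) = 0"
    using A2.kernel_pi[OF W] by blast
  obtain Z where Z: "Z \<in> A1.E.CS" "\<And>n. Z n \<in> A1.E.J" "A2.E.cl (\<lambda>n. EE.ft (Z n)) = A2.E.cl Y"
    using lift_sequence[OF Y(2,1)] by blast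
  have fZ: "(\<lambda>n. EE.ft (Z n)) \<in> A2.E.CS" by (rule EE.fh.CS_subst[OF Z(1)])
  have rZ: "(\<lambda>n. A1.rest (Z n)) \<in> A1.F.CS" by (rule A1.pi.CS_subst[OF Z(1)])
  have "A1.F.L (\<lambda>n. A1.rest (Z n)) = 0"
    by (rule A1.F.null_seq_CS(2)) (use A1.F.CS_P[OF rZ] A1.rest_J[OF Z(2)] in auto)
  then have rZ0: "A1.F.cl (\<lambda>n. A1.rest (Z n)) = A1.F.cl 0" using A1.F.L_eq_0[OF rZ] by simp
  have "A1.F.cl (\<lambda>n. A1.rest ((X + Z) n)) = A1.F.cl ((\<lambda>n. A1.rest (X n)) + (\<lambda>n. A1.rest (Z n)))"
    by (simp add: plus_fun_def subst_add)
  also have "\<dots> = A1.F.cl (Xa + 0)"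
    by (rule A1.F.cl_add_cong[OF rX rZ Xa A1.F.S.A_zero rXa rZ0])
  finally have 1: "A1.F.cl (\<lambda>n. A1.rest ((X + Z) n)) = A1.F.cl Xa" by simp
  have YW: "A2.E.cl Y = A2.E.cl (Xb - fX)" using A2.E.cl_eq_iff[OF W Y(2)] Y(3) by simp
  have "A2.E.cl (\<lambda>n. EE.ft ((X + Z) n)) = A2.E.cl (fX + (\<lambda>n. EE.ft (Z n)))"
    by (simp add: fX_def plus_fun_def subst_add)
  also have "\<dots> = A2.E.cl (fX + (Xb - fX))"
    by (rule A2.E.cl_add_cong[OF fX fZ fX W refl]) (simp add: Z(3) YW)
  finally have 2: "A2.E.cl (\<lambda>n. EE.ft ((X + Z) n)) = A2.E.cl Xb" by simp
  show thesis using that[OF A1.E.CS_add[OF X(1) Z(1)] 1 2] .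
qed

abbreviation pair_map where
  "pair_map \<equiv> \<lambda>c\<in>celems A1.E.alg. (A1.pi.hom c, EE.fh.hom c)"

lemma hom_commutes: "c \<in> celems A1.E.alg \<Longrightarrow> FF.fh.hom (A1.pi.hom c) = A2.pi.hom (EE.fh.hom c)"
  by (elim A1.E.celems_E) (simp add: commutes_cl)

lemma pair_map_bij:
  "bij_betw pair_map (celems A1.E.alg)
     {(a, b). a \<in> celems A1.F.alg \<and> b \<in> celems A2.E.alg \<and> FF.fh.hom a = A2.pi.hom b}"
proof (rule bij_betw_imageI)
  show "inj_on pair_map (celems A1.E.alg)"
  proof (rule inj_onI)
    fix c c' assume c: "c \<in> celems A1.E.alg" "c' \<in> celems A1.E.alg" and eq: "pair_map c = pair_map c'"
    obtain X X' where X: "X \<in> A1.E.CS" "c = A1.E.cl X" and X': "X' \<in> A1.E.CS" "c' = A1.E.cl X'"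
      using c by (metis A1.E.celems_E)
    have Z: "X - X' \<in> A1.E.CS" by (rule A1.E.S.A_diff[OF X(1) X'(1)])
    have "A1.F.cl (\<lambda>n. A1.rest (X n)) = A1.F.cl (\<lambda>n. A1.rest (X' n))"
      "A2.E.cl (\<lambda>n. EE.ft (X n)) = A2.E.cl (\<lambda>n. EE.ft (X' n))"
      using eq c X X' by (simp_all add: A1.pi.hom_cl EE.fh.hom_cl)
    then have "A1.F.L ((\<lambda>n. A1.rest (X n)) - (\<lambda>n. A1.rest (X' n))) = 0"
      "A2.E.L ((\<lambda>n. EE.ft (X n)) - (\<lambda>n. EE.ft (X' n))) = 0"
      using A1.F.cl_eq_iff A2.E.cl_eq_iff A1.pi.CS_subst EE.fh.CS_subst X X' by blast+
    then have "A1.E.L (X - X') = 0"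
      by (intro jointly_injective[OF Z]) (simp_all add: fun_diff_def subst_diff)
    then show "c = c'" using X X' by (simp add: A1.E.cl_eq_iff)
  qed
  show "pair_map ` celems A1.E.alg
      = {(a, b). a \<in> celems A1.F.alg \<and> b \<in> celems A2.E.alg \<and> FF.fh.hom a = A2.pi.hom b}"
  proof (intro equalityI subsetI)
    fix z assume "z \<in> pair_map ` celems A1.E.alg"
    then obtain c where c: "c \<in> celems A1.E.alg" "z = (A1.pi.hom c, EE.fh.hom c)" by auto
    show "z \<in> {(a, b). a \<in> celems A1.F.alg \<and> b \<in> celems A2.E.alg \<and> FF.fh.hom a = A2.pi.hom b}"
      using c hom_commutes star_hom_closed[OF A1.pi.star_hom_hom] star_hom_closed[OF EE.fh.star_hom_hom] by simp
  next
    fix z assume "z \<in> {(a, b). a \<in> celems A1.F.alg \<and> b \<in> celems A2.E.alg \<and> FF.fh.hom a = A2.pi.hom b}"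
    then obtain a b where ab: "z = (a, b)" "a \<in> celems A1.F.alg" "b \<in> celems A2.E.alg" "FF.fh.hom a = A2.pi.hom b"
      by auto
    obtain Xa Xb where Xa: "Xa \<in> A1.F.CS" "a = A1.F.cl Xa" and Xb: "Xb \<in> A2.E.CS" "b = A2.E.cl Xb"
      using ab(2,3) by (metis A1.F.celems_E A2.E.celems_E)
    have "A2.F.cl (\<lambda>n. FF.ft (Xa n)) = A2.F.cl (\<lambda>n. A2.rest (Xb n))"
      using ab(4) Xa Xb by (simp add: FF.fh.hom_cl A2.pi.hom_cl)
    from jointly_surjective[OF Xa(1) Xb(1) this] obtain X where X: "X \<in> A1.E.CS"
      "A1.F.cl (\<lambda>n. A1.rest (X n)) = A1.F.cl Xa" "A2.E.cl (\<lambda>n. EE.ft (X n)) = A2.E.cl Xb" .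
    have "pair_map (A1.E.cl X) = z"
      using X ab(1) Xa Xb by (simp add: A1.E.cl_closed A1.pi.hom_cl EE.fh.hom_cl)
    then show "z \<in> pair_map ` celems A1.E.alg" using A1.E.cl_closed[OF X(1)] by blast
  qed
qed

theorem pullback:
  "pullback_diagram (graph_cstar E1) (graph_cstar F1) (graph_cstar E2) (graph_cstar F2)
     A1.pi.hom EE.fh.hom FF.fh.hom A2.pi.hom"
proof -
  interpret C: cstar_algebra A1.E.alg by (rule A1.E.cstar_algebra_universal)
  note hp = A1.pi.star_hom_hom and hf = EE.fh.star_hom_hom
  have "star_hom A1.E.alg (fiber_product A1.F.alg A2.E.alg FF.fh.hom A2.pi.hom) pair_map"
    unfolding star_hom_def
  proof (intro conjI ballI allI)
    have "pair_map \<in> extensional (celems A1.E.alg)" by simp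
    then show "pair_map \<in> celems A1.E.alg \<rightarrow>\<^sub>E celems (fiber_product A1.F.alg A2.E.alg FF.fh.hom A2.pi.hom)"
      using bij_betw_imp_funcset[OF pair_map_bij] by (simp add: PiE_def fiber_product_def cstar_sum_def)
    fix x assume x: "x \<in> celems A1.E.alg"
    show "pair_map (cscale A1.E.alg c x) = cscale (fiber_product A1.F.alg A2.E.alg FF.fh.hom A2.pi.hom) c (pair_map x)" for c
      using hp hf x by (simp add: star_hom_def C.scale_closed fiber_product_def cstar_sum_def)
    show "pair_map (cadj A1.E.alg x) = cadj (fiber_product A1.F.alg A2.E.alg FF.fh.hom A2.pi.hom) (pair_map x)"
      using hp hf x by (simp add: star_hom_def C.adj_closed fiber_product_def cstar_sum_def)
    fix y assume y: "y \<in> celems A1.E.alg"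
    show "pair_map (cadd A1.E.alg x y)
        = cadd (fiber_product A1.F.alg A2.E.alg FF.fh.hom A2.pi.hom) (pair_map x) (pair_map y)"
      using hp hf x y by (simp add: star_hom_def C.add_closed fiber_product_def cstar_sum_def)
    show "pair_map (cmult A1.E.alg x y)
        = cmult (fiber_product A1.F.alg A2.E.alg FF.fh.hom A2.pi.hom) (pair_map x) (pair_map y)"
      using hp hf x y by (simp add: star_hom_def C.mult_closed fiber_product_def cstar_sum_def)
  qed
  then have "star_iso A1.E.alg (fiber_product A1.F.alg A2.E.alg FF.fh.hom A2.pi.hom) pair_map"
    using pair_map_bij by (simp add: star_iso_def fiber_product_def cstar_sum_def)
  then show ?thesis
    unfolding pullback_diagram_def A1.E.graph_cstar_eq A1.F.graph_cstar_eq A2.E.graph_cstar_eq A2.F.graph_cstar_eq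
    using A1.E.cstar_algebra_universal A1.F.cstar_algebra_universal A2.E.cstar_algebra_universal
      A2.F.cstar_algebra_universal A1.pi.star_hom_hom A2.pi.star_hom_hom EE.fh.star_hom_hom FF.fh.star_hom_hom
      hom_commutes
    by blast
qed

theorem unital_pullback:
  assumes fin: "finite (verts E1)"
  shows "unital_pullback_diagram (graph_cstar E1) (graph_cstar F1) (graph_cstar E2) (graph_cstar F2)
     A1.pi.hom EE.fh.hom FF.fh.hom A2.pi.hom"
proof -
  have fin': "finite (verts F1)" "finite (verts E2)" "finite (verts F2)"
    using fin A1.F_sub(1) EE.verts_eq F_verts finite_subset by auto
  note u = A1.E.unit_elem[OF fin] A1.F.unit_elem[OF fin'(1)] A2.E.unit_elem[OF fin'(2)] A2.F.unit_elem[OF fin'(3)]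
  have "unital_map (graph_cstar E1) (graph_cstar F1) A1.pi.hom"
    by (rule unital_mapI[OF A1.E.cstar_algebra_graph u(1)]) (simp only: A1.pi_unit[OF fin] u)
  moreover have "unital_map (graph_cstar E1) (graph_cstar E2) EE.fh.hom"
    by (rule unital_mapI[OF A1.E.cstar_algebra_graph u(1)]) (simp only: EE.fh_unit u)
  moreover have "unital_map (graph_cstar F1) (graph_cstar F2) FF.fh.hom"
    by (rule unital_mapI[OF A1.F.cstar_algebra_graph u(2)]) (simp only: FF.fh_unit u)
  moreover have "unital_map (graph_cstar E2) (graph_cstar F2) A2.pi.hom"
    by (rule unital_mapI[OF A2.E.cstar_algebra_graph u(3)]) (simp only: A2.pi_unit[OF fin'(2)] u)
  ultimately show ?thesis
    unfolding unital_pullback_diagram_def unital_cstar_def using pullback u by blast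
qed

end

theorem theorem3p4:
  fixes E1 F1 :: "('v, 'e) pre_digraph"
    and E2 F2 :: "('v, 'd) pre_digraph"
    and f0 :: "'v \<Rightarrow> 'v"
    and f1 :: "('v, 'e) path \<Rightarrow> ('v, 'd) path"
  assumes "admissible F1 E1"
    and "admissible F2 E2"
    and "\<not> (\<exists>\<alpha>. is_loop E1 \<alpha>)"
    and "\<not> (\<exists>e\<in>arcs E2. tail E2 e \<in> verts E2 - verts F2 \<and> is_loop E2 (edge_path E2 e))"
    and "verts E1 = verts E2"
    and "verts F1 = verts F2"
    and "path_functor E1 E2 f0 f1"
    and "\<forall>\<alpha>\<in>paths E1. \<forall>\<beta>\<in>paths E1. path_le E2 (f1 \<alpha>) (f1 \<beta>) \<longrightarrow> path_le E1 \<alpha> \<beta>"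
    and "\<forall>v\<in>verts E1. f0 v = v"
    and "f1 ` paths E1 = {\<alpha>. pointed_path E2 \<alpha>}"
  shows "path_functor F1 F2 f0 f1 \<and>
    (\<exists>\<pi>1 \<pi>2 fs fr.
       canonical_surjection E1 F1 \<pi>1 \<and>
       canonical_surjection E2 F2 \<pi>2 \<and>
       functor_induced_hom E1 E2 f0 f1 fs \<and>
       functor_induced_hom F1 F2 f0 f1 fr \<and>
       pullback_diagram (graph_cstar E1) (graph_cstar F1) (graph_cstar E2) (graph_cstar F2)
         \<pi>1 fs fr \<pi>2 \<and>
       (finite (verts E1) \<longrightarrow>
          unital_pullback_diagram
            (graph_cstar E1) (graph_cstar F1) (graph_cstar E2) (graph_cstar F2)
            \<pi>1 fs fr \<pi>2))"
proof -
  interpret A1: admissible_inclusion F1 E1 by unfold_locales (fact assms(1))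
  interpret A2: admissible_inclusion F2 E2 by unfold_locales (fact assms(2))
  interpret pointed_pullback E1 F1 E2 F2 f0 f1
  proof unfold_locales
    show "path_le E1 \<alpha> \<beta>" if "\<alpha> \<in> paths E1" "\<beta> \<in> paths E1" "path_le E2 (f1 \<alpha>) (f1 \<beta>)" for \<alpha> \<beta>
      using assms(8) that by blast
    show "tail E2 e \<noteq> head E2 e" if "e \<in> arcs E2" "tail E2 e \<in> verts E2 - verts F2" for e
      using assms(4) that A2.E.is_loop_edge by blast
  qed (use assms in auto)
  have "path_functor F1 F2 f0 f1" by (rule functor_F)
  moreover have "canonical_surjection E1 F1 A1.pi.hom" "canonical_surjection E2 F2 A2.pi.hom"
    by (rule A1.canonical A2.canonical)+
  moreover have "functor_induced_hom E1 E2 f0 f1 EE.fh.hom" "functor_induced_hom F1 F2 f0 f1 FF.fh.hom"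
    by (rule EE.induced FF.induced)+
  ultimately show ?thesis using pullback unital_pullback by blast
qed

end
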